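(* Let $(\mathbf{G},d_N)$ be a non-abelian Carnot group endowed with the metric $d_N$ induced by a homogeneous horizontally strictly convex norm $N$. Then $(\mathbf{G},d_N)$ is a Prague space, which is moreover Lipschitz-free rigid.
   Context: Carnot groups. A Carnot group is a connected, simply connected nilpotent Lie group whose Lie algebra $\mathfrak{g}$ admits a stratification $\mathfrak{g}=V_1\oplus\dots\oplus V_r$ with $[V_1,V_i]=V_{i+1}$ for $i<r$ (and $[V_1,V_r]=0$). Via exponential coordinates it is identified with $\mathbf{G}=(\mathbb{R}^n,* )$, where $\mathbb{R}^n=\mathbb{R}^{n_1}\oplus\dots\oplus\mathbb{R}^{n_r}$, $n_i=\dim V_i$, and $*$ is the polynomial group law given by the Baker–Campbell–Hausdorff formula; the identity is $0$. The Carnot-dilations are the group automorphisms $\delta_\lambda(x^{(1)},\dots,x^{(r)})=(\lambda x^{(1)},\dots,\lambda^r x^{(r)})$, $\lambda>0$, $x^{(i)}\in\mathbb{R}^{n_i}$. A norm on $\mathbf{G}$ is a map $N:\mathbf{G}\to[0,\infty)$ with $N(g)=0\iff g=0$, $N(g^{-1})=N(g)$, $N(g*g')\le N(g)+N(g')$. It induces the left-invariant metric $d_N(g,g')=N(g^{-1}*g')$. $N$ is homogeneous if $N(\delta_\lambda(g))=\lambda N(g)$ for all $\lambda>0$, $g\in\mathbf{G}$. For $z\in\mathbb{R}^{n_1}$ the horizontal line through the origin is $l(z)=\{(sz,0,\dots,0):s\in\mathbb{R}\}$. A homogeneous norm $N$ is horizontally strictly convex if whenever $g,g'\in\mathbf{G}\setminus\{0\}$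 satisfy $N(g*g')=N(g)+N(g')$, there is $z\in\mathbb{R}^{n_1}$ with $g,g'\in l(z)$. Lipschitz-free spaces. For a metric space $(\mathcal{M},d)$, let $\mathcal{F}_0(\mathcal{M})$ be the real vector space of finitely supported $x:\mathcal{M}\to\mathbb{R}$ with $\sum_{m}x(m)=0$, normed by $\|x\|=\sup\{|\sum_m x(m)f(m)| : f:\mathcal{M}\to\mathbb{R}\ 1\text{-Lipschitz}\}$; $\mathcal{F}(\mathcal{M})$ is its completion. For $x\neq y$ put $m_{x,y}=(\chi_{\{x\}}-\chi_{\{y\}})/d(x,y)$. $E_{ext}(\mathcal{M})$ is the set of ordered pairs $(x,y)$ of distinct points such that $m_{x,y}$ is an extreme point of the closed unit ball of $\mathcal{F}(\mathcal{M})^{**}$; $V_{ext}(\mathcal{M})$ is the set of points incident with such pairs. $\mathcal{M}$ is a Prague space if $V_{ext}(\mathcal{M})$ is dense in $\mathcal{M}$, the graph $(V_{ext}(\mathcal{M}),E_{ext}(\mathcal{M}))$ is connected, and for all $x,y\in V_{ext}(\mathcal{M})$ the distance $d(x,y)$ equals the infimum of $\sum_{i=1}^k d(x_{i-1},x_i)$ over all finite sequences $x=x_0,\dots,x_k=y$ with $(x_{i-1},x_i)\in E_{ext}(\mathcal{M})$. A map $g:\mathcal{M}\to\mathcal{M}$ is an $a$-dilation ($a>0$) if $d(x,y)=a\,d(g(x),g(y))$ for all $x,y$. $\mathcal{M}$ is Lipschitz-free rigid if for every surjective linear isometry $T$ of $\mathcal{F}(\mathcal{M})$ onto itself there exist $\varepsilon\in\{\pm1\}$,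 $a>0$ and a surjective $a$-dilation $g:\mathcal{M}\to\mathcal{M}$ with $T(m_{x,y})=\varepsilon m_{g(x),g(y)}$ for all $x\ne y$. *)

theory Defs
  imports "HOL-Probability.Discrete_Topology"
begin

section \<open>Lipschitz-free spaces\<close>

definition free0 :: "('a \<Rightarrow> real) set" where
  "free0 = {x. finite {m. x m \<noteq> 0} \<and> (\<Sum>m | x m \<noteq> 0. x m) = 0}"

definition pairing :: "('a \<Rightarrow> real) \<Rightarrow> ('a \<Rightarrow> real) \<Rightarrow> real" where
  "pairing x f = (\<Sum>m | x m \<noteq> 0. x m * f m)"

definition free0_norm :: "('a::metric_space \<Rightarrow> real) \<Rightarrow> real" where
  "free0_norm x = (SUP f \<in> {f. 1-lipschitz_on UNIV f}. \<bar>pairing x f\<bar>)"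

typedef (overloaded) 'a lip1 = "{f :: 'a::metric_space \<Rightarrow> real. 1-lipschitz_on UNIV f}"
  by (rule exI[of _ "\<lambda>_. 0"]) (simp add: lipschitz_on_def)

text \<open>An element of \<open>free0\<close> is viewed as the bounded function \<open>f \<mapsto> \<Sum>\<^sub>m x(m) f(m)\<close> on the set of
  1-Lipschitz functions. The supremum norm of this function is \<open>free0_norm x\<close>, so that the closure
  of the image of \<open>free0\<close> in the Banach space of bounded functions is the completion of \<open>free0\<close>;
  see \<open>norm_lipfree_of\<close>, \<open>lipfree_of_add\<close>, \<open>lipfree_of_scale\<close>, \<open>closure_lipfree_of\<close> and the
  \<open>banach\<close> instance below. The discrete topology only serves to make all functions continuous.\<close>

definition free0_fun :: "('a::metric_space \<Rightarrow> real) \<Rightarrow> ('a lip1 discrete \<Rightarrow>\<^sub>C real)" where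
  "free0_fun x = Bcontfun (\<lambda>f. pairing x (Rep_lip1 (of_discrete f)))"

lemma pairing_superset:
  assumes "finite S" "{m. x m \<noteq> 0} \<subseteq> S"
  shows "pairing x f = (\<Sum>m\<in>S. x m * f m)"
  unfolding pairing_def using assms by (intro sum.mono_neutral_left) auto

lemma pairing_one: "pairing x (\<lambda>_. 1) = (\<Sum>m | x m \<noteq> 0. x m)"
  by (simp add: pairing_def)

lemma free0_iff: "x \<in> free0 \<longleftrightarrow> finite {m. x m \<noteq> 0} \<and> pairing x (\<lambda>_. 1) = 0"
  by (simp add: free0_def pairing_one)

lemma pairing_add:
  assumes "finite {m. x m \<noteq> 0}" "finite {m. y m \<noteq> 0}"
  shows "pairing (\<lambda>m. x m + y m) f = pairing x f + pairing y f"
proof -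
  let ?S = "{m. x m \<noteq> 0} \<union> {m. y m \<noteq> 0}"
  have "pairing (\<lambda>m. x m + y m) f = (\<Sum>m\<in>?S. (x m + y m) * f m)"
    using assms by (intro pairing_superset) auto
  moreover have "pairing x f = (\<Sum>m\<in>?S. x m * f m)" "pairing y f = (\<Sum>m\<in>?S. y m * f m)"
    using assms by (auto intro!: pairing_superset)
  ultimately show ?thesis
    by (simp add: sum.distrib algebra_simps)
qed

lemma pairing_scale:
  assumes "finite {m. x m \<noteq> 0}"
  shows "pairing (\<lambda>m. c * x m) f = c * pairing x f"
proof -
  have "pairing (\<lambda>m. c * x m) f = (\<Sum>m | x m \<noteq> 0. (c * x m) * f m)"
    using assms by (intro pairing_superset) auto
  then show ?thesis
    by (simp add: pairing_def sum_distrib_left algebra_simps)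
qed

lemma free0_zero: "(\<lambda>_. 0) \<in> free0"
  by (simp add: free0_def)

lemma free0_add: "x \<in> free0 \<Longrightarrow> y \<in> free0 \<Longrightarrow> (\<lambda>m. x m + y m) \<in> free0"
  unfolding free0_iff
  by (auto simp: pairing_add intro!: finite_subset[of _ "{m. x m \<noteq> 0} \<union> {m. y m \<noteq> 0}"])

lemma free0_scale: "x \<in> free0 \<Longrightarrow> (\<lambda>m. c * x m) \<in> free0"
  unfolding free0_iff
  by (auto simp: pairing_scale intro!: finite_subset[of _ "{m. x m \<noteq> 0}"])

lemma abs_pairing_le:
  fixes x :: "'a::metric_space \<Rightarrow> real"
  assumes "x \<in> free0" "1-lipschitz_on UNIV f"
  shows "\<bar>pairing x f\<bar> \<le> (\<Sum>m | x m \<noteq> 0. \<bar>x m\<bar> * dist m p)"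
proof -
  have "(\<Sum>m | x m \<noteq> 0. x m * f p) = 0"
    using assms(1) by (simp add: free0_def flip: sum_distrib_right)
  then have "pairing x f = (\<Sum>m | x m \<noteq> 0. x m * (f m - f p))"
    by (simp add: pairing_def right_diff_distrib sum_subtractf)
  also have "\<bar>\<dots>\<bar> \<le> (\<Sum>m | x m \<noteq> 0. \<bar>x m * (f m - f p)\<bar>)"
    by (rule sum_abs)
  also have "\<dots> \<le> (\<Sum>m | x m \<noteq> 0. \<bar>x m\<bar> * dist m p)"
  proof (rule sum_mono)
    fix m
    have "\<bar>f m - f p\<bar> \<le> dist m p"
      using assms(2) by (auto simp: lipschitz_on_def dist_real_def)
    then show "\<bar>x m * (f m - f p)\<bar> \<le> \<bar>x m\<bar> * dist m p"
      by (simp add: abs_mult mult_left_mono)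
  qed
  finally show ?thesis .
qed

lemma free0_fun_apply:
  assumes "x \<in> free0"
  shows "apply_bcontfun (free0_fun x) f = pairing x (Rep_lip1 (of_discrete f))"
proof -
  have "(\<lambda>f. pairing x (Rep_lip1 (of_discrete f))) \<in> bcontfun"
  proof (rule bcontfun_normI)
    show "continuous_on UNIV (\<lambda>f :: 'a lip1 discrete. pairing x (Rep_lip1 (of_discrete f)))"
      by (simp add: continuous_on_open_vimage open_discrete)
    show "norm (pairing x (Rep_lip1 (of_discrete f))) \<le> (\<Sum>m | x m \<noteq> 0. \<bar>x m\<bar> * dist m undefined)"
      for f using abs_pairing_le[OF assms] Rep_lip1[of "of_discrete f"] by simp
  qed
  then show ?thesis
    by (simp add: free0_fun_def Bcontfun_inverse)
qed

lemma free0_fun_zero: "free0_fun (\<lambda>_. 0) = 0"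
  by (rule bcontfun_eqI) (simp add: free0_fun_apply free0_zero pairing_def)

lemma free0_fun_add:
  "x \<in> free0 \<Longrightarrow> y \<in> free0 \<Longrightarrow> free0_fun (\<lambda>m. x m + y m) = free0_fun x + free0_fun y"
  by (rule bcontfun_eqI) (auto simp: free0_fun_apply free0_add free0_iff[of x] free0_iff[of y] pairing_add)

lemma free0_fun_scale:
  "x \<in> free0 \<Longrightarrow> free0_fun (\<lambda>m. c * x m) = c *\<^sub>R free0_fun x"
  by (rule bcontfun_eqI) (auto simp: free0_fun_apply free0_scale free0_iff[of x] pairing_scale)

lemma subspace_free0_fun: "subspace (free0_fun ` free0)"
proof (rule subspaceI)
  show "0 \<in> free0_fun ` free0"
    using free0_zero free0_fun_zero by (metis image_eqI)
  show "u + v \<in> free0_fun ` free0" if "u \<in> free0_fun ` free0" "v \<in> free0_fun ` free0" for u v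
    using that by (auto simp flip: free0_fun_add intro!: imageI free0_add)
  show "c *\<^sub>R u \<in> free0_fun ` free0" if "u \<in> free0_fun ` free0" for c u
    using that by (auto simp flip: free0_fun_scale intro!: imageI free0_scale)
qed

typedef (overloaded) 'a lipfree =
  "closure (free0_fun ` free0) :: ('a::metric_space lip1 discrete \<Rightarrow>\<^sub>C real) set"
  using closure_subset[THEN subsetD, OF imageI[OF free0_zero]] by blast

setup_lifting type_definition_lipfree

lemma subspace_lipfree:
  "subspace (closure (free0_fun ` free0) :: ('a::metric_space lip1 discrete \<Rightarrow>\<^sub>C real) set)"
proof (rule subspaceI)
  let ?F = "free0_fun ` free0 :: ('a lip1 discrete \<Rightarrow>\<^sub>C real) set"
  show "0 \<in> closure ?F"
    by (rule subsetD[OF closure_subset subspace_0[OF subspace_free0_fun]])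
  show "u + v \<in> closure ?F" if uv: "u \<in> closure ?F" "v \<in> closure ?F" for u v
  proof -
    obtain X Y where XY: "\<And>n. X n \<in> ?F" "X \<longlonglongrightarrow> u" "\<And>n. Y n \<in> ?F" "Y \<longlonglongrightarrow> v"
      using uv unfolding closure_sequential by metis
    then show ?thesis
      unfolding closure_sequential
      using tendsto_add[OF XY(2,4)] subspace_add[OF subspace_free0_fun XY(1,3)]
      by (intro exI[of _ "\<lambda>n. X n + Y n"] conjI allI)
  qed
  show "c *\<^sub>R u \<in> closure ?F" if u: "u \<in> closure ?F" for c u
  proof -
    obtain X where X: "\<And>n. X n \<in> ?F" "X \<longlonglongrightarrow> u"
      using u unfolding closure_sequential by metis
    then show ?thesis
      unfolding closure_sequential
      using tendsto_scaleR[OF tendsto_const X(2)] subspace_scale[OF subspace_free0_fun X(1)]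
      by (intro exI[of _ "\<lambda>n. c *\<^sub>R X n"] conjI allI)
  qed
qed

instantiation lipfree :: (metric_space) real_normed_vector
begin

lift_definition zero_lipfree :: "'a lipfree" is 0
  by (rule subspace_0[OF subspace_lipfree])

lift_definition plus_lipfree :: "'a lipfree \<Rightarrow> 'a lipfree \<Rightarrow> 'a lipfree" is "(+)"
  by (rule subspace_add[OF subspace_lipfree])

lift_definition minus_lipfree :: "'a lipfree \<Rightarrow> 'a lipfree \<Rightarrow> 'a lipfree" is "(-)"
  by (rule subspace_diff[OF subspace_lipfree])

lift_definition uminus_lipfree :: "'a lipfree \<Rightarrow> 'a lipfree" is "uminus"
  by (rule subspace_neg[OF subspace_lipfree])

lift_definition scaleR_lipfree :: "real \<Rightarrow> 'a lipfree \<Rightarrow> 'a lipfree" is "(*\<^sub>R)"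
  by (rule subspace_scale[OF subspace_lipfree])

lift_definition norm_lipfree :: "'a lipfree \<Rightarrow> real" is norm .

definition dist_lipfree :: "'a lipfree \<Rightarrow> 'a lipfree \<Rightarrow> real" where
  "dist_lipfree u v = norm (u - v)"

definition sgn_lipfree :: "'a lipfree \<Rightarrow> 'a lipfree" where
  "sgn_lipfree u = scaleR (inverse (norm u)) u"

definition uniformity_lipfree :: "('a lipfree \<times> 'a lipfree) filter" where
  "uniformity_lipfree = (INF e\<in>{0 <..}. principal {(u, v). dist u v < e})"

definition open_lipfree :: "'a lipfree set \<Rightarrow> bool" where
  "open_lipfree S = (\<forall>u\<in>S. \<forall>\<^sub>F (u', v) in uniformity. u' = u \<longrightarrow> v \<in> S)"

instance
proof
  fix u v w :: "'a lipfree" and a b :: real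
  show "u + v + w = u + (v + w)" "u + v = v + u" "0 + u = u" "- u + u = 0" "u - v = u + - v"
    by (transfer, simp)+
  show "a *\<^sub>R (u + v) = a *\<^sub>R u + a *\<^sub>R v" "(a + b) *\<^sub>R u = a *\<^sub>R u + b *\<^sub>R u"
    "a *\<^sub>R b *\<^sub>R u = (a * b) *\<^sub>R u" "1 *\<^sub>R u = u"
    by (transfer, simp add: scaleR_add_right scaleR_add_left)+
  show "norm u = 0 \<longleftrightarrow> u = 0" "norm (a *\<^sub>R u) = \<bar>a\<bar> * norm u"
    by (transfer, simp)+
  show "norm (u + v) \<le> norm u + norm v"
    by transfer (rule norm_triangle_ineq)
qed (rule dist_lipfree_def sgn_lipfree_def uniformity_lipfree_def open_lipfree_def)+

end

lemma dist_Rep_lipfree: "dist (Rep_lipfree u) (Rep_lipfree v) = dist u v"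
  by (simp add: dist_norm norm_lipfree.rep_eq minus_lipfree.rep_eq)

instance lipfree :: (metric_space) banach
proof
  fix X :: "nat \<Rightarrow> 'a lipfree"
  assume "Cauchy X"
  then have "Cauchy (\<lambda>n. Rep_lipfree (X n))"
    by (simp add: Cauchy_def dist_Rep_lipfree)
  then obtain L where L: "(\<lambda>n. Rep_lipfree (X n)) \<longlonglongrightarrow> L"
    by (auto simp: Cauchy_convergent_iff convergent_def)
  have "L \<in> closure (free0_fun ` free0)"
    by (rule closed_sequentially[OF closed_closure _ L]) (rule Rep_lipfree)
  then have "L = Rep_lipfree (Abs_lipfree L)"
    by (simp add: Abs_lipfree_inverse)
  with L have "X \<longlonglongrightarrow> Abs_lipfree L"
    by (metis (mono_tags, lifting) dist_Rep_lipfree lim_sequentially)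
  then show "convergent X"
    by (auto simp: convergent_def)
qed

definition lipfree_of :: "('a::metric_space \<Rightarrow> real) \<Rightarrow> 'a lipfree" where
  "lipfree_of x = Abs_lipfree (free0_fun x)"

lemma Rep_lipfree_of: "x \<in> free0 \<Longrightarrow> Rep_lipfree (lipfree_of x) = free0_fun x"
  unfolding lipfree_of_def by (intro Abs_lipfree_inverse subsetD[OF closure_subset] imageI)

lemma lipfree_of_add:
  "x \<in> free0 \<Longrightarrow> y \<in> free0 \<Longrightarrow> lipfree_of (\<lambda>m. x m + y m) = lipfree_of x + lipfree_of y"
  by (simp add: Rep_lipfree_of free0_add free0_fun_add plus_lipfree.rep_eq flip: Rep_lipfree_inject)

lemma lipfree_of_scale:
  "x \<in> free0 \<Longrightarrow> lipfree_of (\<lambda>m. c * x m) = c *\<^sub>R lipfree_of x"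
  by (simp add: Rep_lipfree_of free0_scale free0_fun_scale scaleR_lipfree.rep_eq flip: Rep_lipfree_inject)

lemma norm_lipfree_of:
  assumes "x \<in> free0"
  shows "norm (lipfree_of x) = free0_norm x"
proof (rule antisym)
  have bdd: "bdd_above ((\<lambda>f. \<bar>pairing x f\<bar>) ` {f. 1-lipschitz_on UNIV f})"
    using abs_pairing_le[OF assms] by (intro bdd_aboveI2) blast
  show "norm (lipfree_of x) \<le> free0_norm x"
    unfolding norm_lipfree.rep_eq Rep_lipfree_of[OF assms] free0_norm_def
  proof (rule norm_bound)
    fix f :: "'a lip1 discrete"
    show "norm (apply_bcontfun (free0_fun x) f) \<le> (SUP f\<in>{f. 1-lipschitz_on UNIV f}. \<bar>pairing x f\<bar>)"
      using cSUP_upper[OF Rep_lip1 bdd, of "of_discrete f"] by (simp add: free0_fun_apply assms)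
  qed
  show "free0_norm x \<le> norm (lipfree_of x)"
    unfolding free0_norm_def
  proof (rule cSUP_least)
    show "{f :: 'a \<Rightarrow> real. 1-lipschitz_on UNIV f} \<noteq> {}"
      using Rep_lip1 by blast
    fix f :: "'a \<Rightarrow> real" assume "f \<in> {f. 1-lipschitz_on UNIV f}"
    then show "\<bar>pairing x f\<bar> \<le> norm (lipfree_of x)"
      using norm_bounded[of "free0_fun x" "discrete (Abs_lip1 f)"] assms
      by (simp add: norm_lipfree.rep_eq Rep_lipfree_of free0_fun_apply discrete_inverse
          Abs_lip1_inverse)
  qed
qed

lemma closure_lipfree_of: "closure (lipfree_of ` free0) = (UNIV :: 'a::metric_space lipfree set)"
proof (rule set_eqI, rule iffI[OF UNIV_I], unfold closure_approachable, intro allI impI)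
  fix u :: "'a lipfree" and e :: real assume "e > 0"
  with Rep_lipfree[of u] obtain x where "x \<in> free0" "dist (free0_fun x) (Rep_lipfree u) < e"
    by (auto simp: closure_approachable)
  then show "\<exists>y\<in>lipfree_of ` free0. dist y u < e"
    by (auto simp: Rep_lipfree_of simp flip: dist_Rep_lipfree)
qed

definition molecule :: "'a::metric_space \<Rightarrow> 'a \<Rightarrow> 'a lipfree" where
  "molecule x y = lipfree_of (\<lambda>m. (indicator {x} m - indicator {y} m) / dist x y)"

lemma molecule_in_free0:
  "(\<lambda>m. (indicator {x} m - indicator {y} m) / dist x y) \<in> free0" for x y :: "'a::metric_space"
proof -
  let ?f = "\<lambda>m. (indicator {x} m - indicator {y} m) / dist x y :: real"
  have "{m. ?f m \<noteq> 0} \<subseteq> {x, y}"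
    by (auto simp: indicator_def split: if_splits)
  moreover from this have "pairing ?f (\<lambda>_. 1) = (\<Sum>m\<in>{x, y}. ?f m * 1)"
    by (intro pairing_superset) auto
  ultimately show ?thesis
    unfolding free0_iff
    by (cases "x = y") (auto simp: indicator_def intro: finite_subset)
qed

lift_definition bidual_embed :: "'v::real_normed_vector \<Rightarrow> (('v \<Rightarrow>\<^sub>L real) \<Rightarrow>\<^sub>L real)" is
  "\<lambda>v \<phi>. blinfun_apply \<phi> v"
  by (rule blinfun.bounded_linear_left)


section \<open>Prague spaces and Lipschitz-free rigidity\<close>

definition E_ext :: "('a::metric_space \<times> 'a) set" where
  "E_ext = {(x, y). x \<noteq> y \<and>
     bidual_embed (molecule x y) extreme_point_of
       (cball 0 1 :: (('a lipfree \<Rightarrow>\<^sub>L real) \<Rightarrow>\<^sub>L real) set)}"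

definition V_ext :: "'a::metric_space set" where
  "V_ext = Field E_ext"

text \<open>\<open>E_ext\<close> is symmetric because \<open>molecule y x = - molecule x y\<close>, so reachability along \<open>E_ext\<close>
  is connectedness of the graph.\<close>

definition prague_space :: "'a::metric_space itself \<Rightarrow> bool" where
  "prague_space _ \<longleftrightarrow>
     closure (V_ext :: 'a set) = UNIV \<and>
     (\<forall>x\<in>V_ext :: 'a set. \<forall>y\<in>V_ext. (x, y) \<in> E_ext\<^sup>*) \<and>
     (\<forall>x\<in>V_ext :: 'a set. \<forall>y\<in>V_ext.
        dist x y = Inf {\<Sum>i=1..k. dist (p (i - 1)) (p i) | (k::nat) (p :: nat \<Rightarrow> 'a).
          p 0 = x \<and> p k = y \<and> (\<forall>i\<in>{1..k}. (p (i - 1), p i) \<in> E_ext)})"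

definition dilation_map :: "real \<Rightarrow> ('a::metric_space \<Rightarrow> 'a) \<Rightarrow> bool" where
  "dilation_map a g \<longleftrightarrow> a > 0 \<and> (\<forall>x y. dist x y = a * dist (g x) (g y))"

definition lipschitz_free_rigid :: "'a::metric_space itself \<Rightarrow> bool" where
  "lipschitz_free_rigid _ \<longleftrightarrow>
     (\<forall>T :: 'a lipfree \<Rightarrow> 'a lipfree. linear T \<and> (\<forall>v. norm (T v) = norm v) \<and> surj T \<longrightarrow>
        (\<exists>\<epsilon>\<in>{1, -1}. \<exists>a. \<exists>g :: 'a \<Rightarrow> 'a. surj g \<and> dilation_map a g \<and>
           (\<forall>x y. x \<noteq> y \<longrightarrow> T (molecule x y) = \<epsilon> *\<^sub>R molecule (g x) (g y))))"


section \<open>Carnot groups in exponential coordinates\<close>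

locale lie_algebra =
  fixes bracket :: "'g::real_vector \<Rightarrow> 'g \<Rightarrow> 'g"
  assumes bilinear: "bilinear bracket"
    and alternating: "bracket x x = 0"
    and jacobi: "bracket x (bracket y z) + bracket y (bracket z x) + bracket z (bracket x y) = 0"

text \<open>Only the values \<open>V 1, \<dots>, V r\<close> are used. Nilpotency is a consequence of the stratification:
  \<open>[V\<^sub>i, V\<^sub>j] \<subseteq> V\<^sub>i\<^sub>+\<^sub>j\<close>, which is \<open>0\<close> for \<open>i + j > r\<close>.\<close>

locale stratified_lie_algebra = lie_algebra bracket
  for bracket :: "'g::real_vector \<Rightarrow> 'g \<Rightarrow> 'g" +
  fixes V :: "nat \<Rightarrow> 'g set" and r :: nat
  assumes finite_dim: "\<exists>B. finite B \<and> span B = (UNIV :: 'g set)"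
    and r_pos: "r \<ge> 1"
    and subspace: "i \<in> {1..r} \<Longrightarrow> subspace (V i)"
    and direct_sum: "\<exists>!c. (\<forall>i\<in>{1..r}. c i \<in> V i) \<and> (\<forall>i. i \<notin> {1..r} \<longrightarrow> c i = 0) \<and> x = (\<Sum>i=1..r. c i)"
    and generate: "1 \<le> i \<Longrightarrow> i < r \<Longrightarrow> span {bracket x y | x y. x \<in> V 1 \<and> y \<in> V i} = V (Suc i)"
    and top_layer: "x \<in> V 1 \<Longrightarrow> y \<in> V r \<Longrightarrow> bracket x y = 0"

definition layer :: "(nat \<Rightarrow> 'g::real_vector set) \<Rightarrow> nat \<Rightarrow> 'g \<Rightarrow> nat \<Rightarrow> 'g" where
  "layer V r x = (THE c. (\<forall>i\<in>{1..r}. c i \<in> V i) \<and> (\<forall>i. i \<notin> {1..r} \<longrightarrow> c i = 0) \<and> x = (\<Sum>i=1..r. c i))"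

definition carnot_dilation :: "(nat \<Rightarrow> 'g::real_vector set) \<Rightarrow> nat \<Rightarrow> real \<Rightarrow> 'g \<Rightarrow> 'g" where
  "carnot_dilation V r t x = (\<Sum>i=1..r. t ^ i *\<^sub>R layer V r x i)"

fun nested_bracket :: "('g::zero \<Rightarrow> 'g \<Rightarrow> 'g) \<Rightarrow> 'g list \<Rightarrow> 'g" where
  "nested_bracket br [] = 0"
| "nested_bracket br [x] = x"
| "nested_bracket br (x # y # w) = br x (nested_bracket br (y # w))"

text \<open>Dynkin's form of the Baker--Campbell--Hausdorff series,
  \[ \sum_{k \geq 1} \frac{(-1)^{k-1}}{k} \sum_{p_i + q_i > 0}
     \frac{[x^{p_1} y^{q_1} \cdots x^{p_k} y^{q_k}]}{(\sum_i (p_i + q_i)) \prod_i p_i!\, q_i!} \]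
  with right-nested brackets. In a Lie algebra of step \<open>r\<close> all brackets of more than \<open>r\<close> letters
  vanish, hence the restriction to words of length at most \<open>r\<close>, which makes the sum finite. A list
  \<open>ps\<close> of length \<open>k\<close> encodes the pairs \<open>(p\<^sub>i, q\<^sub>i)\<close>.\<close>

definition bch_degree :: "(nat \<times> nat) list \<Rightarrow> nat" where
  "bch_degree ps = (\<Sum>(p, q)\<leftarrow>ps. p + q)"

definition bch_words :: "nat \<Rightarrow> (nat \<times> nat) list set" where
  "bch_words r = {ps. ps \<noteq> [] \<and> (\<forall>(p, q)\<in>set ps. p + q > 0) \<and> bch_degree ps \<le> r}"

definition bch_coeff :: "(nat \<times> nat) list \<Rightarrow> real" where
  "bch_coeff ps = (-1) ^ (length ps - 1) /
     (real (length ps) * real (bch_degree ps) * (\<Prod>(p, q)\<leftarrow>ps. fact p * fact q))"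

definition bch :: "nat \<Rightarrow> ('g::real_vector \<Rightarrow> 'g \<Rightarrow> 'g) \<Rightarrow> 'g \<Rightarrow> 'g \<Rightarrow> 'g" where
  "bch r br x y = (\<Sum>ps\<in>bch_words r. bch_coeff ps *\<^sub>R
     nested_bracket br (concat (map (\<lambda>(p, q). replicate p x @ replicate q y) ps)))"

lemma finite_bch_words: "finite (bch_words r)"
proof (rule finite_subset)
  have len: "length ps \<le> bch_degree ps" if "\<forall>(p, q)\<in>set ps. p + q > 0" for ps
    using that by (induction ps) (auto simp: bch_degree_def)
  have deg: "p + q \<le> bch_degree ps" if "(p, q) \<in> set ps" for p q ps
    using that by (induction ps) (auto simp: bch_degree_def)
  show "bch_words r \<subseteq> {ps. set ps \<subseteq> {0..r} \<times> {0..r} \<and> length ps \<le> r}"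
    using len deg by (fastforce simp: bch_words_def)
  show "finite {ps. set ps \<subseteq> {0..r} \<times> {0..r} \<and> length ps \<le> r}"
    by (rule finite_lists_length_le) simp
qed

text \<open>The underlying manifold of the group is its Lie algebra, the exponential map being the
  identity. The finite-dimensional real vector space \<open>'g\<close>, decomposed as \<open>V 1 \<oplus> \<dots> \<oplus> V r\<close>, plays
  the role of \<open>\<real>\<^sup>n\<close>. No norm or topology on \<open>'g\<close> is assumed: an additional \<open>metric_space\<close>
  structure on \<open>'g\<close> is independent of the vector space structure, so that \<open>dist\<close> can be the metric
  induced by a homogeneous norm.\<close>

locale carnot_group = stratified_lie_algebra bracket V r
  for bracket :: "'g::real_vector \<Rightarrow> 'g \<Rightarrow> 'g" and V :: "nat \<Rightarrow> 'g set" and r :: nat +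
  fixes gmul :: "'g \<Rightarrow> 'g \<Rightarrow> 'g" and ginv :: "'g \<Rightarrow> 'g"
  assumes group: "group gmul 0 ginv"
    and gmul_eq_bch: "gmul x y = bch r bracket x y"

definition group_norm :: "('g::zero \<Rightarrow> 'g \<Rightarrow> 'g) \<Rightarrow> ('g \<Rightarrow> 'g) \<Rightarrow> ('g \<Rightarrow> real) \<Rightarrow> bool" where
  "group_norm gmul ginv N \<longleftrightarrow>
     (\<forall>g. N g \<ge> 0) \<and> (\<forall>g. N g = 0 \<longleftrightarrow> g = 0) \<and> (\<forall>g. N (ginv g) = N g) \<and>
     (\<forall>g g'. N (gmul g g') \<le> N g + N g')"

definition homogeneous ::
    "(nat \<Rightarrow> 'g::real_vector set) \<Rightarrow> nat \<Rightarrow> ('g \<Rightarrow> real) \<Rightarrow> bool" where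
  "homogeneous V r N \<longleftrightarrow> (\<forall>t>0. \<forall>g. N (carnot_dilation V r t g) = t * N g)"

definition horizontal_line :: "'g::real_vector \<Rightarrow> 'g set" where
  "horizontal_line z = {s *\<^sub>R z | s. True}"

definition horizontally_strictly_convex ::
    "(nat \<Rightarrow> 'g::real_vector set) \<Rightarrow> ('g \<Rightarrow> 'g \<Rightarrow> 'g) \<Rightarrow> ('g \<Rightarrow> real) \<Rightarrow> bool" where
  "horizontally_strictly_convex V gmul N \<longleftrightarrow>
     (\<forall>g g'. g \<noteq> 0 \<and> g' \<noteq> 0 \<and> N (gmul g g') = N g + N g' \<longrightarrow>
        (\<exists>z\<in>V 1. g \<in> horizontal_line z \<and> g' \<in> horizontal_line z))"

end

theory Submission
  imports Defs
begin

text \<open>Let \<open>M\<close> be the group with the metric of the norm, and call the pairs in \<open>E_ext\<close> edges. The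
  argument has four parts.

  Non-horizontal pairs are edges. If \<open>z\<close> lies metrically between \<open>x\<close> and \<open>y\<close> and differs from both, then
  horizontal strict convexity applied to \<open>x\<^sup>-\<^sup>1 z\<close> and \<open>z\<^sup>-\<^sup>1 y\<close> puts both on one horizontal line, so that
  \<open>x\<^sup>-\<^sup>1 y\<close> lies in the first layer. Hence no point lies between \<open>x\<close> and \<open>y\<close> when \<open>x\<^sup>-\<^sup>1 y\<close> is not
  horizontal. Closed balls are compact, which turns this into a quantitative gap
  (\<open>gap_if_no_between\<close>), and the gap makes the molecule of \<open>(x, y)\<close> extreme in the bidual
  (\<open>E_extI_gap\<close>).

  There are many edges. The group is not abelian, so it contains a nonzero vector \<open>c\<close> that is central
  and lies in a layer \<open>V s\<close> with \<open>s \<ge> 2\<close>. Then \<open>p\<^sup>-\<^sup>1 (y + \<tau> c) = p\<^sup>-\<^sup>1 y + \<tau> c\<close> is horizontal for at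
  most one \<open>\<tau>\<close>. So for every finite set \<open>P\<close> and every \<open>y\<close> there are points \<open>w\<close> arbitrarily close to \<open>y\<close>
  that are joined to all of \<open>P\<close>. For \<open>P = {x, y}\<close> such a \<open>w\<close> yields a path of two edges from \<open>x\<close> to \<open>y\<close>
  that is almost as short as the distance, so \<open>M\<close> is a Prague space (\<open>prague_spaceI\<close>).

  Rigidity. A surjective isometry \<open>T\<close> preserves the vectors of the free space that are extreme in the
  bidual (\<open>bidual_extreme_isometry\<close>), and in a space with compact balls every such nonzero vector is a
  molecule (\<open>bidual_extreme_is_molecule\<close>). So \<open>T\<close> maps \<open>\<delta>\<^sub>x - \<delta>\<^sub>y\<close> to a multiple of some \<open>\<delta>\<^sub>a - \<delta>\<^sub>b\<close>
  whenever \<open>(x, y)\<close> is an edge. Finite sets of vertices have common neighbours, so there are many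
  complete subgraphs, and the linear relations along their triangles force a vertex map \<open>g\<close> and one
  constant \<open>c\<close> with \<open>T(\<delta>\<^sub>x - \<delta>\<^sub>y) = c (\<delta>\<^bsub>g x\<^esub> - \<delta>\<^bsub>g y\<^esub>)\<close> (\<open>vertex_map_of_edge_map\<close>). The norm of this vector shows that
  \<open>g\<close> is a dilation, and the inverse of \<open>T\<close> shows that \<open>g\<close> is onto.

  Compactness of balls. A homogeneous norm is continuous at \<open>0\<close> for convergence of coordinates
  (\<open>N_tendsto_0\<close>): on a line in a layer this is homogeneity, and a general element is a product of
  elements of such lines, split off one after the other along the lower central filtration. By
  homogeneity and compactness in coordinates, sets bounded in the norm have bounded coordinates
  (\<open>N_bounded_imp_coord_subsequence\<close>).\<close>

section \<open>Functionals on the free space and Lipschitz functions\<close>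

definition dirac_diff :: "'a::metric_space \<Rightarrow> 'a \<Rightarrow> 'a lipfree" where
  "dirac_diff x y = lipfree_of (\<lambda>m. indicator {x} m - indicator {y} m)"

lemma dirac_diff_in_free0: "(\<lambda>m. indicator {x} m - indicator {y} m) \<in> free0"
proof -
  have "finite {m. indicator {x} m - indicator {y} m \<noteq> (0 :: real)}"
    by (rule finite_subset[of _ "{x, y}"]) (auto simp: indicator_def split: if_splits)
  moreover have "pairing (\<lambda>m. indicator {x} m - indicator {y} m) (\<lambda>_. 1)
      = (\<Sum>m\<in>{x, y}. (indicator {x} m - indicator {y} m) * 1)"
    by (rule pairing_superset) (auto simp: indicator_def split: if_splits)
  ultimately show ?thesis
    unfolding free0_iff by (cases "x = y") (auto simp: indicator_def)
qed

lemma pairing_dirac_diff: "pairing (\<lambda>m. indicator {x} m - indicator {y} m) f = f x - f y"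
proof -
  have "pairing (\<lambda>m. indicator {x} m - indicator {y} m) f
      = (\<Sum>m\<in>{x, y}. (indicator {x} m - indicator {y} m) * f m)"
    by (rule pairing_superset) (auto simp: indicator_def split: if_splits)
  then show ?thesis
    by (cases "x = y") (auto simp: indicator_def)
qed

lemma lipfree_of_zero: "lipfree_of (\<lambda>_. 0) = 0"
  using lipfree_of_scale[OF free0_zero, of 0] by simp

lemma lipfree_of_diff:
  assumes "x \<in> free0" "y \<in> free0"
  shows "lipfree_of (\<lambda>m. x m - y m) = lipfree_of x - lipfree_of y"
  using lipfree_of_add[OF assms(1) free0_scale[OF assms(2), of "-1"]] lipfree_of_scale[OF assms(2), of "-1"]
  by simp

lemma free0_diff: "x \<in> free0 \<Longrightarrow> y \<in> free0 \<Longrightarrow> (\<lambda>m. x m - y m) \<in> free0"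
  using free0_add[OF _ free0_scale[of y "-1"], of x] by simp

lemma molecule_conv_dirac_diff: "molecule x y = (1 / dist x y) *\<^sub>R dirac_diff x y"
  using lipfree_of_scale[OF dirac_diff_in_free0, of "1 / dist x y" x y]
  by (simp add: molecule_def dirac_diff_def)

lemma dirac_diff_self: "dirac_diff x x = 0"
  by (simp add: dirac_diff_def lipfree_of_zero)

lemma dirac_diff_conv_molecule: "dirac_diff x y = dist x y *\<^sub>R molecule x y"
  by (cases "x = y") (simp_all add: molecule_conv_dirac_diff dirac_diff_self)

lemma dirac_diff_add: "dirac_diff x y + dirac_diff y z = dirac_diff x z"
  unfolding dirac_diff_def
  by (subst lipfree_of_add[symmetric, OF dirac_diff_in_free0 dirac_diff_in_free0]) simp

lemma dirac_diff_swap: "dirac_diff y x = - dirac_diff x y"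
  using dirac_diff_add[of x y x] by (simp add: dirac_diff_self eq_neg_iff_add_eq_0 add.commute)

text \<open>The elements of the free space are functions on the set of \<open>1\<close>-Lipschitz functions, so that a
  \<open>1\<close>-Lipschitz function \<open>f\<close> acts on them by evaluation at \<open>f\<close>.\<close>

definition lip_fun :: "('a::metric_space \<Rightarrow> real) \<Rightarrow> 'a lipfree \<Rightarrow>\<^sub>L real" where
  "lip_fun f = Blinfun (\<lambda>u. apply_bcontfun (Rep_lipfree u) (discrete (Abs_lip1 f)))"

lemma lip_fun_apply:
  "blinfun_apply (lip_fun f) u = apply_bcontfun (Rep_lipfree u) (discrete (Abs_lip1 f))"
  unfolding lip_fun_def
proof (subst bounded_linear_Blinfun_apply)
  show "bounded_linear (\<lambda>u. apply_bcontfun (Rep_lipfree u) (discrete (Abs_lip1 f)))"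
  proof (rule bounded_linear_intro[where K = 1])
    show "norm (apply_bcontfun (Rep_lipfree u) (discrete (Abs_lip1 f))) \<le> norm u * 1" for u
      using norm_bounded[of "Rep_lipfree u"] by (simp add: norm_lipfree.rep_eq)
  qed (simp_all add: plus_lipfree.rep_eq scaleR_lipfree.rep_eq plus_bcontfun.rep_eq scaleR_bcontfun.rep_eq)
qed simp

lemma norm_lip_fun: "norm (lip_fun f) \<le> 1"
proof (rule norm_blinfun_bound)
  show "norm (blinfun_apply (lip_fun f) u) \<le> 1 * norm u" for u
    using norm_bounded[of "Rep_lipfree u"] by (simp add: lip_fun_apply norm_lipfree.rep_eq)
qed simp

lemma lip_fun_lipfree_of:
  assumes "1-lipschitz_on UNIV f" "x \<in> free0"
  shows "lip_fun f (lipfree_of x) = pairing x f"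
  using assms
  by (simp add: lip_fun_apply Rep_lipfree_of free0_fun_apply discrete_inverse Abs_lip1_inverse)

lemma lip_fun_dirac_diff:
  "1-lipschitz_on UNIV f \<Longrightarrow> lip_fun f (dirac_diff x y) = f x - f y"
  by (simp add: dirac_diff_def lip_fun_lipfree_of dirac_diff_in_free0 pairing_dirac_diff)

lemma lip_fun_molecule:
  "1-lipschitz_on UNIV f \<Longrightarrow> lip_fun f (molecule x y) = (f x - f y) / dist x y"
  by (simp add: molecule_conv_dirac_diff lip_fun_dirac_diff blinfun.scaleR_right)

lemma lipschitz_dist: "1-lipschitz_on UNIV (\<lambda>p. dist p y)"
  by (rule lipschitz_onI) (auto simp: dist_real_def abs_le_iff, (metis dist_commute dist_triangle le_diff_eq diff_le_eq add.commute)+)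

lemma norm_dirac_diff: "norm (dirac_diff x y) = dist x y"
proof (rule antisym)
  show "norm (dirac_diff x y) \<le> dist x y"
    unfolding dirac_diff_def norm_lipfree_of[OF dirac_diff_in_free0] free0_norm_def pairing_dirac_diff
  proof (rule cSUP_least)
    show "{f :: 'a \<Rightarrow> real. 1-lipschitz_on UNIV f} \<noteq> {}"
      using lipschitz_dist by blast
  qed (auto simp: lipschitz_on_def dist_real_def)
  have "dist x y = lip_fun (\<lambda>p. dist p y) (dirac_diff x y)"
    by (simp add: lip_fun_dirac_diff lipschitz_dist)
  also have "\<dots> \<le> norm (lip_fun (\<lambda>p. dist p y)) * norm (dirac_diff x y)"
    using norm_blinfun[of "lip_fun (\<lambda>p. dist p y)" "dirac_diff x y"] by simp
  also have "\<dots> \<le> 1 * norm (dirac_diff x y)"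
    by (intro mult_right_mono norm_lip_fun) simp
  finally show "dist x y \<le> norm (dirac_diff x y)"
    by simp
qed

lemma norm_molecule: "x \<noteq> y \<Longrightarrow> norm (molecule x y) = 1"
  by (simp add: molecule_conv_dirac_diff norm_dirac_diff)

text \<open>The weights of \<open>x\<close> add up to zero, so that the contributions of the base point \<open>p\<close> cancel.\<close>

lemma lipfree_of_eq_sum_dirac_diff:
  fixes x :: "'a::metric_space \<Rightarrow> real"
  assumes "x \<in> free0"
  shows "lipfree_of x = (\<Sum>m | x m \<noteq> 0. x m *\<^sub>R dirac_diff m p)"
proof -
  have *: "(\<lambda>k. \<Sum>m\<in>S. x m * (indicator {m} k - indicator {p} k)) \<in> free0 \<and>
      lipfree_of (\<lambda>k. \<Sum>m\<in>S. x m * (indicator {m} k - indicator {p} k)) = (\<Sum>m\<in>S. x m *\<^sub>R dirac_diff m p)"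
    if "finite S" for S
    using that
  proof induction
    case (insert m S)
    have "(\<lambda>k. x m * (indicator {m} k - indicator {p} k)) \<in> free0"
      by (rule free0_scale[OF dirac_diff_in_free0])
    then show ?case
      using insert
      by (simp add: free0_add lipfree_of_add lipfree_of_scale[OF dirac_diff_in_free0] dirac_diff_def)
  qed (simp add: free0_zero lipfree_of_zero)
  let ?S = "{m. x m \<noteq> 0}"
  have fin: "finite ?S" and sum0: "sum x ?S = 0"
    using assms by (auto simp: free0_def)
  have "(\<Sum>m\<in>?S. x m * (indicator {m} k - indicator {p} k)) = x k" for k
  proof -
    have "(\<Sum>m\<in>?S. x m * (indicator {m} k - indicator {p} k))
        = (\<Sum>m\<in>?S. x m * indicator {m} k) - sum x ?S * indicator {p} k"
      by (simp add: right_diff_distrib sum_subtractf sum_distrib_right)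
    also have "(\<Sum>m\<in>?S. x m * indicator {m} k) = (\<Sum>m\<in>?S. if m = k then x k else 0)"
      by (intro sum.cong) (auto simp: indicator_def)
    also have "\<dots> = x k"
      using fin by (simp add: sum.delta)
    finally show ?thesis
      using sum0 by simp
  qed
  with *[OF fin] show ?thesis
    by simp
qed

lemma blinfun_eq_if_eq_on_dirac_diff:
  fixes \<phi> \<psi> :: "'a::metric_space lipfree \<Rightarrow>\<^sub>L real"
  assumes "\<And>x y. \<phi> (dirac_diff x y) = \<psi> (dirac_diff x y)"
  shows "\<phi> = \<psi>"
proof (rule blinfun_eqI)
  fix u
  have "closed {u. blinfun_apply \<phi> u = blinfun_apply \<psi> u}"
    by (intro closed_Collect_eq continuous_intros)
  moreover have "lipfree_of ` free0 \<subseteq> {u. blinfun_apply \<phi> u = blinfun_apply \<psi> u}"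
    by (auto simp: lipfree_of_eq_sum_dirac_diff[where p = undefined] blinfun.sum_right
        blinfun.scaleR_right assms)
  ultimately have "closure (lipfree_of ` free0) \<subseteq> {u. blinfun_apply \<phi> u = blinfun_apply \<psi> u}"
    by (rule closure_minimal[rotated])
  then show "blinfun_apply \<phi> u = blinfun_apply \<psi> u"
    by (auto simp: closure_lipfree_of)
qed

text \<open>The differences of Dirac measures span a dense subspace, so a functional is determined by the function
  \<open>x \<mapsto> \<phi>(\<delta>\<^sub>x - \<delta>\<^sub>p)\<close> for any base point \<open>p\<close>; the hypothesis says that this function is \<open>1\<close>-Lipschitz.\<close>

lemma functional_eq_lip_fun:
  fixes \<phi> :: "'a::metric_space lipfree \<Rightarrow>\<^sub>L real"
  assumes "\<And>x y. \<phi> (dirac_diff x y) \<le> dist x y"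
  obtains h where "1-lipschitz_on UNIV h" "\<phi> = lip_fun h"
proof
  let ?h = "\<lambda>x. \<phi> (dirac_diff x undefined)"
  have eq: "?h x - ?h y = \<phi> (dirac_diff x y)" for x y
    by (simp flip: dirac_diff_add[of x y undefined] add: blinfun.add_right)
  show lip: "1-lipschitz_on UNIV ?h"
  proof (rule lipschitz_onI)
    fix x y
    show "dist (?h x) (?h y) \<le> 1 * dist x y"
      using assms[of x y] assms[of y x] eq[of x y] eq[of y x]
      by (auto simp: dist_real_def dist_commute abs_le_iff)
  qed simp
  show "\<phi> = lip_fun ?h"
    by (rule blinfun_eq_if_eq_on_dirac_diff) (simp only: lip_fun_dirac_diff[OF lip] eq)
qed

text \<open>The molecules norm the dual space. The slack \<open>e\<close> makes the constant positive, so that one can rescale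
  to the case of a \<open>1\<close>-Lipschitz function.\<close>

lemma norm_functional_le:
  fixes \<phi> :: "'a::metric_space lipfree \<Rightarrow>\<^sub>L real"
  assumes "\<And>x y. \<phi> (dirac_diff x y) \<le> C * dist x y" "C \<ge> 0"
  shows "norm \<phi> \<le> C"
proof (rule field_le_epsilon)
  fix e :: real assume "e > 0"
  define K where "K = C + e"
  have K: "K > 0"
    using assms(2) \<open>e > 0\<close> by (simp add: K_def)
  have "blinfun_apply (inverse K *\<^sub>R \<phi>) (dirac_diff x y) \<le> dist x y" for x y
  proof -
    have "\<phi> (dirac_diff x y) \<le> K * dist x y"
      using assms(1)[of x y] \<open>e > 0\<close> unfolding K_def
      by (smt (verit, best) mult_right_mono zero_le_dist)
    then show ?thesis
      using K by (simp add: blinfun.scaleR_left field_simps)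
  qed
  then obtain h where "inverse K *\<^sub>R \<phi> = lip_fun h"
    using functional_eq_lip_fun by blast
  then have "\<phi> = K *\<^sub>R lip_fun h"
    using K by (metis less_irrefl scaleR_one scaleR_scaleR right_inverse)
  then show "norm \<phi> \<le> C + e"
    using norm_lip_fun[of h] K by (simp add: K_def mult_left_le)
qed

text \<open>A cone with apex \<open>m\<close> that is too narrow to reach the other points of \<open>P\<close> is Lipschitz and detects \<open>m\<close>.\<close>

lemma separating_functional:
  fixes P :: "'a::metric_space set"
  assumes "finite P"
  obtains \<phi> :: "'a lipfree \<Rightarrow>\<^sub>L real"
  where "\<And>x y. x \<in> P \<Longrightarrow> y \<in> P \<Longrightarrow> \<phi> (dirac_diff x y) = indicator {m} x - indicator {m} y"
proof -
  obtain d where d: "d > 0" "\<And>x. x \<in> P \<Longrightarrow> x \<noteq> m \<Longrightarrow> d \<le> dist m x"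
    using finite_set_avoid[OF assms, of m] by blast
  define f where "f x = - min (dist x m) d" for x
  have lip: "1-lipschitz_on UNIV f"
  proof (rule lipschitz_onI)
    fix x y
    show "dist (f x) (f y) \<le> 1 * dist x y"
      using dist_triangle[of x m y] dist_triangle[of y m x]
      by (auto simp: f_def dist_real_def dist_commute min_def)
  qed simp
  have "f x = d * indicator {m} x - d" if "x \<in> P" for x
    using d(1) d(2)[OF that] by (auto simp: f_def indicator_def dist_commute)
  then have "(inverse d *\<^sub>R lip_fun f) (dirac_diff x y) = indicator {m} x - indicator {m} y"
    if "x \<in> P" "y \<in> P" for x y
    using d(1) that by (simp add: blinfun.scaleR_left lip_fun_dirac_diff[OF lip] right_diff_distrib[symmetric])
  then show ?thesis
    by (rule that)
qed

section \<open>Molecules that are extreme in the bidual\<close>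

text \<open>Extremality is used below only in this symmetric form, where a single vector \<open>d\<close> has to be shown
  to vanish. A proper convex combination of \<open>a\<close> and \<open>b\<close> can be moved both ways along \<open>b - a\<close>.\<close>

lemma extreme_point_of_iff_no_perturbation:
  assumes "convex C"
  shows "v extreme_point_of C \<longleftrightarrow> v \<in> C \<and> (\<forall>d. v + d \<in> C \<longrightarrow> v - d \<in> C \<longrightarrow> d = 0)"
proof (intro iffI conjI allI impI)
  show "v \<in> C" if "v extreme_point_of C"
    using that by (simp add: extreme_point_of_def)
  show "d = 0" if v: "v extreme_point_of C" and d: "v + d \<in> C" "v - d \<in> C" for d
  proof (rule ccontr)
    assume "d \<noteq> 0"
    have "v = (1 - 1 / 2) *\<^sub>R (v - d) + (1 / 2) *\<^sub>R (v + d)"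
      by (simp add: algebra_simps flip: scaleR_add_left)
    moreover have "v - d \<noteq> v + d"
    proof
      assume "v - d = v + d"
      then have "2 *\<^sub>R d = 0"
        by (simp add: scaleR_2 algebra_simps add_eq_0_iff)
      then show False
        using \<open>d \<noteq> 0\<close> by simp
    qed
    ultimately have "v \<in> open_segment (v - d) (v + d)"
      unfolding in_segment by (intro conjI exI[of _ "1 / 2"]) auto
    then show False
      using v d by (auto simp: extreme_point_of_def)
  qed
  assume R: "v \<in> C \<and> (\<forall>d. v + d \<in> C \<longrightarrow> v - d \<in> C \<longrightarrow> d = 0)"
  have False if ab: "a \<in> C" "b \<in> C" and seg: "v \<in> open_segment a b" for a b
  proof -
    obtain u where u: "a \<noteq> b" "0 < u" "u < 1" "v = (1 - u) *\<^sub>R a + u *\<^sub>R b"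
      using seg by (auto simp: in_segment)
    define m where "m = min u (1 - u)"
    have m: "m > 0" "m \<le> u" "m \<le> 1 - u"
      using u by (auto simp: m_def)
    have "v + m *\<^sub>R (b - a) = (1 - (u + m)) *\<^sub>R a + (u + m) *\<^sub>R b"
      "v - m *\<^sub>R (b - a) = (1 - (u - m)) *\<^sub>R a + (u - m) *\<^sub>R b"
      by (simp_all add: u(4) algebra_simps)
    moreover have "(1 - (u + m)) *\<^sub>R a + (u + m) *\<^sub>R b \<in> C" "(1 - (u - m)) *\<^sub>R a + (u - m) *\<^sub>R b \<in> C"
      using u m by (intro convexD[OF assms ab]; simp)+
    ultimately have "m *\<^sub>R (b - a) = 0"
      using R by metis
    then show False
      using m u by simp
  qed
  then show "v extreme_point_of C"
    using R by (auto simp: extreme_point_of_def)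
qed

lemma bidual_extreme_iff:
  "bidual_embed v extreme_point_of cball 0 1 \<longleftrightarrow>
    norm (bidual_embed v) \<le> 1 \<and>
    (\<forall>D. norm (bidual_embed v + D) \<le> 1 \<longrightarrow> norm (bidual_embed v - D) \<le> 1 \<longrightarrow> D = 0)"
  by (simp add: extreme_point_of_iff_no_perturbation)

lemma norm_bidual_embed_le: "norm (bidual_embed v) \<le> norm v"
proof (rule norm_blinfun_bound)
  show "norm (blinfun_apply (bidual_embed v) \<phi>) \<le> norm v * norm \<phi>" for \<phi>
    using norm_blinfun[of \<phi> v] by (simp add: bidual_embed.rep_eq mult.commute)
qed simp

lemma linear_isometry_inverse:
  fixes T :: "'v::real_normed_vector \<Rightarrow> 'w::real_normed_vector"
  assumes T: "linear T" "\<And>v. norm (T v) = norm v" "surj T"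
  obtains S where "linear S" "\<And>w. norm (S w) = norm w" "\<And>v. S (T v) = v" "\<And>w. T (S w) = w"
proof -
  have "inj T"
    unfolding linear_injective_0[OF T(1)] using T(2) by (metis norm_eq_zero)
  then have ST: "inv T (T v) = v" and TS: "T (inv T w) = w" for v w
    using T(3) by (simp_all add: surj_f_inv_f)
  have "linear (inv T)"
  proof (rule linearI)
    show "inv T (a + b) = inv T a + inv T b" for a b
      using ST[of "inv T a + inv T b"] by (simp add: linear_add[OF T(1)] TS)
    show "inv T (c *\<^sub>R a) = c *\<^sub>R inv T a" for a c
      using ST[of "c *\<^sub>R inv T a"] by (simp add: linear_cmul[OF T(1)] TS)
  qed
  moreover have "norm (inv T w) = norm w" for w
    using T(2)[of "inv T w"] by (simp add: TS)
  ultimately show ?thesis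
    using ST TS by (rule that)
qed

text \<open>An isometry onto has an isometric inverse \<open>S\<close>, and composing functionals with \<open>S\<close> turns a
  perturbation of \<open>T v\<close> in the bidual into a perturbation of \<open>v\<close>.\<close>

lemma bidual_extreme_isometry:
  fixes T :: "'v::real_normed_vector \<Rightarrow> 'v"
  assumes T: "linear T" "\<And>v. norm (T v) = norm v" "surj T"
    and v: "bidual_embed v extreme_point_of cball 0 1"
  shows "bidual_embed (T v) extreme_point_of cball 0 1"
proof -
  obtain S where S: "linear S" and normS: "\<And>w. norm (S w) = norm w"
    and ST: "\<And>w. S (T w) = w" and TS: "\<And>w. T (S w) = w"
    using linear_isometry_inverse[OF T] by metis
  have bT: "bounded_linear T" and bS: "bounded_linear S"
    using T(1) S T(2) normS
    by (auto simp: bounded_linear_def bounded_linear_axioms_def intro!: exI[of _ 1])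
  define TB SB where "TB = Blinfun T" and "SB = Blinfun S"
  have TB: "blinfun_apply TB = T" and SB: "blinfun_apply SB = S"
    using bT bS by (simp_all add: TB_def SB_def bounded_linear_Blinfun_apply)
  have "norm SB \<le> 1"
    by (rule norm_blinfun_bound) (simp_all add: SB normS)
  define A where "A = Blinfun (\<lambda>\<phi> :: 'v \<Rightarrow>\<^sub>L real. \<phi> o\<^sub>L SB)"
  have A: "blinfun_apply A \<phi> = \<phi> o\<^sub>L SB" for \<phi>
    unfolding A_def
    by (subst bounded_linear_Blinfun_apply)
      (simp_all add: bounded_bilinear.bounded_linear_left[OF bounded_bilinear_blinfun_compose])
  have "norm A \<le> 1"
  proof (rule norm_blinfun_bound)
    fix \<phi> :: "'v \<Rightarrow>\<^sub>L real"
    have "norm (\<phi> o\<^sub>L SB) \<le> norm \<phi> * norm SB"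
      by (rule norm_blinfun_compose)
    also have "\<dots> \<le> norm \<phi> * 1"
      using \<open>norm SB \<le> 1\<close> by (intro mult_left_mono) auto
    finally show "norm (A \<phi>) \<le> 1 * norm \<phi>"
      by (simp add: A)
  qed simp
  have compA: "norm (\<Psi> o\<^sub>L A) \<le> 1" if "norm \<Psi> \<le> 1" for \<Psi> :: "('v \<Rightarrow>\<^sub>L real) \<Rightarrow>\<^sub>L real"
    using norm_blinfun_compose[of \<Psi> A] that \<open>norm A \<le> 1\<close>
    by (meson mult_le_one norm_ge_zero order_trans)
  have emb: "bidual_embed (T v) o\<^sub>L A = bidual_embed v"
    by (rule blinfun_eqI) (simp add: bidual_embed.rep_eq A SB ST)
  show ?thesis
    unfolding bidual_extreme_iff
  proof (intro conjI allI impI)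
    have "\<bar>\<phi> (T v)\<bar> \<le> norm \<phi>" for \<phi> :: "'v \<Rightarrow>\<^sub>L real"
    proof -
      have "\<bar>bidual_embed v (\<phi> o\<^sub>L TB)\<bar> \<le> norm (bidual_embed v) * norm (\<phi> o\<^sub>L TB)"
        using norm_blinfun[of "bidual_embed v" "\<phi> o\<^sub>L TB"] by simp
      also have "\<dots> \<le> 1 * norm \<phi>"
      proof (rule mult_mono)
        show "norm (bidual_embed v) \<le> 1"
          using v by (simp add: bidual_extreme_iff)
        show "norm (\<phi> o\<^sub>L TB) \<le> norm \<phi>"
        proof (rule norm_blinfun_bound)
          show "norm ((\<phi> o\<^sub>L TB) w) \<le> norm \<phi> * norm w" for w
            using norm_blinfun[of \<phi> "T w"] by (simp add: TB T(2))
        qed simp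
      qed auto
      finally show ?thesis
        by (simp add: bidual_embed.rep_eq TB)
    qed
    then show "norm (bidual_embed (T v)) \<le> 1"
      by (intro norm_blinfun_bound) (auto simp: bidual_embed.rep_eq)
    fix D assume "norm (bidual_embed (T v) + D) \<le> 1" "norm (bidual_embed (T v) - D) \<le> 1"
    moreover have "(bidual_embed (T v) + D) o\<^sub>L A = bidual_embed v + (D o\<^sub>L A)"
      "(bidual_embed (T v) - D) o\<^sub>L A = bidual_embed v - (D o\<^sub>L A)"
      by (simp_all flip: emb add: bounded_bilinear.add_left[OF bounded_bilinear_blinfun_compose]
          bounded_bilinear.diff_left[OF bounded_bilinear_blinfun_compose])
    ultimately have "norm (bidual_embed v + (D o\<^sub>L A)) \<le> 1" "norm (bidual_embed v - (D o\<^sub>L A)) \<le> 1"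
      using compA by metis+
    then have "D o\<^sub>L A = 0"
      using v by (simp add: bidual_extreme_iff)
    then have "D ((\<phi> o\<^sub>L TB) o\<^sub>L SB) = 0" for \<phi>
      by (metis A blinfun_apply_blinfun_compose zero_blinfun.rep_eq)
    moreover have "(\<phi> o\<^sub>L TB) o\<^sub>L SB = \<phi>" for \<phi> :: "'v \<Rightarrow>\<^sub>L real"
      by (rule blinfun_eqI) (simp add: TB SB TS)
    ultimately show "D = 0"
      by (intro blinfun_eqI) simp
  qed
qed

text \<open>The cross difference \<open>a' * b - a * b'\<close> can be split in two ways, one with total weight \<open>a + b\<close> and
  one with total weight \<open>a' + b'\<close>. The maximum on the left is what later confines steep pairs to
  points that are almost between \<open>x\<close> and \<open>y\<close>.\<close>

lemma lipschitz_quotient_bound: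
  fixes a b a' b' D :: real
  assumes "a \<ge> 0" "b \<ge> 0" "a' \<ge> 0" "b' \<ge> 0" "\<bar>a' - a\<bar> \<le> D" "\<bar>b' - b\<bar> \<le> D" "a + b > 0" "a' + b' > 0"
  shows "(b / (a + b) - b' / (a' + b')) * max (a + b) (a' + b') \<le> D"
proof -
  have eq: "b / (a + b) - b' / (a' + b') = (a' * b - a * b') / ((a + b) * (a' + b'))"
    using assms by (simp add: field_simps)
  have "a' * b - a * b' = a' * (b - b') + b' * (a' - a)"
    by (simp add: algebra_simps)
  also have "\<dots> \<le> a' * D + b' * D"
    using assms by (intro add_mono mult_left_mono) auto
  finally have 1: "a' * b - a * b' \<le> D * (a' + b')"
    by (simp add: algebra_simps)
  have "a' * b - a * b' = b * (a' - a) + a * (b - b')"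
    by (simp add: algebra_simps)
  also have "\<dots> \<le> b * D + a * D"
    using assms by (intro add_mono mult_left_mono) auto
  finally have 2: "a' * b - a * b' \<le> D * (a + b)"
    by (simp add: algebra_simps)
  have max1: "X / (A * B) * A \<le> D" if "X \<le> D * B" "A > 0" "B > 0" for X A B :: real
    using that by (simp add: field_simps)
  have max2: "X / (A * B) * B \<le> D" if "X \<le> D * A" "A > 0" "B > 0" for X A B :: real
    using that by (simp add: field_simps)
  show ?thesis
    unfolding eq using max1[OF 1 assms(7,8)] max2[OF 2 assms(7,8)] by (simp add: max_def)
qed

text \<open>The function \<open>g\<close> below, \<open>d(x,y)\<close> times the ratio \<open>d(t,y) / (d(t,x) + d(t,y))\<close> up to a constant, is
  \<open>1\<close>-Lipschitz and has slope at most \<open>d(x,y) / (d(t,x) + d(t,y))\<close> at every pair containing \<open>t\<close>. If the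
  slope at \<open>(p, q)\<close> exceeds \<open>1 - \<kappa>\<close>, the gap hypothesis therefore puts each of \<open>p\<close> and \<open>q\<close> near \<open>x\<close> or
  near \<open>y\<close>. To rule out that both are near the same point, the slope of \<open>g\<close> is reduced by the factor
  \<open>1 - \<kappa>\<close> on its two extreme ranges of width \<open>\<eta>\<close>. This costs only \<open>2 * \<kappa> * \<eta>\<close> of the rise from \<open>y\<close> to
  \<open>x\<close>, a quantity that is small compared with \<open>\<kappa>\<close>.\<close>

lemma peaking_function:
  fixes x y :: "'a::metric_space"
  assumes d: "x \<noteq> y" and \<eta>: "\<eta> > 0" "2 * \<eta> < dist x y" and \<kappa>: "\<kappa> > 0" "\<kappa> < 1"
    and gap: "\<And>z. (1 - \<kappa>) * (dist x z + dist z y) < dist x y \<Longrightarrow> dist z x < \<eta> \<or> dist z y < \<eta>"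
  obtains f where "1-lipschitz_on UNIV f" "f x - f y \<ge> dist x y - 2 * \<kappa> * \<eta>"
    "\<And>p q. f p - f q > (1 - \<kappa>) * dist p q \<Longrightarrow> dist p x < \<eta> \<and> dist q y < \<eta>"
proof -
  let ?d = "dist x y"
  let ?s = "\<lambda>t. dist t x + dist t y"
  define g where "g t = ?d * (dist t y / ?s t) - ?d / 2" for t
  define clamp where "clamp t = max (\<eta> - ?d / 2) (min (?d / 2 - \<eta>) t)" for t
  define f where "f t = (1 - \<kappa>) * g t + \<kappa> * clamp (g t)" for t
  have "?d > 0"
    using d by simp
  have s: "?s t \<ge> ?d" "?s t > 0" for t
    using dist_triangle3[of x y t] \<open>?d > 0\<close> unfolding dist_commute[of t] by linarith+
  have g_max: "(g p - g q) * max (?s p) (?s q) \<le> ?d * dist p q" for p q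
  proof -
    have "(dist p y / ?s p - dist q y / ?s q) * max (?s p) (?s q) \<le> dist p q"
      using s(2)[of p] s(2)[of q] abs_dist_diff_le[of q x p] abs_dist_diff_le[of q y p]
      by (intro lipschitz_quotient_bound) (simp_all add: dist_commute)
    then have "?d * ((dist p y / ?s p - dist q y / ?s q) * max (?s p) (?s q)) \<le> ?d * dist p q"
      by (intro mult_left_mono) auto
    then show ?thesis
      by (simp add: g_def algebra_simps)
  qed
  have g_lip: "g p - g q \<le> dist p q" for p q
  proof (cases "g p - g q \<le> 0")
    case False
    then have "(g p - g q) * ?d \<le> (g p - g q) * max (?s p) (?s q)"
      using s(1) by (intro mult_left_mono) (auto simp: le_max_iff_disj)
    also have "\<dots> \<le> dist p q * ?d"
      using g_max[of p q] by (simp add: mult.commute)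
    finally show ?thesis
      using \<open>?d > 0\<close> by simp
  qed (use zero_le_dist[of p q] in linarith)
  have clamp_mono: "0 \<le> clamp t - clamp s \<and> clamp t - clamp s \<le> t - s" if "s \<le> t" for s t
    using that \<eta> by (auto simp: clamp_def)
  have f_g: "f p - f q \<le> g p - g q" if "g q \<le> g p" for p q
  proof -
    have "\<kappa> * (clamp (g p) - clamp (g q)) \<le> \<kappa> * (g p - g q)"
      using clamp_mono[OF that] \<kappa> by (intro mult_left_mono) auto
    then show ?thesis
      by (simp add: f_def algebra_simps)
  qed
  have f_neg: "f p - f q \<le> 0" if "g p \<le> g q" for p q
  proof -
    have "\<kappa> * (clamp (g p) - clamp (g q)) \<le> 0" "(1 - \<kappa>) * (g p - g q) \<le> 0"
      using clamp_mono[OF that] \<kappa> that by (auto intro!: mult_nonneg_nonpos)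
    then show ?thesis
      by (simp add: f_def algebra_simps)
  qed
  have f_le: "f p - f q \<le> dist p q" for p q
    using f_g[of q p] f_neg[of p q] g_lip[of p q] zero_le_dist[of p q] by linarith
  have gx: "g x = ?d / 2" and gy: "g y = - ?d / 2"
    using d by (simp_all add: g_def dist_commute)
  have near_x: "g t > ?d / 2 - \<eta>" if "dist t x < \<eta>" for t
    using g_lip[of x t] that by (simp add: gx dist_commute)
  have near_y: "g t < \<eta> - ?d / 2" if "dist t y < \<eta>" for t
    using g_lip[of t y] that by (simp add: gy dist_commute)
  show ?thesis
  proof
    show "1-lipschitz_on UNIV f"
    proof (rule lipschitz_onI)
      show "dist (f p) (f q) \<le> 1 * dist p q" for p q
        using f_le[of p q] f_le[of q p] by (auto simp: dist_real_def dist_commute abs_le_iff)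
    qed simp
    have "clamp (g x) = ?d / 2 - \<eta>" "clamp (g y) = \<eta> - ?d / 2"
      using \<eta> by (auto simp: clamp_def gx gy)
    then have "f x - f y
        = ((1 - \<kappa>) * (?d / 2) + \<kappa> * (?d / 2 - \<eta>)) - ((1 - \<kappa>) * (- ?d / 2) + \<kappa> * (\<eta> - ?d / 2))"
      by (simp only: f_def gx gy)
    also have "\<dots> = ?d - 2 * \<kappa> * \<eta>"
      by (simp add: field_simps)
    finally show "f x - f y \<ge> ?d - 2 * \<kappa> * \<eta>"
      by simp
    fix p q assume slope: "f p - f q > (1 - \<kappa>) * dist p q"
    have pos: "(1 - \<kappa>) * dist p q \<ge> 0"
      using \<kappa> by simp
    then have gpq: "g q < g p" and gsl: "g p - g q > (1 - \<kappa>) * dist p q"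
      using slope f_neg[of p q] f_g[of q p] by linarith+
    have "dist p q > 0"
      using slope by (cases "p = q") auto
    have "(1 - \<kappa>) * max (?s p) (?s q) < ?d"
    proof -
      have "max (?s p) (?s q) > 0"
        using s(2)[of p] by (simp add: less_max_iff_disj)
      then have "(1 - \<kappa>) * dist p q * max (?s p) (?s q) < (g p - g q) * max (?s p) (?s q)"
        using gsl by (intro mult_strict_right_mono)
      then have "dist p q * ((1 - \<kappa>) * max (?s p) (?s q)) < dist p q * ?d"
        using g_max[of p q] by (simp add: mult_ac)
      then show ?thesis
        using \<open>dist p q > 0\<close> by simp
    qed
    moreover have "(1 - \<kappa>) * ?s p \<le> (1 - \<kappa>) * max (?s p) (?s q)"
      "(1 - \<kappa>) * ?s q \<le> (1 - \<kappa>) * max (?s p) (?s q)"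
      using \<kappa> by (intro mult_left_mono; simp)+
    ultimately have "(1 - \<kappa>) * ?s p < ?d" "(1 - \<kappa>) * ?s q < ?d"
      by linarith+
    then have near: "dist p x < \<eta> \<or> dist p y < \<eta>" "dist q x < \<eta> \<or> dist q y < \<eta>"
      using gap[of p] gap[of q] by (simp_all add: dist_commute)
    have no: False if "clamp (g p) = clamp (g q)"
    proof -
      have "f p - f q = (1 - \<kappa>) * (g p - g q)"
        using that by (simp add: f_def algebra_simps)
      also have "\<dots> \<le> (1 - \<kappa>) * dist p q"
        using g_lip \<kappa> by (intro mult_left_mono) auto
      finally show False
        using slope by simp
    qed
    have "\<not> (dist p x < \<eta> \<and> dist q x < \<eta>)"
      using no near_x[of p] near_x[of q] \<eta> by (auto simp: clamp_def)
    moreover have "\<not> (dist p y < \<eta> \<and> dist q y < \<eta>)"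
      using no near_y[of p] near_y[of q] \<eta> by (auto simp: clamp_def)
    moreover have "\<not> (dist p y < \<eta> \<and> dist q x < \<eta>)"
      using gpq near_y[of p] near_x[of q] \<eta> by linarith
    ultimately show "dist p x < \<eta> \<and> dist q y < \<eta>"
      using near by blast
  qed
qed

lemma quotient_perturbation:
  fixes a b a' b' \<eta> :: real
  assumes "\<bar>a\<bar> \<le> b" "b > 0" "b' > 0" "a \<le> a' + 2 * \<eta>" "\<bar>b - b'\<bar> \<le> 2 * \<eta>"
  shows "a / b \<le> a' / b' + 4 * \<eta> / b'"
proof -
  have "\<bar>(a / b) * (b' - b)\<bar> \<le> 1 * (2 * \<eta>)"
    unfolding abs_mult using assms by (intro mult_mono) (auto simp: abs_minus_commute)
  then have "(a / b) * (b' - b) \<le> 2 * \<eta>"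
    by linarith
  moreover have "(a / b) * (b' - b) = (a / b) * b' - a"
    using assms by (simp add: right_diff_distrib)
  ultimately have "(a / b) * b' \<le> a + 2 * \<eta>"
    by linarith
  also have "\<dots> \<le> a' + 4 * \<eta>"
    using assms by simp
  finally have "a / b \<le> (a' + 4 * \<eta>) / b'"
    using assms by (simp add: pos_le_divide_eq)
  then show ?thesis
    by (simp add: add_divide_distrib)
qed

text \<open>Let \<open>u\<close> be the molecule of \<open>(x, y)\<close>, let \<open>u + D\<close> and \<open>u - D\<close> lie in the unit ball of the bidual, and let
  \<open>h\<close> be \<open>1\<close>-Lipschitz. For the peaking function \<open>f\<close> and \<open>t = \<kappa> / 2\<close>, the function \<open>f + t h\<close> has slope at
  most \<open>1 + t h(u) + t \<delta>\<close>: where the slope of \<open>f\<close> is at most \<open>1 - \<kappa>\<close> there is room for \<open>t h\<close>, and elsewhere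
  the pair is close to \<open>(x, y)\<close>, so that \<open>h\<close> has nearly the slope \<open>h(u)\<close> there. As \<open>f(u) \<ge> 1 - t \<delta>\<close>, the
  choice of sign with \<open>s D(f) \<ge> 0\<close> leaves \<open>s D(h) \<le> 2 \<delta>\<close>, and \<open>\<delta>\<close> is arbitrarily small.\<close>

theorem E_extI_gap:
  fixes x y :: "'a::metric_space"
  assumes xy: "x \<noteq> y"
    and gap: "\<And>\<eta>. \<eta> > 0 \<Longrightarrow> \<exists>\<kappa>>0. \<kappa> < 1 \<and>
      (\<forall>z. (1 - \<kappa>) * (dist x z + dist z y) < dist x y \<longrightarrow> dist z x < \<eta> \<or> dist z y < \<eta>)"
  shows "(x, y) \<in> E_ext"
proof -
  let ?d = "dist x y" and ?u = "molecule x y"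
  have "?d > 0"
    using xy by simp
  have key: "s * D (lip_fun h) \<le> 8 * \<eta> / ?d"
    if D: "norm (bidual_embed ?u + s *\<^sub>R D) \<le> 1" and h: "1-lipschitz_on UNIV h"
      and \<eta>: "\<eta> > 0" "2 * \<eta> < ?d"
      and f: "1-lipschitz_on UNIV f" "f x - f y \<ge> ?d - 2 * \<kappa> * \<eta>"
        "\<And>p q. f p - f q > (1 - \<kappa>) * dist p q \<Longrightarrow> dist p x < \<eta> \<and> dist q y < \<eta>"
      and \<kappa>: "\<kappa> > 0" "\<kappa> < 1" and s: "s * D (lip_fun f) \<ge> 0"
    for D s h \<eta> f \<kappa>
  proof -
    define t where "t = \<kappa> / 2"
    define \<delta> where "\<delta> = 4 * \<eta> / ?d"
    define C where "C = 1 + t * (h x - h y) / ?d + t * \<delta>"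
    have t: "0 < t" "t < 1"
      using \<kappa> by (auto simp: t_def)
    have \<delta>: "\<delta> > 0"
      using \<eta> \<open>?d > 0\<close> by (simp add: \<delta>_def)
    have h_le: "\<bar>h p - h q\<bar> \<le> dist p q" for p q
      using h by (auto simp: lipschitz_on_def dist_real_def)
    have f_le: "f p - f q \<le> dist p q" for p q
      using f(1) by (force simp: lipschitz_on_def dist_real_def abs_le_iff)
    have "t * (h x - h y) \<ge> t * - ?d"
      using t h_le[of x y] by (intro mult_left_mono) auto
    then have hu: "t * (h x - h y) / ?d \<ge> - t"
      using \<open>?d > 0\<close> by (simp add: field_simps)
    have "t * \<delta> > 0"
      using t \<delta> by simp
    then have "C \<ge> 1 - t" "C \<ge> 0"
      using hu t unfolding C_def by linarith+
    have bound: "f p - f q + t * (h p - h q) \<le> C * dist p q" for p q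
    proof (cases "f p - f q \<le> (1 - \<kappa>) * dist p q")
      case True
      have "t * (h p - h q) \<le> t * dist p q"
        using t h_le[of p q] by (intro mult_left_mono) auto
      moreover have "(1 - \<kappa>) * dist p q + t * dist p q = (1 - t) * dist p q"
        by (simp add: t_def field_simps)
      ultimately have "f p - f q + t * (h p - h q) \<le> (1 - t) * dist p q"
        using True by linarith
      also have "\<dots> \<le> C * dist p q"
        using \<open>C \<ge> 1 - t\<close> by (intro mult_right_mono) auto
      finally show ?thesis .
    next
      case False
      then have near: "dist p x < \<eta>" "dist q y < \<eta>"
        using f(3)[of p q] by auto
      have "?d \<le> dist p x + dist p q + dist q y"
        using dist_triangle[of x y p] dist_triangle[of p y q] by (simp add: dist_commute)
      moreover have "dist p q \<le> dist p x + ?d + dist q y"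
        using dist_triangle[of p q x] dist_triangle[of x q y] by (simp add: dist_commute)
      ultimately have pq: "dist p q > 0" "\<bar>dist p q - ?d\<bar> \<le> 2 * \<eta>"
        using near \<eta> by linarith+
      have "(h p - h q) / dist p q \<le> (h x - h y) / ?d + \<delta>"
        unfolding \<delta>_def
        using h_le[of p q] h_le[of p x] h_le[of y q] near pq \<open>?d > 0\<close>
        by (intro quotient_perturbation) (auto simp: dist_commute)
      then have "h p - h q \<le> ((h x - h y) / ?d + \<delta>) * dist p q"
        using pq by (simp add: pos_divide_le_eq)
      then have "t * (h p - h q) \<le> t * (((h x - h y) / ?d + \<delta>) * dist p q)"
        using t by (intro mult_left_mono) auto
      then show ?thesis
        using f_le[of p q] by (simp add: C_def algebra_simps)
    qed
    let ?F = "lip_fun f + t *\<^sub>R lip_fun h"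
    have "norm ?F \<le> C"
      using bound \<open>C \<ge> 0\<close>
      by (intro norm_functional_le)
        (simp_all add: blinfun.add_left blinfun.scaleR_left lip_fun_dirac_diff f(1) h)
    have "(bidual_embed ?u + s *\<^sub>R D) ?F \<le> norm (bidual_embed ?u + s *\<^sub>R D) * norm ?F"
      using norm_blinfun[of "bidual_embed ?u + s *\<^sub>R D" ?F] by simp
    also have "\<dots> \<le> 1 * norm ?F"
      using D by (intro mult_right_mono) auto
    also have "\<dots> \<le> C"
      using \<open>norm ?F \<le> C\<close> by simp
    finally have "(f x - f y) / ?d + t * (h x - h y) / ?d + s * D (lip_fun f) + t * (s * D (lip_fun h)) \<le> C"
      by (simp add: blinfun.add_left blinfun.scaleR_left blinfun.add_right blinfun.scaleR_right
          bidual_embed.rep_eq lip_fun_molecule f(1) h algebra_simps)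
    moreover have "(f x - f y) / ?d \<ge> (?d - 2 * \<kappa> * \<eta>) / ?d"
      using f(2) \<open>?d > 0\<close> by (intro divide_right_mono) auto
    moreover have "(?d - 2 * \<kappa> * \<eta>) / ?d = 1 - t * \<delta>"
      using \<open>?d > 0\<close> by (simp add: t_def \<delta>_def field_simps)
    ultimately have "t * (s * D (lip_fun h)) \<le> t * (2 * \<delta>)"
      using s by (simp add: C_def algebra_simps)
    then have "s * D (lip_fun h) \<le> 2 * \<delta>"
      using t by simp
    then show ?thesis
      by (simp add: \<delta>_def)
  qed
  have "D = 0" if D: "norm (bidual_embed ?u + D) \<le> 1" "norm (bidual_embed ?u - D) \<le> 1" for D
  proof -
    have zero: "D (lip_fun h) = 0" if h: "1-lipschitz_on UNIV h" for h
    proof -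
      have "\<bar>D (lip_fun h)\<bar> \<le> 0"
      proof (rule field_le_epsilon)
        fix e :: real assume "e > 0"
        define \<eta> where "\<eta> = min (?d / 3) (e * ?d / 8)"
        have \<eta>: "\<eta> > 0" "2 * \<eta> < ?d" "8 * \<eta> / ?d \<le> e"
          using \<open>e > 0\<close> \<open>?d > 0\<close> by (auto simp: \<eta>_def field_simps min_def)
        obtain \<kappa> where \<kappa>: "\<kappa> > 0" "\<kappa> < 1"
          and gap': "\<And>z. (1 - \<kappa>) * (dist x z + dist z y) < dist x y \<Longrightarrow> dist z x < \<eta> \<or> dist z y < \<eta>"
          using gap[OF \<eta>(1)] by blast
        obtain f where f: "1-lipschitz_on UNIV f" "f x - f y \<ge> ?d - 2 * \<kappa> * \<eta>"
          "\<And>p q. f p - f q > (1 - \<kappa>) * dist p q \<Longrightarrow> dist p x < \<eta> \<and> dist q y < \<eta>"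
          using peaking_function[OF xy \<eta>(1,2) \<kappa> gap'] by blast
        obtain s where s: "\<bar>s\<bar> = (1 :: real)" "s * D (lip_fun f) \<ge> 0" "norm (bidual_embed ?u + s *\<^sub>R D) \<le> 1"
        proof (cases "D (lip_fun f) \<ge> 0")
          case True then show ?thesis using D by (intro that[of 1]) auto
        next
          case False then show ?thesis using D by (intro that[of "- 1"]) auto
        qed
        have nh: "1-lipschitz_on UNIV (\<lambda>p. - h p)"
          using h by simp
        have "lip_fun (\<lambda>p. - h p) = - lip_fun h"
          by (rule blinfun_eq_if_eq_on_dirac_diff)
            (simp add: blinfun.minus_left lip_fun_dirac_diff[OF nh] lip_fun_dirac_diff[OF h])
        then have "s * D (lip_fun h) \<le> e" "- (s * D (lip_fun h)) \<le> e"
          using key[OF s(3) h \<eta>(1,2) f \<kappa> s(2)] key[OF s(3) nh \<eta>(1,2) f \<kappa> s(2)] \<eta>(3)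
          by (simp_all add: blinfun.minus_right)
        then have "\<bar>s * D (lip_fun h)\<bar> \<le> e"
          by linarith
        then show "\<bar>D (lip_fun h)\<bar> \<le> 0 + e"
          using s(1) by (simp add: abs_mult)
      qed
      then show ?thesis by simp
    qed
    show "D = 0"
    proof (rule blinfun_eqI)
      fix \<phi> :: "'a lipfree \<Rightarrow>\<^sub>L real"
      define K where "K = norm \<phi> + 1"
      have K: "K > 0"
        by (simp add: K_def add_nonneg_pos)
      have "(inverse K *\<^sub>R \<phi>) (dirac_diff p q) \<le> dist p q" for p q
      proof -
        have "\<phi> (dirac_diff p q) \<le> norm \<phi> * dist p q"
          using norm_blinfun[of \<phi> "dirac_diff p q"] by (simp add: norm_dirac_diff)
        also have "\<dots> \<le> K * dist p q"
          by (intro mult_right_mono) (auto simp: K_def)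
        finally show ?thesis
          using K by (simp add: blinfun.scaleR_left field_simps)
      qed
      then obtain h where "1-lipschitz_on UNIV h" "inverse K *\<^sub>R \<phi> = lip_fun h"
        by (rule functional_eq_lip_fun)
      then have "D (inverse K *\<^sub>R \<phi>) = 0"
        using zero by simp
      then show "D \<phi> = blinfun_apply 0 \<phi>"
        using K by (simp add: blinfun.scaleR_right)
    qed
  qed
  then have "bidual_embed ?u extreme_point_of cball 0 1"
    using norm_bidual_embed_le[of ?u] norm_molecule[OF xy] by (simp add: bidual_extreme_iff)
  then show ?thesis
    using xy by (simp add: E_ext_def)
qed

section \<open>Hahn--Banach and means on bounded functions\<close>

definition sublinear :: "('z::real_vector \<Rightarrow> real) \<Rightarrow> bool" where
  "sublinear P \<longleftrightarrow> (\<forall>x y. P (x + y) \<le> P x + P y) \<and> (\<forall>c>0. \<forall>x. P (c *\<^sub>R x) \<le> c * P x)"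

lemma sublinear_add: "sublinear P \<Longrightarrow> P (x + y) \<le> P x + P y"
  and sublinear_scale_le: "sublinear P \<Longrightarrow> c > 0 \<Longrightarrow> P (c *\<^sub>R x) \<le> c * P x"
  by (auto simp: sublinear_def)

lemma sublinear_zero:
  assumes "sublinear P" shows "P 0 = 0"
  using sublinear_scale_le[OF assms, of 2 0] sublinear_scale_le[OF assms, of "1 / 2" 0] by simp

lemma sublinear_scale:
  assumes "sublinear P" "c \<ge> 0" shows "P (c *\<^sub>R x) = c * P x"
proof (cases "c = 0")
  case False
  then have "c > 0"
    using assms(2) by simp
  moreover from this have "P x \<le> (1 / c) * P (c *\<^sub>R x)"
    using sublinear_scale_le[OF assms(1), of "1 / c" "c *\<^sub>R x"] by simp
  ultimately show ?thesis
    using sublinear_scale_le[OF assms(1), of c x] by (simp add: field_simps)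
qed (simp add: sublinear_zero assms(1))

lemma sublinear_ge_minus:
  assumes "sublinear P" shows "- P (- x) \<le> P x"
  using sublinear_add[OF assms, of x "- x"] sublinear_zero[OF assms] by simp

text \<open>Zorn's lemma applies because the pointwise infimum of a chain is again sublinear; it is finite since
  every member \<open>Q\<close> satisfies \<open>Q x \<ge> - P (- x)\<close>.\<close>

lemma minimal_sublinear_exists:
  assumes P: "sublinear (P :: 'z::real_vector \<Rightarrow> real)"
  obtains Q where "sublinear Q" "\<And>x. Q x \<le> P x"
    "\<And>R. sublinear R \<Longrightarrow> (\<And>x. R x \<le> Q x) \<Longrightarrow> R = Q"
proof -
  define A where "A = {Q. sublinear Q \<and> Q \<le> P}"
  let ?less = "\<lambda>Q R :: 'z \<Rightarrow> real. R \<le> Q"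
  have "\<exists>m\<in>A. \<forall>a\<in>A. a \<le> m \<longrightarrow> a = m"
  proof (rule predicate_Zorn)
    show "partial_order_on A (relation_of ?less A)"
      by (rule partial_order_on_relation_ofI) auto
    fix C assume "C \<in> Chains (relation_of ?less A)"
    then have C: "\<And>Q. Q \<in> C \<Longrightarrow> sublinear Q \<and> Q \<le> P"
      and chain: "\<And>Q R. Q \<in> C \<Longrightarrow> R \<in> C \<Longrightarrow> Q \<le> R \<or> R \<le> Q"
      by (auto simp: Chains_def relation_of_def A_def)
    show "\<exists>u\<in>A. \<forall>a\<in>C. u \<le> a"
    proof (cases "C = {}")
      case True
      then show ?thesis
        using P by (auto simp: A_def)
    next
      case False
      define u where "u x = (INF Q\<in>C. Q x)" for x
      have bdd: "bdd_below ((\<lambda>Q. Q x) ` C)" for x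
      proof (rule bdd_belowI2)
        fix Q assume "Q \<in> C"
        then show "- P (- x) \<le> Q x"
          using sublinear_ge_minus[of Q x] C[of Q] le_funD[of Q P "- x"] by fastforce
      qed
      have u_le: "u x \<le> Q x" if "Q \<in> C" for Q x
        unfolding u_def by (rule cINF_lower[OF bdd that])
      have u_ge: "u x \<ge> c" if "\<And>Q. Q \<in> C \<Longrightarrow> c \<le> Q x" for c x
        unfolding u_def using that by (intro cINF_greatest False)
      have "u (x + y) \<le> u x + u y" for x y
      proof -
        have "u (x + y) \<le> Q x + R y" if QR: "Q \<in> C" "R \<in> C" for Q R
        proof -
          obtain S where S: "S \<in> C" "S \<le> Q" "S \<le> R"
            using chain[OF QR] QR by auto
          have "u (x + y) \<le> S x + S y"
            using u_le[OF S(1)] sublinear_add[of S x y] C[OF S(1)] by (meson order_trans)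
          also have "\<dots> \<le> Q x + R y"
            using S by (intro add_mono) (auto simp: le_fun_def)
          finally show ?thesis .
        qed
        then have "u (x + y) - R y \<le> u x" if "R \<in> C" for R
          using that by (intro u_ge) (simp add: algebra_simps)
        then have "u (x + y) - u x \<le> u y"
          by (intro u_ge) (simp add: algebra_simps)
        then show ?thesis by simp
      qed
      moreover have "u (c *\<^sub>R x) \<le> c * u x" if "c > 0" for c x
      proof -
        have "u (c *\<^sub>R x) / c \<le> Q x" if "Q \<in> C" for Q
          using u_le[OF that, of "c *\<^sub>R x"] sublinear_scale_le[of Q c x] C[OF that] \<open>c > 0\<close>
          by (simp add: field_simps)
        then have "u (c *\<^sub>R x) / c \<le> u x"
          by (rule u_ge)
        then show ?thesis
          using that by (simp add: field_simps)
      qed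
      ultimately have "sublinear u"
        by (simp add: sublinear_def)
      moreover obtain Q where "Q \<in> C"
        using False by blast
      then have "u \<le> P"
        using u_le[of Q] C[of Q] by (meson le_funI order_trans le_funD)
      ultimately show ?thesis
        using u_le by (auto simp: A_def le_fun_def)
    qed
  qed
  then obtain Q where Q: "sublinear Q" "Q \<le> P" "\<And>R. sublinear R \<Longrightarrow> R \<le> P \<Longrightarrow> R \<le> Q \<Longrightarrow> R = Q"
    by (auto simp: A_def)
  show ?thesis
  proof
    show "R = Q" if "sublinear R" "\<And>x. R x \<le> Q x" for R
      using that Q(2) by (intro Q(3)) (auto intro!: le_funI intro: order_trans dest: le_funD)
  qed (use Q(1,2) in \<open>auto simp: le_fun_def\<close>)
qed

text \<open>For fixed \<open>y\<close>, the infimum of \<open>Q (x + t y) - t Q y\<close> over \<open>t \<ge> 0\<close> is sublinear in \<open>x\<close> and at most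
  \<open>Q\<close>, hence equal to \<open>Q\<close>. The value \<open>t = 1\<close> gives \<open>Q x + Q y \<le> Q (x + y)\<close>.\<close>

lemma minimal_sublinear_linear:
  assumes Q: "sublinear Q" and min: "\<And>R. sublinear R \<Longrightarrow> (\<And>x. R x \<le> Q x) \<Longrightarrow> R = Q"
  shows "linear Q"
proof -
  have super: "Q x + Q y \<le> Q (x + y)" for x y
  proof -
    define R where "R z = (INF t\<in>{0..}. Q (z + t *\<^sub>R y) - t * Q y)" for z
    have "- Q (- z) \<le> Q (z + t *\<^sub>R y) - t * Q y" if "t \<ge> 0" for z t
      using sublinear_add[OF Q, of "z + t *\<^sub>R y" "- z"] sublinear_scale[OF Q that, of y] by simp
    then have bdd: "bdd_below ((\<lambda>t. Q (z + t *\<^sub>R y) - t * Q y) ` {0..})" for z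
      by (intro bdd_belowI2[of _ "- Q (- z)"]) auto
    have R_le: "R z \<le> Q (z + t *\<^sub>R y) - t * Q y" if "t \<ge> 0" for z t
      unfolding R_def using that by (intro cINF_lower bdd) auto
    have R_ge: "c \<le> R z" if "\<And>t. t \<ge> 0 \<Longrightarrow> c \<le> Q (z + t *\<^sub>R y) - t * Q y" for c z
      unfolding R_def using that by (intro cINF_greatest) auto
    have "R (a + b) \<le> R a + R b" for a b
    proof -
      have *: "R (a + b) \<le> (Q (a + s *\<^sub>R y) - s * Q y) + (Q (b + t *\<^sub>R y) - t * Q y)"
        if "s \<ge> 0" "t \<ge> 0" for s t
        using R_le[of "s + t" "a + b"] sublinear_add[OF Q, of "a + s *\<^sub>R y" "b + t *\<^sub>R y"] that
        by (simp add: algebra_simps)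
      have "R (a + b) - (Q (b + t *\<^sub>R y) - t * Q y) \<le> R a" if "t \<ge> 0" for t
        using *[OF _ that] by (intro R_ge) (simp add: algebra_simps)
      then have "R (a + b) - R a \<le> R b"
        by (intro R_ge) (simp add: algebra_simps)
      then show ?thesis by simp
    qed
    moreover have "R (c *\<^sub>R a) \<le> c * R a" if "c > 0" for c a
    proof -
      have "R (c *\<^sub>R a) / c \<le> R a"
      proof (rule R_ge)
        fix t :: real assume "t \<ge> 0"
        have "R (c *\<^sub>R a) \<le> Q (c *\<^sub>R a + (c * t) *\<^sub>R y) - (c * t) * Q y"
          using that \<open>t \<ge> 0\<close> by (intro R_le) auto
        also have "c *\<^sub>R a + (c * t) *\<^sub>R y = c *\<^sub>R (a + t *\<^sub>R y)"
          by (simp add: algebra_simps)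
        also have "Q \<dots> = c * Q (a + t *\<^sub>R y)"
          using that by (intro sublinear_scale[OF Q]) auto
        finally show "R (c *\<^sub>R a) / c \<le> Q (a + t *\<^sub>R y) - t * Q y"
          using that by (simp add: field_simps)
      qed
      then show ?thesis
        using that by (simp add: field_simps)
    qed
    ultimately have "sublinear R"
      by (simp add: sublinear_def)
    then have "R = Q"
      using R_le[of 0] by (intro min) auto
    then show ?thesis
      using R_le[of 1 x] by simp
  qed
  have add: "Q (x + y) = Q x + Q y" for x y
    using super[of x y] sublinear_add[OF Q, of x y] by simp
  have neg: "Q (- x) = - Q x" for x
    using add[of x "- x"] sublinear_zero[OF Q] by simp
  show ?thesis
  proof (rule linearI)
    fix c x
    show "Q (c *\<^sub>R x) = c *\<^sub>R Q x"
    proof (cases "c \<ge> 0")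
      case False
      then have "Q ((- c) *\<^sub>R x) = (- c) * Q x"
        by (intro sublinear_scale[OF Q]) simp
      then show ?thesis
        using neg[of "c *\<^sub>R x"] by simp
    qed (simp add: sublinear_scale[OF Q])
  qed (rule add)
qed

text \<open>Hahn--Banach extension, for a functional given on the domain of a linear map \<open>\<Phi>\<close> instead of on a
  subspace. A minimal sublinear functional below \<open>z \<mapsto> inf\<^sub>y (P (z - \<Phi> y) + f y)\<close> is linear, and it is at
  most \<open>f\<close> along \<open>\<Phi>\<close>, hence equal to it.\<close>

theorem hahn_banach_along:
  fixes P :: "'z::real_vector \<Rightarrow> real" and \<Phi> :: "'y::real_vector \<Rightarrow> 'z"
  assumes P: "sublinear P" and \<Phi>: "linear \<Phi>" and f: "linear f" and le: "\<And>y. f y \<le> P (\<Phi> y)"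
  obtains F where "linear F" "\<And>z. F z \<le> P z" "\<And>y. F (\<Phi> y) = f y"
proof -
  define P' where "P' z = (INF y. P (z - \<Phi> y) + f y)" for z
  have "- P (- z) \<le> P (z - \<Phi> y) + f y" for z y
    using sublinear_add[OF P, of "z - \<Phi> y" "- z"] le[of "- y"] by (simp add: linear_neg[OF \<Phi>] linear_neg[OF f])
  then have bdd: "bdd_below (range (\<lambda>y. P (z - \<Phi> y) + f y))" for z
    by (intro bdd_belowI2[of _ "- P (- z)"]) auto
  have P'_le: "P' z \<le> P (z - \<Phi> y) + f y" for z y
    unfolding P'_def by (intro cINF_lower bdd) auto
  have P'_ge: "c \<le> P' z" if "\<And>y. c \<le> P (z - \<Phi> y) + f y" for c z
    unfolding P'_def using that by (intro cINF_greatest) auto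
  have "P' (a + b) \<le> P' a + P' b" for a b
  proof -
    have *: "P' (a + b) \<le> (P (a - \<Phi> y) + f y) + (P (b - \<Phi> y') + f y')" for y y'
      using P'_le[of "a + b" "y + y'"] sublinear_add[OF P, of "a - \<Phi> y" "b - \<Phi> y'"]
      by (simp add: linear_add[OF \<Phi>] linear_add[OF f] algebra_simps)
    have "P' (a + b) - (P (b - \<Phi> y') + f y') \<le> P' a" for y'
      using *[of _ y'] by (intro P'_ge) (simp add: algebra_simps)
    then have "P' (a + b) - P' a \<le> P' b"
      by (intro P'_ge) (simp add: algebra_simps)
    then show ?thesis by simp
  qed
  moreover have "P' (c *\<^sub>R a) \<le> c * P' a" if "c > 0" for c a
  proof -
    have "P' (c *\<^sub>R a) / c \<le> P' a"
    proof (rule P'_ge)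
      fix y
      have "P' (c *\<^sub>R a) \<le> P (c *\<^sub>R (a - \<Phi> y)) + c * f y"
        using P'_le[of "c *\<^sub>R a" "c *\<^sub>R y"]
        by (simp add: linear_cmul[OF \<Phi>] linear_cmul[OF f] scaleR_diff_right)
      also have "P (c *\<^sub>R (a - \<Phi> y)) = c * P (a - \<Phi> y)"
        using that by (intro sublinear_scale[OF P]) auto
      finally show "P' (c *\<^sub>R a) / c \<le> P (a - \<Phi> y) + f y"
        using that by (simp add: field_simps)
    qed
    then show ?thesis
      using that by (simp add: field_simps)
  qed
  ultimately have "sublinear P'"
    by (simp add: sublinear_def)
  then obtain F where F: "sublinear F" "\<And>z. F z \<le> P' z"
    "\<And>R. sublinear R \<Longrightarrow> (\<And>x. R x \<le> F x) \<Longrightarrow> R = F"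
    by (rule minimal_sublinear_exists) blast
  have lin: "linear F"
    by (rule minimal_sublinear_linear[OF F(1,3)])
  have F_le: "F (\<Phi> y) \<le> f y" for y
    using F(2)[of "\<Phi> y"] P'_le[of "\<Phi> y" y] sublinear_zero[OF P] by simp
  show ?thesis
  proof
    show "F z \<le> P z" for z
      using F(2)[of z] P'_le[of z 0] by (simp add: linear_0[OF \<Phi>] linear_0[OF f])
    show "F (\<Phi> y) = f y" for y
      using F_le[of y] F_le[of "- y"] by (simp add: linear_neg[OF \<Phi>] linear_neg[OF f] linear_neg[OF lin])
  qed (rule lin)
qed

text \<open>Integration against a finitely additive probability measure.\<close>

definition mean_on_bounded :: "(('w \<Rightarrow> real) \<Rightarrow> real) \<Rightarrow> bool" where
  "mean_on_bounded \<mu> \<longleftrightarrow>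
     (\<forall>f g. bounded (range f) \<longrightarrow> bounded (range g) \<longrightarrow> \<mu> (\<lambda>w. f w + g w) = \<mu> f + \<mu> g) \<and>
     (\<forall>c f. bounded (range f) \<longrightarrow> \<mu> (\<lambda>w. c * f w) = c * \<mu> f) \<and>
     (\<forall>f. bounded (range f) \<longrightarrow> (\<forall>w. f w \<ge> 0) \<longrightarrow> \<mu> f \<ge> 0) \<and>
     \<mu> (\<lambda>_. 1) = 1"

text \<open>Dominating by the supremum functional makes the extension positive and normalised. The bounded
  functions on the index set form a normed space as continuous functions on the discrete space.\<close>

lemma mean_extension:
  fixes \<Phi> :: "'y::real_vector \<Rightarrow> 'w \<Rightarrow> real"
  assumes lin: "\<And>w. linear (\<lambda>y. \<Phi> y w)" and bdd: "\<And>y. bounded (range (\<Phi> y))"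
    and f: "linear f" and le: "\<And>y C. (\<And>w. \<Phi> y w \<le> C) \<Longrightarrow> f y \<le> C"
  obtains \<mu> where "mean_on_bounded \<mu>" "\<And>y. \<mu> (\<Phi> y) = f y"
proof -
  define B :: "('w \<Rightarrow> real) \<Rightarrow> 'w discrete \<Rightarrow>\<^sub>C real" where "B g = Bcontfun (\<lambda>w. g (of_discrete w))" for g
  have B: "apply_bcontfun (B g) = (\<lambda>w. g (of_discrete w))" if "bounded (range g)" for g
  proof -
    have "continuous_on UNIV (\<lambda>w. g (of_discrete w))"
      by (simp add: continuous_on_open_vimage open_discrete)
    moreover have "bounded (range (\<lambda>w. g (of_discrete w)))"
      by (rule bounded_subset[OF that]) auto
    ultimately show ?thesis
      unfolding B_def by (intro Bcontfun_inverse) (simp add: bcontfun_def)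
  qed
  define P where "P z = Sup (range (apply_bcontfun z))" for z :: "'w discrete \<Rightarrow>\<^sub>C real"
  have bdd_z: "bdd_above (range (apply_bcontfun z))" for z :: "'w discrete \<Rightarrow>\<^sub>C real"
    by (simp add: bounded_imp_bdd_above)
  have P_ge: "apply_bcontfun z w \<le> P z" for z w
    unfolding P_def by (rule cSUP_upper[OF _ bdd_z]) simp
  have P_le: "P z \<le> C" if "\<And>w. apply_bcontfun z w \<le> C" for z C
    unfolding P_def using that by (intro cSUP_least) auto
  have P: "sublinear P"
    unfolding sublinear_def
    by (intro conjI allI impI P_le)
      (auto simp: plus_bcontfun.rep_eq scaleR_bcontfun.rep_eq intro!: add_mono P_ge)
  have lin_B: "linear (\<lambda>y. B (\<Phi> y))"
    by (intro linearI bcontfun_eqI)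
      (simp_all add: B[OF bdd] plus_bcontfun.rep_eq scaleR_bcontfun.rep_eq linear_add[OF lin] linear_cmul[OF lin])
  have "f y \<le> P (B (\<Phi> y))" for y
  proof (rule le)
    show "\<Phi> y w \<le> P (B (\<Phi> y))" for w
      using P_ge[of "B (\<Phi> y)" "discrete w"] by (simp add: B bdd discrete_inverse)
  qed
  then obtain F where F: "linear F" "\<And>z. F z \<le> P z" "\<And>y. F (B (\<Phi> y)) = f y"
    using hahn_banach_along[OF P lin_B f] by metis
  have "mean_on_bounded (\<lambda>g. F (B g))"
    unfolding mean_on_bounded_def
  proof (intro conjI allI impI)
    fix g h :: "'w \<Rightarrow> real" and c assume g: "bounded (range g)"
    show "F (B (\<lambda>w. c * g w)) = c * F (B g)"
    proof -
      have "bounded (range (\<lambda>w. c * g w))"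
        using bounded_scaling[OF g, of c] by (simp add: image_image)
      then have "B (\<lambda>w. c * g w) = c *\<^sub>R B g"
        by (intro bcontfun_eqI) (simp add: B g scaleR_bcontfun.rep_eq)
      then show ?thesis
        by (simp add: linear_cmul[OF F(1)])
    qed
    show "F (B (\<lambda>w. g w + h w)) = F (B g) + F (B h)" if h: "bounded (range h)"
    proof -
      have "bounded (range (\<lambda>w. g w + h w))"
        by (rule bounded_plus_comp[OF g h])
      then have "B (\<lambda>w. g w + h w) = B g + B h"
        by (intro bcontfun_eqI) (simp add: B g h plus_bcontfun.rep_eq)
      then show ?thesis
        by (simp add: linear_add[OF F(1)])
    qed
    show "F (B g) \<ge> 0" if "\<forall>w. g w \<ge> 0"
    proof -
      have "F (- B g) \<le> 0"
        using that by (intro order_trans[OF F(2) P_le]) (auto simp: B g uminus_bcontfun.rep_eq)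
      then show ?thesis
        by (simp add: linear_neg[OF F(1)])
    qed
  next
    have one: "apply_bcontfun (B (\<lambda>_. 1)) = (\<lambda>_. 1)"
      by (subst B) auto
    have "F (B (\<lambda>_. 1)) \<le> 1"
      by (rule order_trans[OF F(2) P_le]) (simp add: one)
    moreover have "F (- B (\<lambda>_. 1)) \<le> - 1"
      by (rule order_trans[OF F(2) P_le]) (simp add: one uminus_bcontfun.rep_eq)
    ultimately show "F (B (\<lambda>_. 1)) = 1"
      by (simp add: linear_neg[OF F(1)])
  qed
  then show ?thesis
    using F(3) by (rule that)
qed

section \<open>Bidual extreme points of the unit ball are molecules\<close>

lemma mean_add: "mean_on_bounded \<mu> \<Longrightarrow> bounded (range f) \<Longrightarrow> bounded (range g) \<Longrightarrow> \<mu> (\<lambda>w. f w + g w) = \<mu> f + \<mu> g"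
  and mean_scale: "mean_on_bounded \<mu> \<Longrightarrow> bounded (range f) \<Longrightarrow> \<mu> (\<lambda>w. c * f w) = c * \<mu> f"
  and mean_nonneg: "mean_on_bounded \<mu> \<Longrightarrow> bounded (range f) \<Longrightarrow> (\<And>w. f w \<ge> 0) \<Longrightarrow> \<mu> f \<ge> 0"
  and mean_one: "mean_on_bounded \<mu> \<Longrightarrow> \<mu> (\<lambda>_. 1) = 1"
  unfolding mean_on_bounded_def by blast+

lemma bounded_range_real:
  fixes f :: "'w \<Rightarrow> real"
  assumes "\<And>w. \<bar>f w\<bar> \<le> C"
  shows "bounded (range f)"
  using assms by (auto simp: bounded_iff)

lemma bounded_range_mult:
  fixes f g :: "'w \<Rightarrow> real"
  assumes "bounded (range f)" "bounded (range g)"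
  shows "bounded (range (\<lambda>w. f w * g w))"
proof -
  obtain a b where ab: "\<And>w. \<bar>f w\<bar> \<le> a" "\<And>w. \<bar>g w\<bar> \<le> b"
    using assms by (auto simp: bounded_iff)
  then have "\<bar>f w * g w\<bar> \<le> a * b" for w
    unfolding abs_mult by (intro mult_mono) (auto intro: order_trans[OF abs_ge_zero])
  then show ?thesis
    by (rule bounded_range_real)
qed

lemma mean_mono:
  assumes \<mu>: "mean_on_bounded \<mu>" and f: "bounded (range f)" and g: "bounded (range g)"
    and le: "\<And>w. f w \<le> g w"
  shows "\<mu> f \<le> \<mu> g"
proof -
  have h: "bounded (range (\<lambda>w. - 1 * f w))"
    using bounded_range_mult[OF bounded_range_real[of "\<lambda>_. - 1" 1] f] by simp
  have "0 \<le> \<mu> (\<lambda>w. g w + - 1 * f w)"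
    using le by (intro mean_nonneg[OF \<mu> bounded_plus_comp[OF g h]]) simp
  also have "\<dots> = \<mu> g + - 1 * \<mu> f"
    by (subst mean_add[OF \<mu> g h]) (simp only: mean_scale[OF \<mu> f])
  finally show ?thesis
    by simp
qed

lemma bounded_range_indicator: "bounded (range (indicator A :: 'w \<Rightarrow> real))"
  by (rule bounded_range_real[of _ 1]) (simp add: indicator_def)

lemma mean_indicator_bounds:
  assumes "mean_on_bounded \<mu>"
  shows "0 \<le> \<mu> (indicator A)" "\<mu> (indicator A) \<le> 1"
  using mean_nonneg[OF assms bounded_range_indicator, of A]
    mean_mono[OF assms bounded_range_indicator bounded_range_real[of "\<lambda>_. 1" 1], of A]
  by (auto simp: mean_one[OF assms] indicator_def)

lemma lipfree_eqI:
  assumes "\<And>h. 1-lipschitz_on UNIV h \<Longrightarrow> lip_fun h u = lip_fun h v"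
  shows "u = v"
proof -
  have "apply_bcontfun (Rep_lipfree u) w = apply_bcontfun (Rep_lipfree v) w" for w
    using assms[of "Rep_lip1 (of_discrete w)"] Rep_lip1[of "of_discrete w"]
    by (simp add: lip_fun_apply Rep_lip1_inverse of_discrete_inverse)
  then show ?thesis
    by (simp add: bcontfun_eqI flip: Rep_lipfree_inject)
qed

lemma abs_functional_molecule_le:
  fixes \<phi> :: "'a::metric_space lipfree \<Rightarrow>\<^sub>L real"
  shows "\<bar>blinfun_apply \<phi> (molecule p q)\<bar> \<le> norm \<phi>"
proof (cases "p = q")
  case False
  then show ?thesis
    using norm_blinfun[of \<phi> "molecule p q"] by (simp add: norm_molecule)
qed (simp add: molecule_conv_dirac_diff)

lemma bounded_functional_molecule:
  fixes \<phi> :: "'a::metric_space lipfree \<Rightarrow>\<^sub>L real"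
  shows "bounded (range (\<lambda>(p, q). blinfun_apply \<phi> (molecule p q)))"
  by (rule bounded_range_real[of _ "norm \<phi>"]) (simp add: abs_functional_molecule_le split: prod.split)

lemma abs_functional_le_norm:
  assumes "norm (bidual_embed v) \<le> 1"
  shows "\<bar>blinfun_apply \<phi> v\<bar> \<le> norm \<phi>"
proof -
  have "\<bar>blinfun_apply \<phi> v\<bar> \<le> norm (bidual_embed v) * norm \<phi>"
    using norm_blinfun[of "bidual_embed v" \<phi>] by (simp add: bidual_embed.rep_eq)
  also have "\<dots> \<le> 1 * norm \<phi>"
    using assms by (intro mult_right_mono) auto
  finally show ?thesis
    by simp
qed

text \<open>Functionals are determined by their slopes at pairs of points, and the supremum of the slopes
  dominates \<open>\<phi> v\<close>, so evaluation at \<open>v\<close> extends to a mean on all bounded functions of pairs. Pairs on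
  the diagonal have slope \<open>0\<close>.\<close>

lemma representing_mean:
  fixes v :: "'a::metric_space lipfree"
  assumes "norm (bidual_embed v) \<le> 1"
  obtains \<mu> :: "('a \<times> 'a \<Rightarrow> real) \<Rightarrow> real"
  where "mean_on_bounded \<mu>" "\<And>\<phi>. \<mu> (\<lambda>(p, q). blinfun_apply \<phi> (molecule p q)) = \<phi> v"
proof (rule mean_extension[of "\<lambda>\<phi> (p, q). blinfun_apply \<phi> (molecule p q :: 'a lipfree)" "\<lambda>\<phi>. blinfun_apply \<phi> v"])
  show "linear (\<lambda>\<phi>. case w of (p, q) \<Rightarrow> blinfun_apply \<phi> (molecule p q))" for w :: "'a \<times> 'a"
    by (cases w) (simp add: linearI blinfun.add_left blinfun.scaleR_left)
  show "linear (\<lambda>\<phi>. blinfun_apply \<phi> v)"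
    by (simp add: linearI blinfun.add_left blinfun.scaleR_left)
  fix \<phi> :: "'a lipfree \<Rightarrow>\<^sub>L real" and C
  assume C: "\<And>w. (case w of (p, q) \<Rightarrow> blinfun_apply \<phi> (molecule p q)) \<le> C"
  have "C \<ge> 0"
    using C[of "(undefined, undefined)"] by (simp add: molecule_conv_dirac_diff)
  moreover have "\<phi> (dirac_diff p q) \<le> C * dist p q" for p q
    unfolding dirac_diff_conv_molecule
    using mult_right_mono[OF C[of "(p, q)"], of "dist p q"] by (simp add: blinfun.scaleR_right mult.commute)
  ultimately have "norm \<phi> \<le> C"
    by (intro norm_functional_le)
  then show "\<phi> v \<le> C"
    using abs_functional_le_norm[OF assms, of \<phi>] by simp
qed (auto simp: bounded_functional_molecule intro: that)

text \<open>Integrating slopes against a weight \<open>w\<close> with \<open>\<bar>w\<bar> \<le> 1\<close> and mean \<open>0\<close> defines an element \<open>D\<close> of the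
  bidual. Both \<open>v + D\<close> and \<open>v - D\<close> are integrals against nonnegative weights of mean \<open>1\<close>, so they lie
  in the unit ball and \<open>D\<close> vanishes. The lemma is the case where \<open>w\<close> is a centred indicator.\<close>

lemma mean_splits_at_extreme_point:
  fixes v :: "'a::metric_space lipfree"
  assumes ext: "bidual_embed v extreme_point_of cball 0 1"
    and \<mu>: "mean_on_bounded \<mu>" "\<And>\<phi>. \<mu> (\<lambda>(p, q). blinfun_apply \<phi> (molecule p q)) = \<phi> v"
  shows "\<mu> (\<lambda>z. indicator A z * (case z of (p, q) \<Rightarrow> blinfun_apply \<phi> (molecule p q)))
    = \<mu> (indicator A) * \<phi> v"
proof -
  define m where "m \<phi> = (\<lambda>(p, q). blinfun_apply \<phi> (molecule p q))" for \<phi> :: "'a lipfree \<Rightarrow>\<^sub>L real"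
  define a where "a = \<mu> (indicator A)"
  define w where "w z = indicator A z - a" for z
  have bm: "bounded (range (m \<phi>))" for \<phi>
    unfolding m_def by (rule bounded_functional_molecule)
  have a: "0 \<le> a" "a \<le> 1"
    unfolding a_def by (rule mean_indicator_bounds[OF \<mu>(1)])+
  have w: "\<bar>w z\<bar> \<le> 1" for z
    using a by (auto simp: w_def indicator_def)
  then have bw: "bounded (range w)"
    by (rule bounded_range_real)
  have bwm: "bounded (range (\<lambda>z. w z * m \<phi> z))" for \<phi>
    by (rule bounded_range_mult[OF bw bm])
  have \<mu>w: "\<mu> w = 0"
    using mean_add[OF \<mu>(1) bounded_range_indicator[of A] bounded_range_real[of "\<lambda>_. - a * 1" a]]
      mean_scale[OF \<mu>(1) bounded_range_real[of "\<lambda>_. 1" 1], of "- a"] a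
    by (simp add: w_def[abs_def] mean_one[OF \<mu>(1)] a_def)
  have le: "m \<phi> z * c \<le> norm \<phi> * c" if "c \<ge> 0" for \<phi> z c
    using that abs_functional_molecule_le[of \<phi>]
    by (intro mult_right_mono) (auto simp: m_def abs_le_iff split: prod.split)
  define D where "D = Blinfun (\<lambda>\<phi>. \<mu> (\<lambda>z. w z * m \<phi> z))"
  have pert: "\<phi> v + s * \<mu> (\<lambda>z. w z * m \<phi> z) \<le> norm \<phi>" if s: "\<bar>s\<bar> = 1" for \<phi> :: "'a lipfree \<Rightarrow>\<^sub>L real" and s
  proof -
    have b1: "bounded (range (\<lambda>z. s * (w z * m \<phi> z)))"
      by (rule bounded_range_mult[OF bounded_range_real[of "\<lambda>_. s" 1] bwm]) (simp add: s)
    have b2: "bounded (range (\<lambda>z. s * w z))"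
      by (rule bounded_range_mult[OF bounded_range_real[of "\<lambda>_. s" 1] bw]) (simp add: s)
    have b3: "bounded (range (\<lambda>z. 1 + s * w z))"
      by (rule bounded_plus_comp[OF bounded_range_real[of "\<lambda>_. 1" 1] b2]) simp
    have b4: "bounded (range (\<lambda>z. norm \<phi> * (1 + s * w z)))"
      by (rule bounded_range_mult[OF bounded_range_real[of "\<lambda>_. norm \<phi>" "norm \<phi>"] b3]) simp
    have "\<phi> v + s * \<mu> (\<lambda>z. w z * m \<phi> z) = \<mu> (\<lambda>z. m \<phi> z + s * (w z * m \<phi> z))"
      using \<mu>(2)[of \<phi>] by (simp add: mean_add[OF \<mu>(1) bm b1] mean_scale[OF \<mu>(1) bwm]) (simp add: m_def)
    also have "\<dots> \<le> \<mu> (\<lambda>z. norm \<phi> * (1 + s * w z))"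
    proof (rule mean_mono[OF \<mu>(1) bounded_plus_comp[OF bm b1] b4])
      fix z
      have "\<bar>s * w z\<bar> \<le> 1"
        using w[of z] s by (simp add: abs_mult)
      then have "m \<phi> z * (1 + s * w z) \<le> norm \<phi> * (1 + s * w z)"
        by (intro le) linarith
      then show "m \<phi> z + s * (w z * m \<phi> z) \<le> norm \<phi> * (1 + s * w z)"
        by (simp add: algebra_simps)
    qed
    also have "\<dots> = norm \<phi> * (1 + s * 0)"
      using mean_scale[OF \<mu>(1) b3, of "norm \<phi>"] mean_scale[OF \<mu>(1) bw, of s]
        mean_add[OF \<mu>(1) bounded_range_real[of "\<lambda>_. 1" 1] b2] \<mu>w
      by (simp add: mean_one[OF \<mu>(1)])
    finally show ?thesis
      by simp
  qed
  have D: "blinfun_apply D \<phi> = \<mu> (\<lambda>z. w z * m \<phi> z)" for \<phi>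
    unfolding D_def
  proof (subst bounded_linear_Blinfun_apply)
    show "bounded_linear (\<lambda>\<phi>. \<mu> (\<lambda>z. w z * m \<phi> z))"
    proof (rule bounded_linear_intro[where K = 2])
      fix \<phi> \<psi> :: "'a lipfree \<Rightarrow>\<^sub>L real" and c :: real
      have "(\<lambda>z. w z * m (\<phi> + \<psi>) z) = (\<lambda>z. w z * m \<phi> z + w z * m \<psi> z)"
        by (auto simp: m_def blinfun.add_left distrib_left split: prod.split)
      then show "\<mu> (\<lambda>z. w z * m (\<phi> + \<psi>) z) = \<mu> (\<lambda>z. w z * m \<phi> z) + \<mu> (\<lambda>z. w z * m \<psi> z)"
        by (simp add: mean_add[OF \<mu>(1) bwm bwm])
      have "(\<lambda>z. w z * m (c *\<^sub>R \<phi>) z) = (\<lambda>z. c * (w z * m \<phi> z))"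
        by (auto simp: m_def blinfun.scaleR_left split: prod.split)
      then show "\<mu> (\<lambda>z. w z * m (c *\<^sub>R \<phi>) z) = c *\<^sub>R \<mu> (\<lambda>z. w z * m \<phi> z)"
        by (simp add: mean_scale[OF \<mu>(1) bwm])
      have "\<bar>\<phi> v\<bar> \<le> norm \<phi>"
        using ext by (intro abs_functional_le_norm) (simp add: bidual_extreme_iff)
      then show "norm (\<mu> (\<lambda>z. w z * m \<phi> z)) \<le> norm \<phi> * 2"
        using pert[of 1 \<phi>] pert[of "- 1" \<phi>] by (simp add: abs_le_iff)
    qed
  qed simp
  have "norm (bidual_embed v + s *\<^sub>R D) \<le> 1" if "\<bar>s\<bar> = 1" for s
  proof (rule norm_blinfun_bound)
    fix \<phi> :: "'a lipfree \<Rightarrow>\<^sub>L real"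
    have "(bidual_embed v + s *\<^sub>R D) \<psi> \<le> norm \<psi>" for \<psi> :: "'a lipfree \<Rightarrow>\<^sub>L real"
      using pert[OF that, of \<psi>] by (simp add: D blinfun.add_left blinfun.scaleR_left bidual_embed.rep_eq)
    from this[of \<phi>] this[of "- \<phi>"] show "norm ((bidual_embed v + s *\<^sub>R D) \<phi>) \<le> 1 * norm \<phi>"
      by (simp add: blinfun.minus_right abs_le_iff)
  qed simp
  from this[of 1] this[of "- 1"] have "D = 0"
    using ext by (simp add: bidual_extreme_iff)
  then have "0 = \<mu> (\<lambda>z. w z * m \<phi> z)"
    using D[of \<phi>] by simp
  also have "\<dots> = \<mu> (\<lambda>z. indicator A z * m \<phi> z + (- a) * m \<phi> z)"
    by (simp add: w_def algebra_simps)
  also have "\<dots> = \<mu> (\<lambda>z. indicator A z * m \<phi> z) + (- a) * \<mu> (m \<phi>)"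
    by (subst mean_add[OF \<mu>(1) bounded_range_mult[OF bounded_range_indicator bm]
          bounded_range_mult[OF bounded_range_real[of "\<lambda>_. - a" a] bm]])
      (use a in \<open>simp_all only: mean_scale[OF \<mu>(1) bm] abs_minus_cancel abs_of_nonneg order_refl\<close>)
  finally show ?thesis
    using \<mu>(2)[of \<phi>] by (simp add: m_def a_def)
qed

text \<open>The pairs at which the slope of \<open>\<phi>\<close> is at least \<open>\<phi> v + e\<close> form a set \<open>A\<close> of mean \<open>0\<close>, because the
  mean of the slope over \<open>A\<close> is \<open>\<phi> v\<close> times the mean of \<open>A\<close>. The complements of sets of mean \<open>0\<close> form
  the required filter.\<close>

lemma extreme_point_is_limit_of_molecules:
  fixes v :: "'a::metric_space lipfree"
  assumes ext: "bidual_embed v extreme_point_of cball 0 1"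
  obtains F :: "('a \<times> 'a) filter" where "F \<noteq> bot"
    "\<And>\<phi> :: 'a lipfree \<Rightarrow>\<^sub>L real. ((\<lambda>(p, q). blinfun_apply \<phi> (molecule p q)) \<longlongrightarrow> \<phi> v) F"
proof -
  have "norm (bidual_embed v) \<le> 1"
    using ext by (simp add: bidual_extreme_iff)
  then obtain \<mu> :: "('a \<times> 'a \<Rightarrow> real) \<Rightarrow> real"
    where \<mu>: "mean_on_bounded \<mu>" "\<And>\<phi>. \<mu> (\<lambda>(p, q). blinfun_apply \<phi> (molecule p q)) = \<phi> v"
    by (rule representing_mean) blast
  define F where "F = Abs_filter (\<lambda>P. \<mu> (indicator {z. \<not> P z}) = 0)"
  have null_le: "\<mu> (indicator A) = 0" if "\<And>z. indicator A z \<le> (f z :: real)" "bounded (range f)" "\<mu> f \<le> 0"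
    for A :: "('a \<times> 'a) set" and f
    using mean_mono[OF \<mu>(1) bounded_range_indicator that(2), of A] that mean_indicator_bounds(1)[OF \<mu>(1), of A]
    by (meson antisym order_trans)
  have ev: "eventually P F \<longleftrightarrow> \<mu> (indicator {z. \<not> P z}) = 0" for P
    unfolding F_def
  proof (rule eventually_Abs_filter, rule is_filter.intro)
    show "\<mu> (indicator {z. \<not> True}) = 0"
      using mean_scale[OF \<mu>(1) bounded_range_real[of "\<lambda>_. 1" 1], of 0] by (simp add: indicator_def[abs_def])
    show "\<mu> (indicator {z. \<not> (P z \<and> Q z)}) = 0"
      if PQ: "\<mu> (indicator {z. \<not> P z}) = 0" "\<mu> (indicator {z. \<not> Q z}) = 0" for P Q
    proof (rule null_le)
      show "bounded (range (\<lambda>z. indicator {z. \<not> P z} z + indicator {z. \<not> Q z} z :: real))"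
        by (rule bounded_plus_comp[OF bounded_range_indicator bounded_range_indicator])
      show "\<mu> (\<lambda>z. indicator {z. \<not> P z} z + indicator {z. \<not> Q z} z) \<le> 0"
        using PQ by (subst mean_add[OF \<mu>(1) bounded_range_indicator bounded_range_indicator]) simp
    qed (auto simp: indicator_def)
    show "\<mu> (indicator {z. \<not> Q z}) = 0" if "\<forall>z. P z \<longrightarrow> Q z" "\<mu> (indicator {z. \<not> P z}) = 0" for P Q
      using that by (intro null_le[OF _ bounded_range_indicator[of "{z. \<not> P z}"]]) (auto simp: indicator_def)
  qed
  have "F \<noteq> bot"
    using mean_one[OF \<mu>(1)] by (auto simp: trivial_limit_def ev)
  moreover have "((\<lambda>(p, q). blinfun_apply \<phi> (molecule p q)) \<longlongrightarrow> \<phi> v) F"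
    for \<phi> :: "'a lipfree \<Rightarrow>\<^sub>L real"
  proof -
    have above: "eventually (\<lambda>(p, q). \<phi> (molecule p q) < \<phi> v + e) F" if "e > 0" for \<phi> :: "'a lipfree \<Rightarrow>\<^sub>L real" and e :: real
    proof -
      define m where "m = (\<lambda>(p, q). blinfun_apply \<phi> (molecule p q :: 'a lipfree))"
      define A where "A = {z. \<not> m z < \<phi> v + e}"
      have bm: "bounded (range m)"
        unfolding m_def by (rule bounded_functional_molecule)
      have "(\<phi> v + e) * \<mu> (indicator A) = \<mu> (\<lambda>z. (\<phi> v + e) * indicator A z)"
        by (simp add: mean_scale[OF \<mu>(1) bounded_range_indicator])
      also have "\<dots> \<le> \<mu> (\<lambda>z. indicator A z * m z)"
        by (intro mean_mono[OF \<mu>(1) bounded_range_mult[OF bounded_range_real[of "\<lambda>_. \<phi> v + e" "\<bar>\<phi> v + e\<bar>"] bounded_range_indicator]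
              bounded_range_mult[OF bounded_range_indicator bm]])
          (auto simp: A_def indicator_def)
      also have "\<dots> = \<mu> (indicator A) * \<phi> v"
        unfolding m_def by (rule mean_splits_at_extreme_point[OF ext \<mu>])
      finally have "e * \<mu> (indicator A) \<le> 0"
        by (simp add: algebra_simps)
      then have "\<mu> (indicator A) = 0"
        using that mean_indicator_bounds(1)[OF \<mu>(1), of A] by (simp add: mult_le_0_iff)
      then show ?thesis
        by (simp add: ev A_def m_def case_prod_unfold)
    qed
    show ?thesis
      unfolding tendsto_iff
    proof (intro allI impI)
      fix e :: real assume "e > 0"
      show "eventually (\<lambda>z. dist (case z of (p, q) \<Rightarrow> \<phi> (molecule p q)) (\<phi> v) < e) F"
        using above[OF \<open>e > 0\<close>, of \<phi>] above[OF \<open>e > 0\<close>, of "- \<phi>"]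
        by eventually_elim (auto simp: dist_real_def blinfun.minus_left)
    qed
  qed
  ultimately show ?thesis
    by (rule that)
qed

text \<open>Let pairs \<open>(p, q)\<close> run through the filter along which molecules converge weakly to \<open>v\<close>. A
  \<open>1\<close>-Lipschitz function of bounded support on which \<open>v\<close> does not vanish keeps the pairs in a compact
  set, so that they have a cluster point \<open>(a, b)\<close>. A \<open>1\<close>-Lipschitz function that is constant near \<open>a\<close> and
  on which \<open>v\<close> does not vanish excludes \<open>a = b\<close>. Such functions exist because \<open>v\<close> is a norm limit of
  finitely supported elements, on which truncations of a Lipschitz function act almost like the
  function itself. Off the diagonal slopes are continuous, so \<open>v\<close> is the molecule of \<open>(a, b)\<close>.\<close>

theorem bidual_extreme_is_molecule:
  fixes v :: "'a::metric_space lipfree"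
  assumes proper: "\<And>(c::'a) R. compact (cball c R)"
    and "v \<noteq> 0" and ext: "bidual_embed v extreme_point_of cball 0 1"
  shows "\<exists>a b. a \<noteq> b \<and> v = molecule a b"
proof -
  obtain F :: "('a \<times> 'a) filter" where F: "F \<noteq> bot"
    and lim: "\<And>\<phi> :: 'a lipfree \<Rightarrow>\<^sub>L real. ((\<lambda>(p, q). blinfun_apply \<phi> (molecule p q)) \<longlongrightarrow> \<phi> v) F"
    by (rule extreme_point_is_limit_of_molecules[OF ext]) blast
  have "norm v / 3 > 0"
    using \<open>v \<noteq> 0\<close> by simp
  moreover have "v \<in> closure (lipfree_of ` free0)"
    by (simp add: closure_lipfree_of)
  ultimately obtain x where "x \<in> free0" "dist (lipfree_of x) v < norm v / 3"
    unfolding closure_approachable by blast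
  then have x: "x \<in> free0" "norm (lipfree_of x - v) < norm v / 3"
    by (simp_all add: dist_norm)
  let ?\<delta> = "norm (lipfree_of x - v)"
  have "\<exists>f. 1-lipschitz_on UNIV f \<and> \<bar>pairing x f\<bar> > norm v / 3"
  proof (rule ccontr)
    assume no: "\<not> ?thesis"
    have "norm (lipfree_of x) \<le> norm v / 3"
      unfolding norm_lipfree_of[OF x(1)] free0_norm_def
      using no lipschitz_dist by (intro cSUP_least) (auto simp: not_less)
    then have "norm v \<le> ?\<delta> + norm v / 3"
      using norm_triangle_ineq4[of "lipfree_of x" "lipfree_of x - v"] by simp
    then show False
      using x(2) \<open>norm v / 3 > 0\<close> by simp
  qed
  then obtain f where f: "1-lipschitz_on UNIV f" "\<bar>pairing x f\<bar> > norm v / 3"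
    by blast
  let ?e = "\<bar>pairing x f\<bar> - ?\<delta>"
  have "?e > 0"
    using f x by simp
  have nonzero: "lip_fun g v \<noteq> 0" if g: "1-lipschitz_on UNIV g" "\<bar>pairing x g - pairing x f\<bar> < ?e" for g
  proof -
    have "\<bar>lip_fun g (lipfree_of x - v)\<bar> \<le> norm (lip_fun g) * ?\<delta>"
      using norm_blinfun[of "lip_fun g" "lipfree_of x - v"] by simp
    also have "\<dots> \<le> 1 * ?\<delta>"
      by (intro mult_right_mono norm_lip_fun) simp
    finally have "\<bar>pairing x g - lip_fun g v\<bar> \<le> ?\<delta>"
      by (simp add: blinfun.diff_right lip_fun_lipfree_of g x)
    then show ?thesis
      using g(2) by auto
  qed
  let ?S = "{m. x m \<noteq> 0}"
  have finS: "finite ?S"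
    using x(1) by (simp add: free0_def)
  have pairing_shift: "pairing x (\<lambda>p. f p - c) = pairing x f" for c
  proof -
    have "(\<Sum>m\<in>?S. x m * c) = 0"
      using x(1) by (simp add: free0_def flip: sum_distrib_right)
    then show ?thesis
      by (simp add: pairing_def right_diff_distrib sum_subtractf)
  qed
  have f_lip: "\<bar>f p - f q\<bar> \<le> dist p q" for p q
    using f(1) by (auto simp: lipschitz_on_def dist_real_def)
  have "\<exists>K. compact K \<and> eventually (\<lambda>z. z \<in> K \<times> K) F"
  proof -
    define c :: 'a where "c = undefined"
    have "bounded ?S"
      using finS by (rule finite_imp_bounded)
    then obtain R0 where R0: "\<And>m. m \<in> ?S \<Longrightarrow> dist c m \<le> R0"
      unfolding bounded_any_center[of _ c] by blast
    define R where "R = max R0 1"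
    have R: "R > 0" "\<And>m. m \<in> ?S \<Longrightarrow> dist m c \<le> R"
      using R0 by (auto simp: R_def dist_commute le_max_iff_disj)
    \<comment> \<open>Cutting \<open>f\<close> off by the cone \<open>g\<close> gives bounded support and keeps the
      Lipschitz constant \<open>1\<close>.\<close>
    define g where "g p = max 0 (2 * R - dist p c)" for p
    define h where "h p = max (- g p) (min (f p - f c) (g p))" for p
    have g_lip: "\<bar>g p - g q\<bar> \<le> dist p q" for p q
      using dist_triangle[of p c q] dist_triangle[of q c p] by (auto simp: g_def dist_commute)
    have h_lip: "\<bar>h p - h q\<bar> \<le> dist p q" for p q
      using g_lip[of p q] f_lip[of p q] unfolding h_def by (auto simp: max_def min_def)
    then have h1: "1-lipschitz_on UNIV h"
      by (intro lipschitz_onI) (auto simp: dist_real_def)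
    have "h m = f m - f c" if "m \<in> ?S" for m
      using R(2)[OF that] f_lip[of m c] by (auto simp: h_def g_def)
    then have "pairing x h = pairing x (\<lambda>p. f p - f c)"
      by (simp add: pairing_def)
    then have nz: "lip_fun h v \<noteq> 0" (is "?c \<noteq> 0")
      using \<open>?e > 0\<close> by (intro nonzero h1) (simp add: pairing_shift)
    \<comment> \<open>Pairs at which \<open>h\<close> has slope at least \<open>\<bar>?c\<bar> / 2\<close> have distance
      at most \<open>L\<close>, because \<open>\<bar>h\<bar> \<le> 2 * R\<close>.\<close>
    define L where "L = 8 * R / \<bar>?c\<bar>"
    have "L > 0"
      using nz R by (simp add: L_def)
    have "\<bar>?c\<bar> / 2 > 0"
      using nz by simp
    then have "eventually (\<lambda>z. dist (case z of (p, q) \<Rightarrow> lip_fun h (molecule p q)) ?c < \<bar>?c\<bar> / 2) F"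
      using lim[of "lip_fun h"] unfolding tendsto_iff by blast
    then have "eventually (\<lambda>z. z \<in> cball c (2 * R + L) \<times> cball c (2 * R + L)) F"
    proof eventually_elim
      case (elim z)
      obtain p q where z: "z = (p, q)"
        by (cases z)
      have "\<bar>(h p - h q) / dist p q - ?c\<bar> < \<bar>?c\<bar> / 2"
        using elim by (simp add: z lip_fun_molecule h1 dist_real_def)
      then have big: "\<bar>(h p - h q) / dist p q\<bar> > \<bar>?c\<bar> / 2"
        by linarith
      have pq: "dist p q > 0"
        using big by (cases "p = q") auto
      have h_le: "\<bar>h p\<bar> \<le> 2 * R" for p
      proof -
        have "0 \<le> g p" "g p \<le> 2 * R"
          using R(1) by (simp_all add: g_def)
        then show ?thesis
          unfolding h_def by linarith
      qed
      have "\<bar>?c\<bar> / 2 * dist p q < \<bar>h p - h q\<bar>"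
        using big pq by (simp add: abs_divide pos_less_divide_eq)
      also have "\<dots> \<le> 4 * R"
        using h_le[of p] h_le[of q] by simp
      finally have d: "dist p q \<le> L"
        using nz by (simp add: L_def field_simps)
      have "h p \<noteq> 0 \<or> h q \<noteq> 0"
        using big by auto
      moreover have "dist p c \<le> 2 * R" if "h p \<noteq> 0" for p
        using that by (auto simp: h_def g_def max_def min_def split: if_splits)
      ultimately consider "dist p c \<le> 2 * R" | "dist q c \<le> 2 * R"
        by blast
      then have "dist p c \<le> 2 * R + L" "dist q c \<le> 2 * R + L"
        using d \<open>L > 0\<close> dist_triangle[of p c q] dist_triangle[of q c p]
        by (cases; simp add: dist_commute; linarith)+
      then show ?case
        by (simp add: z dist_commute)
    qed
    then show ?thesis
      using proper by blast
  qed
  then obtain K where K: "compact K" "eventually (\<lambda>z. z \<in> K \<times> K) F"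
    by blast
  then have "\<exists>z\<in>K \<times> K. inf (nhds z) F \<noteq> bot"
    using compact_Times[OF K(1) K(1)] F unfolding compact_filter by blast
  then obtain a b where ab: "inf (nhds (a, b)) F \<noteq> bot"
    by auto
  have lim': "((\<lambda>(p, q). blinfun_apply \<phi> (molecule p q)) \<longlongrightarrow> \<phi> v) (inf (nhds (a, b)) F)"
    for \<phi> :: "'a lipfree \<Rightarrow>\<^sub>L real"
    by (rule tendsto_mono[OF inf_le2 lim])
  have "a \<noteq> b"
  proof
    assume "a = b"
    define T where "T = (\<Sum>m\<in>?S. \<bar>x m\<bar>)"
    define \<rho> where "\<rho> = ?e / (2 * (T + 1))"
    have "T \<ge> 0"
      by (auto simp: T_def intro: sum_nonneg)
    have \<rho>: "\<rho> > 0" "\<rho> * T < ?e"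
    proof -
      show "\<rho> > 0"
        using \<open>?e > 0\<close> \<open>T \<ge> 0\<close> by (simp add: \<rho>_def)
      have "?e * T < ?e * (2 * (T + 1))"
        using \<open>?e > 0\<close> \<open>T \<ge> 0\<close> by (intro mult_strict_left_mono) auto
      then show "\<rho> * T < ?e"
        using \<open>T \<ge> 0\<close> by (simp add: \<rho>_def pos_divide_less_eq)
    qed
    \<comment> \<open>Soft thresholding at \<open>\<rho>\<close> flattens \<open>f\<close> on the ball of radius
      \<open>\<rho>\<close> around \<open>a\<close>, keeps the Lipschitz constant and changes values by at
      most \<open>\<rho>\<close>.\<close>
    define k where "k p = f p - f a" for p
    define h where "h p = k p - max (- \<rho>) (min \<rho> (k p))" for p
    have k_lip: "\<bar>k p - k q\<bar> \<le> dist p q" for p q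
      using f_lip[of p q] by (simp add: k_def)
    have "\<bar>h p - h q\<bar> \<le> dist p q" for p q
      using k_lip[of p q] \<rho>(1) by (auto simp: h_def max_def min_def)
    then have h1: "1-lipschitz_on UNIV h"
      by (intro lipschitz_onI) (auto simp: dist_real_def)
    have hk: "\<bar>h p - k p\<bar> \<le> \<rho>" for p
      using \<rho>(1) by (auto simp: h_def)
    have "\<bar>pairing x h - pairing x k\<bar> \<le> \<rho> * T"
    proof -
      have "pairing x h - pairing x k = (\<Sum>m\<in>?S. x m * (h m - k m))"
        by (simp add: pairing_def right_diff_distrib sum_subtractf)
      also have "\<bar>\<dots>\<bar> \<le> (\<Sum>m\<in>?S. \<bar>x m * (h m - k m)\<bar>)"
        by (rule sum_abs)
      also have "\<dots> \<le> (\<Sum>m\<in>?S. \<bar>x m\<bar> * \<rho>)"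
        using hk by (intro sum_mono) (auto simp: abs_mult intro: mult_left_mono)
      finally show ?thesis
        by (simp add: T_def sum_distrib_left mult.commute)
    qed
    then have nz: "lip_fun h v \<noteq> 0" (is "?c \<noteq> 0")
      using \<rho>(2) pairing_shift[of "f a"] by (intro nonzero h1) (simp add: k_def[abs_def])
    have "eventually (\<lambda>z. dist z (a, b) < \<rho>) (nhds (a, b))"
      using \<rho>(1) by (auto simp: eventually_nhds_metric)
    then have "eventually (\<lambda>z. (case z of (p, q) \<Rightarrow> lip_fun h (molecule p q)) = 0) (nhds (a, b))"
    proof eventually_elim
      case (elim z)
      obtain p q where z: "z = (p, q)"
        by (cases z)
      have "dist p a < \<rho>" "dist q a < \<rho>"
        using elim dist_fst_le[of z "(a, b)"] dist_snd_le[of z "(a, b)"] \<open>a = b\<close> by (auto simp: z)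
      then have "h p = 0" "h q = 0"
        using k_lip[of p a] k_lip[of q a] by (auto simp: h_def k_def)
      then show ?case
        by (simp add: z lip_fun_molecule h1)
    qed
    then have "((\<lambda>(p, q). lip_fun h (molecule p q)) \<longlongrightarrow> 0) (inf (nhds (a, b)) F)"
      by (intro tendsto_eventually filter_leD[OF inf_le1])
    then have "?c = 0"
      using tendsto_unique[OF ab lim'[of "lip_fun h"]] by simp
    with nz show False ..
  qed
  moreover have "v = molecule a b"
  proof (rule lipfree_eqI)
    fix h :: "'a \<Rightarrow> real" assume h: "1-lipschitz_on UNIV h"
    have cont: "isCont h p" for p
      using lipschitz_on_continuous_on[OF h] by (simp add: continuous_on_eq_continuous_at)
    have "((\<lambda>z. (h (fst z) - h (snd z)) / dist (fst z) (snd z)) \<longlongrightarrow> (h (fst (a, b)) - h (snd (a, b))) / dist (fst (a, b)) (snd (a, b))) (nhds (a, b))"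
    proof (intro tendsto_divide tendsto_diff tendsto_dist)
      have 1: "(fst \<longlongrightarrow> fst (a, b)) (nhds (a, b))" "(snd \<longlongrightarrow> snd (a, b)) (nhds (a, b))"
        by (intro tendsto_fst tendsto_snd filterlim_ident)+
      then show "(fst \<longlongrightarrow> fst (a, b)) (nhds (a, b))" "(snd \<longlongrightarrow> snd (a, b)) (nhds (a, b))" .
      show "((\<lambda>z. h (fst z)) \<longlongrightarrow> h (fst (a, b))) (nhds (a, b))"
        by (rule isCont_tendsto_compose[OF cont 1(1)])
      show "((\<lambda>z. h (snd z)) \<longlongrightarrow> h (snd (a, b))) (nhds (a, b))"
        by (rule isCont_tendsto_compose[OF cont 1(2)])
    qed (use \<open>a \<noteq> b\<close> in simp)
    then have "((\<lambda>(p, q). lip_fun h (molecule p q)) \<longlongrightarrow> lip_fun h (molecule a b)) (nhds (a, b))"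
      by (simp add: lip_fun_molecule h case_prod_unfold)
    then have "((\<lambda>(p, q). lip_fun h (molecule p q)) \<longlongrightarrow> lip_fun h (molecule a b)) (inf (nhds (a, b)) F)"
      by (rule tendsto_mono[OF inf_le1])
    then show "lip_fun h v = lip_fun h (molecule a b)"
      using tendsto_unique[OF ab lim'[of "lip_fun h"]] by simp
  qed
  ultimately show ?thesis
    by blast
qed

section \<open>Reconstructing a vertex map from an edge map\<close>

definition edge_fun :: "('b \<Rightarrow> real) \<Rightarrow> bool" where
  "edge_fun f \<longleftrightarrow> (\<exists>c p q. c \<noteq> 0 \<and> p \<noteq> q \<and> f = (\<lambda>m. c * (indicator {p} m - indicator {q} m)))"

lemma edge_funE:
  assumes "edge_fun f" "f x \<noteq> 0"
  obtains y where "y \<noteq> x" "f = (\<lambda>m. f x * (indicator {x} m - indicator {y} m))"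
proof -
  obtain c p q where c: "c \<noteq> 0" "p \<noteq> q" "f = (\<lambda>m. c * (indicator {p} m - indicator {q} m))"
    using assms(1) by (auto simp: edge_fun_def)
  then consider "x = p" | "x = q"
    using assms(2) by (cases "x = p"; cases "x = q") auto
  then show ?thesis
  proof cases
    case 1 then show ?thesis using c by (intro that[of q]) (auto simp: indicator_def)
  next
    case 2 then show ?thesis using c by (intro that[of p]) (auto simp: indicator_def)
  qed
qed

lemma edge_fun_two:
  assumes "edge_fun f" "f x \<noteq> 0" "f y \<noteq> 0" "x \<noteq> y"
  shows "f = (\<lambda>m. f x * (indicator {x} m - indicator {y} m))"
proof -
  obtain z where z: "z \<noteq> x" "f = (\<lambda>m. f x * (indicator {x} m - indicator {z} m))"
    using edge_funE[OF assms(1,2)] by blast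
  then have "f y = f x * (indicator {x} y - indicator {z} y)"
    by metis
  then have "y = z"
    using assms(3,4) by (auto simp: indicator_def split: if_splits)
  with z show ?thesis
    by simp
qed

lemma edge_endpoints_unique:
  fixes s t :: real
  assumes eq: "(\<lambda>m. s * (indicator {x} m - indicator {y} m)) = (\<lambda>m. t * (indicator {p} m - indicator {q} m))"
    and "s \<noteq> 0" "x \<noteq> y"
  shows "{x, y} = {p, q}"
proof -
  have "x \<in> {p, q}"
  proof (rule ccontr)
    assume "x \<notin> {p, q}"
    then show False
      using fun_cong[OF eq, of x] assms(2,3) by simp
  qed
  moreover have "y \<in> {p, q}"
  proof (rule ccontr)
    assume "y \<notin> {p, q}"
    then show False
      using fun_cong[OF eq, of y] assms(2,3) by simp
  qed
  ultimately show ?thesis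
    using assms(3) by blast
qed

lemma edge_fun_minus:
  assumes "edge_fun (\<lambda>m. f m - g m)"
  shows "edge_fun (\<lambda>m. g m - f m)"
proof -
  obtain c p q where c: "c \<noteq> 0" "p \<noteq> q" and eq: "(\<lambda>m. f m - g m) = (\<lambda>m. c * (indicator {p} m - indicator {q} m))"
    using assms unfolding edge_fun_def by blast
  have "g m - f m = - c * (indicator {p} m - indicator {q} m)" for m
    using fun_cong[OF eq, of m] by (simp add: algebra_simps)
  then show ?thesis
    unfolding edge_fun_def using c by (intro exI[of _ "- c"] exI[of _ p] exI[of _ q]) auto
qed

lemma edge_fun_nonzero:
  assumes "edge_fun f"
  shows "f \<noteq> (\<lambda>_. 0)"
proof -
  obtain c p q where "c \<noteq> 0" "p \<noteq> q" "f = (\<lambda>m. c * (indicator {p} m - indicator {q} m))"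
    using assms by (auto simp: edge_fun_def)
  then have "f p \<noteq> 0"
    by simp
  then show ?thesis
    by auto
qed

text \<open>If \<open>u\<close> vanishes at one of the three points, say at \<open>k\<close>, then \<open>k\<close> is an endpoint of the edge
  \<open>u - c \<delta>\<^sub>k\<close>, and what remains of \<open>u\<close> is a mass \<open>c\<close> at the other endpoint. Otherwise each of the three
  edges has the remaining two points as endpoints, which forces contradictory values.\<close>

lemma point_mass_if_three_edges:
  fixes u :: "'b \<Rightarrow> real"
  assumes c: "c \<noteq> 0" and dist: "a \<noteq> b" "b \<noteq> e" "a \<noteq> e"
    and edge: "\<And>k. k \<in> {a, b, e} \<Longrightarrow> edge_fun (\<lambda>m. u m - c * indicator {k} m)"
  shows "\<exists>f. u = (\<lambda>m. c * indicator {f} m)"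
proof (cases "\<exists>k\<in>{a, b, e}. u k = 0")
  case True
  then obtain k where k: "k \<in> {a, b, e}" "u k = 0"
    by blast
  obtain y where y: "y \<noteq> k" and eq: "(\<lambda>m. u m - c * indicator {k} m)
      = (\<lambda>m. (u k - c * indicator {k} k) * (indicator {k} m - indicator {y} m))"
    using edge_funE[OF edge[OF k(1)], of k] k(2) c by auto
  have "u m = c * indicator {y} m" for m
    using fun_cong[OF eq, of m] k(2) by (simp add: algebra_simps)
  then show ?thesis
    by blast
next
  case False
  then have nz: "u a \<noteq> 0" "u b \<noteq> 0" "u e \<noteq> 0"
    by auto
  have step: "u k = c \<and> u i = - u j"
    if "k \<in> {a, b, e}" "i \<noteq> j" "k \<noteq> i" "k \<noteq> j" "u i \<noteq> 0" "u j \<noteq> 0" for k i j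
  proof -
    have "(\<lambda>m. u m - c * indicator {k} m)
      = (\<lambda>m. (u i - c * indicator {k} i) * (indicator {i} m - indicator {j} m))"
      using that by (intro edge_fun_two[OF edge]) (auto simp: indicator_def)
    from fun_cong[OF this, of k] fun_cong[OF this, of j] show ?thesis
      using that by (simp add: indicator_def split: if_splits)
  qed
  have "u a = c \<and> u b = - u e"
    by (rule step) (use nz dist in auto)
  moreover have "u b = c \<and> u a = - u e"
    by (rule step) (use nz dist in auto)
  moreover have "u e = c \<and> u a = - u b"
    by (rule step) (use nz dist in auto)
  ultimately have "c = 0"
    by linarith
  then show ?thesis
    using c by simp
qed

text \<open>Two non-parallel edge functions whose sum is an edge function share exactly one endpoint, and the
  values there cancel. The two cases say which endpoint of the first edge is shared.\<close>

lemma triangle_of_edges: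
  fixes G :: "'a \<Rightarrow> 'b \<Rightarrow> real"
  assumes xy: "edge_fun (\<lambda>m. G x m - G y m)" and yz: "edge_fun (\<lambda>m. G y m - G z m)"
    and xz: "edge_fun (\<lambda>m. G x m - G z m)"
    and np: "\<And>t. (\<lambda>m. G y m - G z m) \<noteq> (\<lambda>m. t * (G x m - G y m))"
  obtains H c a b e where "c \<noteq> 0" "a \<noteq> b" "b \<noteq> e" "a \<noteq> e"
    "G x = (\<lambda>m. H m + c * indicator {a} m)" "G y = (\<lambda>m. H m + c * indicator {b} m)"
    "G z = (\<lambda>m. H m + c * indicator {e} m)"
proof -
  obtain c a b where c: "c \<noteq> 0" "a \<noteq> b"
    and eq1: "\<And>m. G x m - G y m = c * (indicator {a} m - indicator {b} m)"
    using xy by (auto simp: edge_fun_def fun_eq_iff)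
  define \<beta> where "\<beta> m = G y m - G z m" for m
  define \<gamma> where "\<gamma> m = G x m - G z m" for m
  have \<beta>: "edge_fun \<beta>" and \<gamma>: "edge_fun \<gamma>"
    using yz xz by (simp_all add: \<beta>_def[abs_def] \<gamma>_def[abs_def])
  have \<gamma>\<beta>: "\<gamma> m = c * (indicator {a} m - indicator {b} m) + \<beta> m" for m
    using eq1[of m] by (simp add: \<gamma>_def \<beta>_def)
  have not_both: "\<not> (\<beta> a \<noteq> 0 \<and> \<beta> b \<noteq> 0)"
  proof
    assume "\<beta> a \<noteq> 0 \<and> \<beta> b \<noteq> 0"
    then have *: "\<beta> = (\<lambda>m. \<beta> a * (indicator {a} m - indicator {b} m))"
      using \<beta> c(2) by (intro edge_fun_two) auto
    obtain t where t: "\<And>m. \<beta> m = t * (indicator {a} m - indicator {b} m)"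
      using fun_cong[OF *] by blast
    have "G y m - G z m = t / c * (G x m - G y m)" for m
      unfolding eq1 using t[of m] c(1) by (simp add: \<beta>_def)
    then have "(\<lambda>m. G y m - G z m) = (\<lambda>m. t / c * (G x m - G y m))"
      by (intro ext)
    then show False
      using np by blast
  qed
  have not_none: "\<not> (\<beta> a = 0 \<and> \<beta> b = 0)"
  proof
    assume "\<beta> a = 0 \<and> \<beta> b = 0"
    then have "\<gamma> a = c" "\<gamma> b = - c"
      using \<gamma>\<beta>[of a] \<gamma>\<beta>[of b] c(2) by (auto simp: indicator_def)
    then have "\<gamma> = (\<lambda>m. c * (indicator {a} m - indicator {b} m))"
      using edge_fun_two[OF \<gamma>, of a b] c by simp
    then have "\<beta> = (\<lambda>_. 0)"
      using \<gamma>\<beta> by (simp add: fun_eq_iff)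
    then show False
      using edge_fun_nonzero[OF \<beta>] by simp
  qed
  show ?thesis
  proof (cases "\<beta> b = 0")
    case False
    then have "\<beta> a = 0"
      using not_both by simp
    obtain e where e: "e \<noteq> b" and eq2': "\<beta> = (\<lambda>m. \<beta> b * (indicator {b} m - indicator {e} m))"
      using edge_funE[OF \<beta> False] by blast
    have eq2: "\<beta> m = \<beta> b * (indicator {b} m - indicator {e} m)" for m
      using fun_cong[OF eq2'] .
    have "e \<noteq> a"
      using eq2[of a] \<open>\<beta> a = 0\<close> c(2) False by auto
    have "\<gamma> b = 0"
    proof (rule ccontr)
      assume "\<gamma> b \<noteq> 0"
      moreover have "\<gamma> a \<noteq> 0"
        using \<gamma>\<beta>[of a] \<open>\<beta> a = 0\<close> c by simp
      ultimately have *: "\<gamma> = (\<lambda>m. \<gamma> a * (indicator {a} m - indicator {b} m))"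
        using c(2) by (intro edge_fun_two[OF \<gamma>]) auto
      have "\<gamma> e = 0"
        using fun_cong[OF *, of e] e \<open>e \<noteq> a\<close> by simp
      then show False
        using \<gamma>\<beta>[of e] eq2[of e] e \<open>e \<noteq> a\<close> False by simp
    qed
    then have "\<beta> b = c"
      using \<gamma>\<beta>[of b] c(2) by simp
    have "G y m = G x m - c * indicator {a} m + c * indicator {b} m" for m
      using eq1[of m] by (simp add: algebra_simps)
    moreover have "G z m = G x m - c * indicator {a} m + c * indicator {e} m" for m
      using eq1[of m] eq2[of m] unfolding \<beta>_def[of m] \<open>\<beta> b = c\<close> by (simp add: algebra_simps)
    ultimately show ?thesis
      using c e \<open>e \<noteq> a\<close>
      by (intro that[of c a b e "\<lambda>m. G x m - c * indicator {a} m"]) auto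
  next
    case True
    then have False': "\<beta> a \<noteq> 0"
      using not_none by simp
    obtain e where e: "e \<noteq> a" and eq2': "\<beta> = (\<lambda>m. \<beta> a * (indicator {a} m - indicator {e} m))"
      using edge_funE[OF \<beta> False'] by blast
    have eq2: "\<beta> m = \<beta> a * (indicator {a} m - indicator {e} m)" for m
      using fun_cong[OF eq2'] .
    have "e \<noteq> b"
      using eq2[of b] True c(2) False' by auto
    have "\<gamma> a = 0"
    proof (rule ccontr)
      assume "\<gamma> a \<noteq> 0"
      moreover have "\<gamma> b \<noteq> 0"
        using \<gamma>\<beta>[of b] True c by simp
      ultimately have *: "\<gamma> = (\<lambda>m. \<gamma> a * (indicator {a} m - indicator {b} m))"
        using c(2) by (intro edge_fun_two[OF \<gamma>]) auto
      have "\<gamma> e = 0"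
        using fun_cong[OF *, of e] e \<open>e \<noteq> b\<close> by simp
      then show False
        using \<gamma>\<beta>[of e] eq2[of e] e \<open>e \<noteq> b\<close> False' by simp
    qed
    then have "\<beta> a = - c"
      using \<gamma>\<beta>[of a] c(2) by simp
    have "G x m = G y m + c * indicator {a} m + - c * indicator {b} m" for m
      using eq1[of m] by (simp add: algebra_simps)
    moreover have "G z m = G y m + c * indicator {a} m + - c * indicator {e} m" for m
      using eq2[of m] unfolding \<beta>_def[of m] \<open>\<beta> a = - c\<close> by (simp add: algebra_simps)
    ultimately show ?thesis
      using c e \<open>e \<noteq> b\<close>
      by (intro that[of "- c" b a e "\<lambda>m. G y m + c * indicator {a} m"]) auto
  qed
qed

text \<open>A triangle of \<open>adj\<close> fixes \<open>H\<close> and \<open>c\<close>. Any vertex joined to all three corners of a triangle that is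
  already in the required form gets the same form by \<open>point_mass_if_three_edges\<close>. An arbitrary vertex
  \<open>v\<close> need not be joined to the first triangle, but common neighbours provide a second triangle
  \<open>x1\<close>, \<open>y1\<close>, \<open>z1\<close> whose corners are joined to the first triangle as well as to \<open>v\<close>.\<close>

theorem vertex_map_of_edge_map:
  fixes adj :: "'a \<Rightarrow> 'a \<Rightarrow> bool" and G :: "'a \<Rightarrow> 'b \<Rightarrow> real"
  assumes ext: "\<And>S. finite S \<Longrightarrow> \<exists>w. \<forall>s\<in>S. adj s w"
    and edge: "\<And>x y. adj x y \<Longrightarrow> edge_fun (\<lambda>m. G x m - G y m)"
    and np: "\<And>x y z t. adj x y \<Longrightarrow> adj y z \<Longrightarrow> adj x z \<Longrightarrow>
      (\<lambda>m. G y m - G z m) \<noteq> (\<lambda>m. t * (G x m - G y m))"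
  obtains H c g where "c \<noteq> 0" "\<And>v m. G v m = H m + c * indicator {g v} m"
proof -
  obtain x :: 'a where True by simp
  obtain y where y: "adj x y"
    using ext[of "{x}"] by auto
  obtain z where z: "adj x z" "adj y z"
    using ext[of "{x, y}"] by auto
  obtain H c a b e where H: "c \<noteq> 0" "a \<noteq> b" "b \<noteq> e" "a \<noteq> e"
    "G x = (\<lambda>m. H m + c * indicator {a} m)" "G y = (\<lambda>m. H m + c * indicator {b} m)"
    "G z = (\<lambda>m. H m + c * indicator {e} m)"
    by (rule triangle_of_edges[OF edge[OF y] edge[OF z(2)] edge[OF z(1)] np[OF y z(2,1)]])
  define rep where "rep v \<longleftrightarrow> (\<exists>f. G v = (\<lambda>m. H m + c * indicator {f} m))" for v
  have edge': "adj v w \<or> adj w v \<Longrightarrow> edge_fun (\<lambda>m. G v m - G w m)" for v w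
    using edge edge_fun_minus[of "G w" "G v"] by blast
  have K4: "rep w"
    if r: "rep p" "rep q" "rep r" and tri: "adj p q" "adj q r" "adj p r"
      and w: "\<And>k. k \<in> {p, q, r} \<Longrightarrow> adj k w \<or> adj w k" for p q r w
  proof -
    obtain fp fq fr where f: "G p = (\<lambda>m. H m + c * indicator {fp} m)"
      "G q = (\<lambda>m. H m + c * indicator {fq} m)" "G r = (\<lambda>m. H m + c * indicator {fr} m)"
      using r by (auto simp: rep_def)
    have ne: "fp \<noteq> fq" "fq \<noteq> fr" "fp \<noteq> fr"
      using edge_fun_nonzero[OF edge[OF tri(1)]] edge_fun_nonzero[OF edge[OF tri(2)]]
        edge_fun_nonzero[OF edge[OF tri(3)]] by (auto simp: f)
    have "edge_fun (\<lambda>m. G w m - H m - c * indicator {k} m)" if "k \<in> {fp, fq, fr}" for k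
      using that edge'[of w p] edge'[of w q] edge'[of w r] w by (auto simp: f diff_diff_add)
    from point_mass_if_three_edges[OF H(1) ne this]
    obtain k where k: "(\<lambda>m. G w m - H m) = (\<lambda>m. c * indicator {k} m)"
      by blast
    have "G w m = H m + c * indicator {k} m" for m
      using fun_cong[OF k, of m] by simp
    then show ?thesis
      by (auto simp: rep_def)
  qed
  have base: "rep x" "rep y" "rep z"
    using H by (auto simp: rep_def)
  have "rep v" for v
  proof -
    obtain x1 where x1: "\<forall>s\<in>{v, x, y, z}. adj s x1"
      using ext[of "{v, x, y, z}"] by auto
    obtain y1 where y1: "\<forall>s\<in>{v, x, y, z, x1}. adj s y1"
      using ext[of "{v, x, y, z, x1}"] by auto
    obtain z1 where z1: "\<forall>s\<in>{v, x, y, z, x1, y1}. adj s z1"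
      using ext[of "{v, x, y, z, x1, y1}"] by auto
    have "rep x1" "rep y1" "rep z1"
      using K4[OF base y z(2,1)] x1 y1 z1 by auto
    then show ?thesis
      by (rule K4) (use x1 y1 z1 in auto)
  qed
  then obtain g where "\<And>v. G v = (\<lambda>m. H m + c * indicator {g v} m)"
    unfolding rep_def by metis
  with H(1) show ?thesis
    by (intro that[of c H g]) auto
qed

section \<open>Prague spaces and rigidity from bidual extreme molecules\<close>

lemma lipfree_of_inject:
  fixes x y :: "'a::metric_space \<Rightarrow> real"
  assumes "x \<in> free0" "y \<in> free0" "lipfree_of x = lipfree_of y"
  shows "x = y"
proof
  fix m
  define z where "z k = x k - y k" for k
  have z: "z \<in> free0" "lipfree_of z = 0"
    using free0_diff[OF assms(1,2)] lipfree_of_diff[OF assms(1,2)] assms(3)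
    by (simp_all add: z_def[abs_def])
  let ?S = "{k. z k \<noteq> 0}"
  have fin: "finite ?S" and sum0: "sum z ?S = 0"
    using z(1) by (auto simp: free0_def)
  show "x m = y m"
  proof (rule ccontr)
    assume "x m \<noteq> y m"
    then have m: "m \<in> ?S"
      by (simp add: z_def)
    obtain \<phi> :: "'a lipfree \<Rightarrow>\<^sub>L real" where \<phi>: "\<And>x y. x \<in> ?S \<Longrightarrow> y \<in> ?S \<Longrightarrow> \<phi> (dirac_diff x y) = indicator {m} x - indicator {m} y"
      using separating_functional[OF fin, of m] by blast
    have "0 = \<phi> (lipfree_of z)"
      by (simp add: z)
    also have "\<dots> = (\<Sum>k\<in>?S. z k * (indicator {m} k - 1))"
      unfolding lipfree_of_eq_sum_dirac_diff[OF z(1), of m] blinfun.sum_right blinfun.scaleR_right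
      using \<phi> m by (intro sum.cong) auto
    also have "\<dots> = (\<Sum>k\<in>?S. if k = m then z m else 0) - sum z ?S"
      unfolding sum_subtractf[symmetric] by (intro sum.cong) (auto simp: indicator_def)
    also have "\<dots> = z m"
      using fin m sum0 by simp
    finally show False
      using m by simp
  qed
qed

lemma dirac_diff_not_parallel:
  fixes x y z :: "'a::metric_space"
  assumes "x \<noteq> z" "y \<noteq> z"
  shows "dirac_diff y z \<noteq> t *\<^sub>R dirac_diff x y"
proof
  assume eq: "dirac_diff y z = t *\<^sub>R dirac_diff x y"
  have "finite {x, y, z}"
    by simp
  then obtain \<phi> :: "'a lipfree \<Rightarrow>\<^sub>L real"
    where \<phi>: "\<And>p q. p \<in> {x, y, z} \<Longrightarrow> q \<in> {x, y, z} \<Longrightarrow> \<phi> (dirac_diff p q) = indicator {z} p - indicator {z} q"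
    using separating_functional[of "{x, y, z}" z] by blast
  have "\<phi> (dirac_diff y z) = t * \<phi> (dirac_diff x y)"
    by (simp add: eq blinfun.scaleR_right)
  then show False
    using assms by (simp add: \<phi>)
qed

lemma dirac_diff_scale_in_free0: "(\<lambda>m. c * (indicator {x} m - indicator {y} m)) \<in> free0"
  by (rule free0_scale[OF dirac_diff_in_free0])

lemma lipfree_of_scaled_dirac_diff:
  "lipfree_of (\<lambda>m. c * (indicator {x} m - indicator {y} m)) = c *\<^sub>R dirac_diff x y"
  by (simp add: dirac_diff_def lipfree_of_scale[OF dirac_diff_in_free0])

lemma E_ext_imp_distinct: "(x, y) \<in> E_ext \<Longrightarrow> x \<noteq> y"
  by (simp add: E_ext_def)

text \<open>The map \<open>v \<mapsto> - v\<close> is an isometry and reverses molecules.\<close>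

lemma E_ext_sym:
  assumes "(x, y) \<in> E_ext"
  shows "(y, x) \<in> E_ext"
proof -
  have "molecule y x = - molecule x y"
    by (simp add: molecule_conv_dirac_diff dirac_diff_swap[of y x] dist_commute)
  moreover have "bidual_embed (- molecule x y) extreme_point_of cball 0 1"
    using assms by (intro bidual_extreme_isometry[where T = uminus])
      (auto simp: E_ext_def linear_uminus surj_uminus)
  ultimately show ?thesis
    using assms by (auto simp: E_ext_def)
qed

text \<open>A pair of points need not be an edge, but it has a common neighbour \<open>w\<close>, so \<open>T\<close> sends every
  difference of Dirac measures to a finitely supported element. These elements are written as
  differences \<open>G x - G y\<close>, which are edge functions on edges; injectivity of \<open>T\<close> keeps the images of two
  sides of a triangle from being parallel.\<close>

lemma isometry_from_point_map:
  fixes T :: "'a::metric_space lipfree \<Rightarrow> 'a lipfree"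
  assumes proper: "\<And>(p::'a) R. compact (cball p R)"
    and ext: "\<And>S :: 'a set. finite S \<Longrightarrow> \<exists>w. \<forall>s\<in>S. (s, w) \<in> E_ext"
    and T: "linear T" "\<And>v. norm (T v) = norm v" "surj T"
  obtains c g where "c \<noteq> 0" "\<And>x y. T (dirac_diff x y) = c *\<^sub>R dirac_diff (g x) (g y)"
proof -
  have inj: "T u = T v \<Longrightarrow> u = v" for u v
    using T(2)[of "u - v"] by (simp add: linear_diff[OF T(1)])
  have edge: "\<exists>c a b. c \<noteq> 0 \<and> a \<noteq> b \<and> T (dirac_diff x y) = lipfree_of (\<lambda>m. c * (indicator {a} m - indicator {b} m))"
    if "(x, y) \<in> E_ext" for x y
  proof -
    have "x \<noteq> y" "bidual_embed (molecule x y) extreme_point_of cball 0 1"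
      using that by (auto simp: E_ext_def)
    moreover from this have "T (molecule x y) \<noteq> 0"
      using T(2)[of "molecule x y"] by (auto simp: norm_molecule)
    ultimately obtain a b where ab: "a \<noteq> b" "T (molecule x y) = molecule a b"
      using bidual_extreme_is_molecule[OF proper _ bidual_extreme_isometry[OF T, of "molecule x y"]] by blast
    have "T (dirac_diff x y) = (dist x y / dist a b) *\<^sub>R dirac_diff a b"
      by (subst dirac_diff_conv_molecule, subst linear_cmul[OF T(1)], subst ab(2), subst molecule_conv_dirac_diff) simp
    moreover have "dist x y / dist a b \<noteq> 0"
      using \<open>x \<noteq> y\<close> ab(1) by simp
    ultimately show ?thesis
      using ab(1) lipfree_of_scaled_dirac_diff by metis
  qed
  have "\<exists>W\<in>free0. T (dirac_diff x undefined) = lipfree_of W" for x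
  proof -
    obtain w where "\<forall>s\<in>{x, undefined}. (s, w) \<in> E_ext"
      using ext[of "{x, undefined}"] by auto
    then obtain W W' where W: "W \<in> free0" "T (dirac_diff x w) = lipfree_of W"
      "W' \<in> free0" "T (dirac_diff undefined w) = lipfree_of W'"
      using edge[of x w] edge[of undefined w] dirac_diff_scale_in_free0 by force
    have "dirac_diff x undefined = dirac_diff x w - dirac_diff undefined w"
      using dirac_diff_add[of x undefined w] by (simp add: algebra_simps)
    then have "T (dirac_diff x undefined) = lipfree_of (\<lambda>m. W m - W' m)"
      by (simp add: linear_diff[OF T(1)] W lipfree_of_diff)
    then show ?thesis
      using free0_diff[OF W(1,3)] by blast
  qed
  then obtain G where G: "\<And>x. G x \<in> free0" "\<And>x. T (dirac_diff x undefined) = lipfree_of (G x)"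
    by metis
  have TG: "T (dirac_diff x y) = lipfree_of (\<lambda>m. G x m - G y m)" for x y
  proof -
    have "dirac_diff x y = dirac_diff x undefined - dirac_diff y undefined"
      using dirac_diff_add[of x y undefined] by (simp add: algebra_simps)
    then show ?thesis
      by (simp add: linear_diff[OF T(1)] G lipfree_of_diff)
  qed
  have G_edge: "edge_fun (\<lambda>m. G x m - G y m)" if E: "(x, y) \<in> E_ext" for x y
  proof -
    obtain c a b where "c \<noteq> 0" "a \<noteq> b"
      and eq: "lipfree_of (\<lambda>m. G x m - G y m) = lipfree_of (\<lambda>m. c * (indicator {a} m - indicator {b} m))"
      using edge[OF E] unfolding TG by blast
    then show ?thesis
      using lipfree_of_inject[OF free0_diff[OF G(1) G(1)] dirac_diff_scale_in_free0 eq]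
      by (auto simp: edge_fun_def)
  qed
  have G_np: "(\<lambda>m. G y m - G z m) \<noteq> (\<lambda>m. t * (G x m - G y m))"
    if "(x, y) \<in> E_ext" "(y, z) \<in> E_ext" "(x, z) \<in> E_ext" for x y z t
  proof
    assume "(\<lambda>m. G y m - G z m) = (\<lambda>m. t * (G x m - G y m))"
    then have "T (dirac_diff y z) = T (t *\<^sub>R dirac_diff x y)"
      by (simp add: TG linear_cmul[OF T(1)] lipfree_of_scale[OF free0_diff[OF G(1) G(1)]])
    then have "dirac_diff y z = t *\<^sub>R dirac_diff x y"
      by (rule inj)
    then show False
      using dirac_diff_not_parallel[of x z y t] that by (auto dest: E_ext_imp_distinct)
  qed
  obtain H c g where "c \<noteq> 0" and H: "\<And>v m. G v m = H m + c * indicator {g v} m"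
    by (rule vertex_map_of_edge_map[of "\<lambda>x y. (x, y) \<in> E_ext" G, OF ext G_edge G_np];
        (assumption | (rule that; assumption)))
  have "T (dirac_diff x y) = c *\<^sub>R dirac_diff (g x) (g y)" for x y
  proof -
    have "(\<lambda>m. G x m - G y m) = (\<lambda>m. c * (indicator {g x} m - indicator {g y} m))"
      by (simp add: H algebra_simps)
    then show ?thesis
      by (simp add: TG lipfree_of_scaled_dirac_diff)
  qed
  with \<open>c \<noteq> 0\<close> show ?thesis
    by (rule that)
qed

text \<open>Taking norms in \<open>T(\<delta>\<^sub>x - \<delta>\<^sub>y) = c (\<delta>\<^bsub>g x\<^esub> - \<delta>\<^bsub>g y\<^esub>)\<close> shows that \<open>g\<close> is a dilation. The inverse of \<open>T\<close> has
  a vertex map \<open>h\<close> as well, and \<open>g \<circ> h\<close> preserves every two-point set as a set. A point of a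
  three-point set is determined by two of the two-point subsets containing it, so \<open>g \<circ> h\<close> is the
  identity.\<close>

theorem lipschitz_free_rigidI:
  assumes proper: "\<And>(p::'a::metric_space) R. compact (cball p R)"
    and ext: "\<And>S :: 'a set. finite S \<Longrightarrow> \<exists>w. \<forall>s\<in>S. (s, w) \<in> E_ext"
  shows "lipschitz_free_rigid TYPE('a)"
  unfolding lipschitz_free_rigid_def
proof (intro allI impI, elim conjE)
  fix T :: "'a lipfree \<Rightarrow> 'a lipfree"
  assume T: "linear T" "\<forall>v. norm (T v) = norm v" "surj T"
  then have norm_T: "norm (T v) = norm v" for v
    by blast
  obtain c g where c: "c \<noteq> 0" and g: "\<And>x y. T (dirac_diff x y) = c *\<^sub>R dirac_diff (g x) (g y)"
    using isometry_from_point_map[OF proper ext T(1) norm_T T(3)] by metis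
  have dist_g: "dist x y = \<bar>c\<bar> * dist (g x) (g y)" for x y
    using norm_T[of "dirac_diff x y"] by (simp add: g norm_dirac_diff)
  obtain S where S: "linear S" "\<And>w. norm (S w) = norm w"
    and ST: "\<And>w. S (T w) = w" and TS: "\<And>w. T (S w) = w"
    using linear_isometry_inverse[OF T(1) norm_T T(3)] by metis
  have "surj S"
    using ST by (metis surjI)
  obtain d h where d: "d \<noteq> 0" and h: "\<And>x y. S (dirac_diff x y) = d *\<^sub>R dirac_diff (h x) (h y)"
    using isometry_from_point_map[OF proper ext S \<open>surj S\<close>] by metis
  have gh: "dirac_diff x y = (d * c) *\<^sub>R dirac_diff (g (h x)) (g (h y))" for x y
    using TS[of "dirac_diff x y"] by (simp add: h g linear_cmul[OF T(1)])
  have pair: "{x, y} = {g (h x), g (h y)}" if "x \<noteq> y" for x y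
  proof -
    have eq: "(\<lambda>m. 1 * (indicator {x} m - indicator {y} m))
        = (\<lambda>m. d * c * (indicator {g (h x)} m - indicator {g (h y)} m))"
      using gh[of x y]
      by (intro lipfree_of_inject dirac_diff_scale_in_free0) (simp only: lipfree_of_scaled_dirac_diff scaleR_one)
    show ?thesis
      by (rule edge_endpoints_unique[OF eq _ that]) simp
  qed
  have "g (h x) = x" for x
  proof -
    obtain y where "(x, y) \<in> E_ext"
      using ext[of "{x}"] by auto
    moreover obtain z where "(x, z) \<in> E_ext" "(y, z) \<in> E_ext"
      using ext[of "{x, y}"] by auto
    ultimately have "x \<noteq> y" "x \<noteq> z" "y \<noteq> z"
      by (auto dest: E_ext_imp_distinct)
    then show ?thesis
      using pair[of x y] pair[of x z] by (metis doubleton_eq_iff)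
  qed
  then have "surj g"
    by (metis surjI)
  moreover have "dilation_map \<bar>c\<bar> g"
    unfolding dilation_map_def using c by (intro conjI allI dist_g) simp
  moreover have "T (molecule x y) = sgn c *\<^sub>R molecule (g x) (g y)" if "x \<noteq> y" for x y
  proof -
    have "g x \<noteq> g y"
      using that dist_g[of x y] by auto
    then have "1 / dist x y * c = sgn c * (1 / dist (g x) (g y))"
      using c unfolding dist_g[of x y] by (simp add: sgn_if field_simps)
    then show ?thesis
      by (simp add: molecule_conv_dirac_diff linear_cmul[OF T(1)] g)
  qed
  moreover have "sgn c \<in> {1, - 1}"
    using c by (simp add: sgn_if)
  ultimately show "\<exists>\<epsilon>\<in>{1, -1}. \<exists>a. \<exists>g :: 'a \<Rightarrow> 'a. surj g \<and> dilation_map a g \<and>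
      (\<forall>x y. x \<noteq> y \<longrightarrow> T (molecule x y) = \<epsilon> *\<^sub>R molecule (g x) (g y))"
    by blast
qed

lemma dist_le_path_length:
  fixes p :: "nat \<Rightarrow> 'a::metric_space"
  shows "dist (p 0) (p k) \<le> (\<Sum>i=1..k. dist (p (i - 1)) (p i))"
proof (induction k)
  case (Suc k)
  then show ?case
    using dist_triangle[of "p 0" "p (Suc k)" "p k"] by simp
qed simp

text \<open>Two edges, through a common neighbour of \<open>x\<close> and \<open>y\<close> that is close to \<open>y\<close>, connect \<open>x\<close> to \<open>y\<close> with
  total length close to the distance.\<close>

theorem prague_spaceI:
  assumes ext: "\<And>(S :: 'a::metric_space set) y e. finite S \<Longrightarrow> e > 0 \<Longrightarrow> \<exists>w. dist y w < e \<and> (\<forall>s\<in>S. (s, w) \<in> E_ext)"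
  shows "prague_space TYPE('a)"
proof -
  have V: "(V_ext :: 'a set) = UNIV"
  proof -
    have "x \<in> V_ext" for x :: 'a
      using ext[of "{x}" 1 x] by (auto simp: V_ext_def intro: FieldI1)
    then show ?thesis
      by blast
  qed
  have conn: "(x, y) \<in> E_ext\<^sup>*" for x y :: 'a
  proof -
    obtain w where "(x, w) \<in> E_ext" "(y, w) \<in> E_ext"
      using ext[of "{x, y}" 1 x] by auto
    then show ?thesis
      using E_ext_sym[of y w] by (meson converse_rtrancl_into_rtrancl r_into_rtrancl)
  qed
  have "Inf {\<Sum>i=1..k. dist (p (i - 1)) (p i) | (k::nat) (p :: nat \<Rightarrow> 'a).
          p 0 = x \<and> p k = y \<and> (\<forall>i\<in>{1..k}. (p (i - 1), p i) \<in> E_ext)} = dist x y" (is "Inf ?L = _")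
    for x y :: 'a
  proof (rule cInf_eq)
    show "dist x y \<le> l" if "l \<in> ?L" for l
      using that dist_le_path_length by blast
    fix b assume b: "\<And>l. l \<in> ?L \<Longrightarrow> b \<le> l"
    show "b \<le> dist x y"
    proof (rule field_le_epsilon)
      fix e :: real assume "e > 0"
      then obtain w where w: "dist y w < e / 2" "(x, w) \<in> E_ext" "(y, w) \<in> E_ext"
        using ext[of "{x, y}" "e / 2" y] by auto
      define p where "p = (\<lambda>i :: nat. if i = 0 then x else if i = 1 then w else y)"
      have two: "{1..2} = {1, 2 :: nat}"
        by auto
      have "(\<Sum>i=1..2. dist (p (i - 1)) (p i)) \<in> ?L"
        using w E_ext_sym[OF w(3)] by (intro CollectI exI[of _ 2] exI[of _ p]) (auto simp: p_def two)
      then have "b \<le> (\<Sum>i=1..2. dist (p (i - 1)) (p i))"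
        by (rule b)
      then have "b \<le> dist x w + dist w y"
        by (simp add: p_def numeral_2_eq_2)
      then show "b \<le> dist x y + e"
        using w(1) dist_triangle[of x w y] by (simp add: dist_commute)
    qed
  qed
  then show ?thesis
    using conn by (auto simp: prague_space_def V)
qed

section \<open>Stratified Lie algebras\<close>

context stratified_lie_algebra
begin

lemmas bracket_add_left = bilinear_ladd[OF bilinear]
  and bracket_add_right = bilinear_radd[OF bilinear]
  and bracket_scale_left = bilinear_lmul[OF bilinear]
  and bracket_scale_right = bilinear_rmul[OF bilinear]
  and bracket_minus_right = bilinear_rneg[OF bilinear]
  and bracket_zero_left = bilinear_lzero[OF bilinear]
  and bracket_zero_right = bilinear_rzero[OF bilinear]

lemma linear_bracket_left: "linear (\<lambda>x. bracket x y)" and linear_bracket_right: "linear (bracket x)"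
  using bilinear by (auto simp: bilinear_def)

lemma bracket_antisym: "bracket y x = - bracket x y"
proof -
  have "bracket (x + y) (x + y) = bracket x y + bracket y x"
    unfolding bracket_add_left bracket_add_right by (simp add: alternating)
  then have "bracket x y + bracket y x = 0"
    by (simp only: alternating)
  then show ?thesis
    by (simp add: add_eq_0_iff)
qed

lemma layer_in: "i \<in> {1..r} \<Longrightarrow> layer V r x i \<in> V i"
  and layer_out: "i \<notin> {1..r} \<Longrightarrow> layer V r x i = 0"
  and sum_layers: "(\<Sum>i=1..r. layer V r x i) = x"
  using theI'[OF direct_sum[of x]] unfolding layer_def by auto

lemmas sum_layers_Suc = sum_layers[unfolded One_nat_def]

lemma layer_unique:
  assumes "\<And>i. i \<in> {1..r} \<Longrightarrow> c i \<in> V i" "\<And>i. i \<notin> {1..r} \<Longrightarrow> c i = 0" "x = (\<Sum>i=1..r. c i)"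
  shows "layer V r x = c"
  unfolding layer_def using assms by (intro the1_equality direct_sum) auto

lemma layer_add: "layer V r (x + y) i = layer V r x i + layer V r y i"
proof -
  have "layer V r (x + y) = (\<lambda>i. layer V r x i + layer V r y i)"
    by (rule layer_unique)
      (auto simp: layer_out sum.distrib sum_layers_Suc intro!: subspace_add[OF subspace] layer_in)
  then show ?thesis by simp
qed

lemma layer_scale: "layer V r (c *\<^sub>R x) i = c *\<^sub>R layer V r x i"
proof -
  have "layer V r (c *\<^sub>R x) = (\<lambda>i. c *\<^sub>R layer V r x i)"
    by (rule layer_unique)
      (auto simp: layer_out sum_layers_Suc simp flip: scaleR_sum_right intro!: subspace_scale[OF subspace] layer_in)
  then show ?thesis by simp
qed

lemma linear_layer: "linear (\<lambda>x. layer V r x i)"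
  by (simp add: linearI layer_add layer_scale)

lemma layer_of_layer:
  assumes "x \<in> V j" "j \<in> {1..r}"
  shows "layer V r x i = (if i = j then x else 0)"
proof -
  have "layer V r x = (\<lambda>i. if i = j then x else 0)"
    using assms by (intro layer_unique) (auto simp: subspace_0[OF subspace])
  then show ?thesis by simp
qed

lemma carnot_dilation_of_layer:
  assumes "x \<in> V j" "j \<in> {1..r}"
  shows "carnot_dilation V r t x = t ^ j *\<^sub>R x"
proof -
  have "carnot_dilation V r t x = (\<Sum>i=1..r. if i = j then t ^ j *\<^sub>R x else 0)"
    unfolding carnot_dilation_def by (intro sum.cong) (auto simp: layer_of_layer[OF assms])
  also have "\<dots> = t ^ j *\<^sub>R x"
    using assms(2) by simp
  finally show ?thesis .
qed

lemma layer_carnot_dilation: "layer V r (carnot_dilation V r t x) i = t ^ i *\<^sub>R layer V r x i"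
proof -
  have "layer V r (carnot_dilation V r t x) = (\<lambda>i. t ^ i *\<^sub>R layer V r x i)"
    unfolding carnot_dilation_def
    by (rule layer_unique) (auto simp: layer_out intro!: subspace_scale[OF subspace] layer_in)
  then show ?thesis by simp
qed

text \<open>With zero layers outside \<open>{1..r}\<close>, the rule \<open>[V\<^sub>i, V\<^sub>j] \<subseteq> V\<^sub>i\<^sub>+\<^sub>j\<close> holds for all positive indices.\<close>

definition ext_layer :: "nat \<Rightarrow> 'g set" where
  "ext_layer i = (if i \<in> {1..r} then V i else {0})"

lemma subspace_ext_layer: "subspace (ext_layer i)"
  by (auto simp: ext_layer_def subspace)

lemma bracket_first_layer:
  assumes "j \<ge> 1" "x \<in> ext_layer 1" "y \<in> ext_layer j"
  shows "bracket x y \<in> ext_layer (1 + j)"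
proof -
  have x: "x \<in> V 1"
    using assms(2) r_pos by (simp add: ext_layer_def)
  consider "j < r" | "j = r" | "j > r"
    by linarith
  then show ?thesis
  proof cases
    case 1
    then have "bracket x y \<in> span {bracket x y | x y. x \<in> V 1 \<and> y \<in> V j}"
      using x assms by (intro span_base) (auto simp: ext_layer_def)
    then show ?thesis
      using 1 generate[of j] assms(1) by (simp add: ext_layer_def)
  next
    case 2
    then show ?thesis
      using top_layer[OF x] assms by (simp add: ext_layer_def)
  next
    case 3
    then show ?thesis
      using assms by (simp add: ext_layer_def bracket_zero_right)
  qed
qed

text \<open>Induction on \<open>i\<close>: the layer \<open>V (Suc i)\<close> is spanned by brackets \<open>[a, b]\<close> with \<open>a\<close> in the first layer and
  \<open>b\<close> in \<open>V i\<close>, and the Jacobi identity gives \<open>[[a, b], y] = [a, [b, y]] - [b, [a, y]]\<close>.\<close>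

lemma bracket_ext_layer:
  assumes "i \<ge> 1" "j \<ge> 1" "x \<in> ext_layer i" "y \<in> ext_layer j"
  shows "bracket x y \<in> ext_layer (i + j)"
  using assms
proof (induction i arbitrary: j x y rule: nat_induct_at_least)
  case base
  then show ?case
    using bracket_first_layer[of j x y] by simp
next
  case (Suc i)
  show ?case
  proof (cases "Suc i \<le> r")
    case False
    then show ?thesis
      using Suc.prems by (simp add: ext_layer_def bracket_zero_left subspace_0 subspace)
  next
    case True
    then have "x \<in> span {bracket a b | a b. a \<in> V 1 \<and> b \<in> V i}"
      using Suc.prems Suc.hyps generate[of i] by (simp add: ext_layer_def)
    then show ?thesis
    proof (induction rule: span_induct)
      case base
      show ?case
        unfolding subspace_def
        using subspace_0[OF subspace_ext_layer] subspace_add[OF subspace_ext_layer] subspace_scale[OF subspace_ext_layer]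
        by (simp add: bracket_zero_left bracket_add_left bracket_scale_left)
    next
      case (step x)
      then obtain a b where ab: "x = bracket a b" "a \<in> ext_layer 1" "b \<in> ext_layer i"
        using True Suc.hyps r_pos by (auto simp: ext_layer_def)
      have "bracket a (bracket b y) \<in> ext_layer (1 + (i + j))"
        using Suc.prems Suc.hyps Suc.IH[of j b y] ab by (intro bracket_first_layer) auto
      moreover have "bracket b (bracket a y) \<in> ext_layer (i + (1 + j))"
        using Suc.prems ab bracket_first_layer[of j a y] by (intro Suc.IH) auto
      moreover have "bracket x y = bracket a (bracket b y) - bracket b (bracket a y)"
        using jacobi[of a b y] bracket_antisym[of y "bracket a b"] bracket_antisym[of y a]
        by (simp add: ab(1) bracket_minus_right algebra_simps add_eq_0_iff)
      ultimately show ?case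
        using subspace_diff[OF subspace_ext_layer] by simp
    qed
  qed
qed

text \<open>The sum of the layers from \<open>k\<close> on; for \<open>k \<ge> 1\<close> a term of the lower central series.\<close>

definition filtration :: "nat \<Rightarrow> 'g set" where
  "filtration k = {x. \<forall>i<k. layer V r x i = 0}"

lemma subspace_filtration: "subspace (filtration k)"
  unfolding subspace_def filtration_def
  by (auto simp: layer_add layer_scale linear_0[OF linear_layer])

lemma filtration_antimono: "k \<le> l \<Longrightarrow> filtration l \<subseteq> filtration k"
  by (auto simp: filtration_def)

lemma filtration_1: "filtration 1 = UNIV"
  by (auto simp: filtration_def layer_out)

lemma filtration_above: "filtration (Suc r) = {0}"
proof
  show "filtration (Suc r) \<subseteq> {0}"
  proof
    fix x assume "x \<in> filtration (Suc r)"
    then have "(\<Sum>i=1..r. layer V r x i) = 0"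
      by (intro sum.neutral) (auto simp: filtration_def)
    then show "x \<in> {0}"
      by (simp add: sum_layers_Suc)
  qed
  show "{0} \<subseteq> filtration (Suc r)"
    using subspace_0[OF subspace_filtration] by simp
qed

lemma ext_layer_subset_filtration: "k \<le> i \<Longrightarrow> ext_layer i \<subseteq> filtration k"
  by (auto simp: ext_layer_def filtration_def layer_of_layer subspace_0[OF subspace_filtration]
      linear_0[OF linear_layer])

lemma layer_in_ext_layer: "layer V r x i \<in> ext_layer i"
  by (auto simp: ext_layer_def layer_in layer_out)

lemma bracket_eq_sum_layers:
  "bracket x y = (\<Sum>i=1..r. \<Sum>j=1..r. bracket (layer V r x i) (layer V r y j))"
proof -
  have "bracket x y = bracket (\<Sum>i=1..r. layer V r x i) (\<Sum>j=1..r. layer V r y j)"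
    by (simp add: sum_layers_Suc)
  also have "\<dots> = (\<Sum>i=1..r. bracket (layer V r x i) (\<Sum>j=1..r. layer V r y j))"
    by (rule linear_sum[OF linear_bracket_left])
  also have "\<dots> = (\<Sum>i=1..r. \<Sum>j=1..r. bracket (layer V r x i) (layer V r y j))"
    by (simp only: linear_sum[OF linear_bracket_right])
  finally show ?thesis .
qed

lemma bracket_filtration:
  assumes "x \<in> filtration k" "y \<in> filtration l"
  shows "bracket x y \<in> filtration (k + l)"
proof (subst bracket_eq_sum_layers, intro subspace_sum[OF subspace_filtration])
  fix i j assume ij: "i \<in> {1..r}" "j \<in> {1..r}"
  show "bracket (layer V r x i) (layer V r y j) \<in> filtration (k + l)"
  proof (cases "k \<le> i \<and> l \<le> j")
    case True
    then have "ext_layer (i + j) \<subseteq> filtration (k + l)"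
      by (intro ext_layer_subset_filtration) auto
    moreover have "bracket (layer V r x i) (layer V r y j) \<in> ext_layer (i + j)"
      using ij by (intro bracket_ext_layer layer_in_ext_layer) auto
    ultimately show ?thesis
      by blast
  next
    case False
    then have "layer V r x i = 0 \<or> layer V r y j = 0"
      using assms by (auto simp: filtration_def not_le)
    then show ?thesis
      using subspace_0[OF subspace_filtration] by (auto simp: bracket_zero_left bracket_zero_right)
  qed
qed

text \<open>The last nonzero layer is central because brackets with it would lie in a higher layer. It is not
  the first one, since all brackets lie in the layers from the second on.\<close>

lemma central_element_exists:
  assumes "bracket g h \<noteq> 0"
  obtains s c where "2 \<le> s" "s \<le> r" "c \<in> V s" "c \<noteq> 0" "\<And>x. bracket x c = 0"
proof -
  let ?I = "{i\<in>{1..r}. V i \<noteq> {0}}"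
  have "bracket g h \<in> filtration (1 + 1)"
    by (intro bracket_filtration) (simp_all add: filtration_1[simplified])
  then have low: "layer V r (bracket g h) i = 0" if "i < 2" for i
    using that by (simp add: filtration_def)
  have "\<exists>i\<in>{1..r}. layer V r (bracket g h) i \<noteq> 0"
    using sum_layers[of "bracket g h"] assms by (metis sum.neutral)
  then obtain i where i: "i \<in> {1..r}" "layer V r (bracket g h) i \<noteq> 0"
    by blast
  then have iI: "i \<in> ?I" "i \<ge> 2"
    using layer_in[OF i(1), of "bracket g h"] low[of i] by (auto simp: not_less[symmetric])
  define s where "s = Max ?I"
  have s: "s \<in> ?I" "\<And>j. j \<in> ?I \<Longrightarrow> j \<le> s"
    using iI(1) unfolding s_def by (intro Max_in Max_ge; auto)+
  then have "V s \<noteq> {0}" "0 \<in> V s"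
    using subspace_0[OF subspace, of s] by auto
  then obtain c where c: "c \<in> V s" "c \<noteq> 0"
    by blast
  have "bracket x c = 0" for x
  proof -
    have "ext_layer (i + s) = {0}" if "i \<ge> 1" for i
      using that s(2)[of "i + s"] by (auto simp: ext_layer_def)
    then have "bracket (layer V r x i) c = 0" if "i \<in> {1..r}" for i
      using bracket_ext_layer[OF _ _ layer_in_ext_layer[of x i], of s c] that c s(1)
      by (auto simp: ext_layer_def[of s])
    then have "bracket (\<Sum>i=1..r. layer V r x i) c = 0"
      unfolding linear_sum[OF linear_bracket_left] by (intro sum.neutral) auto
    then show ?thesis
      by (simp add: sum_layers_Suc)
  qed
  then show ?thesis
    using that[of s c] c s s(2)[OF iI(1)] iI(2) by auto
qed

end

section \<open>The Baker--Campbell--Hausdorff product\<close>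

text \<open>The argument of the nested bracket in \<open>bch\<close> as a word in two letters, \<open>True\<close> for the first.\<close>

definition bch_word :: "(nat \<times> nat) list \<Rightarrow> bool list" where
  "bch_word ps = concat (map (\<lambda>(p, q). replicate p True @ replicate q False) ps)"

definition word_bracket :: "('g::zero \<Rightarrow> 'g \<Rightarrow> 'g) \<Rightarrow> 'g \<Rightarrow> 'g \<Rightarrow> bool list \<Rightarrow> 'g" where
  "word_bracket br x y w = nested_bracket br (map (\<lambda>b. if b then x else y) w)"

lemma length_bch_word: "length (bch_word ps) = bch_degree ps"
  by (induction ps) (auto simp: bch_word_def bch_degree_def)

lemma map_bch_word:
  "map (\<lambda>b. if b then x else y) (bch_word ps) = concat (map (\<lambda>(p, q). replicate p x @ replicate q y) ps)"
  by (induction ps) (auto simp: bch_word_def map_replicate_const)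

text \<open>The only words of length one are the single letters, so the terms of degree one of the series are \<open>x\<close>
  and \<open>y\<close>.\<close>

lemma bch_words_low_degree:
  assumes "r \<ge> 1"
  shows "{ps \<in> bch_words r. \<not> 2 \<le> bch_degree ps} = {[(1, 0)], [(0, 1)]}"
proof
  show "{ps \<in> bch_words r. \<not> 2 \<le> bch_degree ps} \<subseteq> {[(1, 0)], [(0, 1)]}"
  proof
    fix ps assume "ps \<in> {ps \<in> bch_words r. \<not> 2 \<le> bch_degree ps}"
    then have ps: "ps \<noteq> []" "\<And>p q. (p, q) \<in> set ps \<Longrightarrow> p + q > 0" "bch_degree ps < 2"
      by (auto simp: bch_words_def)
    then obtain p q qs where c: "ps = (p, q) # qs"
      by (cases ps) auto
    have "p + q > 0" "p + q + bch_degree qs < 2"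
      using ps by (auto simp: c bch_degree_def)
    moreover have "qs = []"
    proof (rule ccontr)
      assume "qs \<noteq> []"
      then obtain p' q' qs' where "qs = (p', q') # qs'"
        by (cases qs) auto
      then have "bch_degree qs \<ge> p' + q'" "p' + q' > 0"
        using ps(2)[of p' q'] by (auto simp: c bch_degree_def)
      then show False
        using \<open>p + q > 0\<close> \<open>p + q + bch_degree qs < 2\<close> by linarith
    qed
    ultimately show "ps \<in> {[(1, 0)], [(0, 1)]}"
      by (auto simp: c bch_degree_def)
  qed
  show "{[(1, 0)], [(0, 1)]} \<subseteq> {ps \<in> bch_words r. \<not> 2 \<le> bch_degree ps}"
    using assms by (auto simp: bch_words_def bch_degree_def)
qed

lemma bch_eq:
  assumes "r \<ge> 1"
  shows "bch r br x y = x + y + (\<Sum>ps | ps \<in> bch_words r \<and> 2 \<le> bch_degree ps.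
    bch_coeff ps *\<^sub>R word_bracket br x y (bch_word ps))"
proof -
  let ?f = "\<lambda>ps. bch_coeff ps *\<^sub>R word_bracket br x y (bch_word ps)"
  have "bch r br x y = sum ?f (bch_words r)"
    by (simp add: bch_def word_bracket_def map_bch_word)
  also have "\<dots> = sum ?f {ps \<in> bch_words r. 2 \<le> bch_degree ps} + sum ?f {ps \<in> bch_words r. \<not> 2 \<le> bch_degree ps}"
    by (subst sum.union_disjoint[symmetric]) (auto intro!: sum.cong simp: finite_bch_words)
  also have "sum ?f {ps \<in> bch_words r. \<not> 2 \<le> bch_degree ps} = x + y"
    unfolding bch_words_low_degree[OF assms]
    by (simp add: bch_coeff_def bch_degree_def bch_word_def word_bracket_def)
  finally show ?thesis
    by (simp add: add.commute)
qed

context stratified_lie_algebra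
begin

lemma word_bracket_in_filtration:
  assumes "x \<in> filtration k" "y \<in> filtration k" "w \<noteq> []" "k \<ge> 1"
  shows "word_bracket bracket x y w \<in> filtration k
    \<and> (2 \<le> length w \<longrightarrow> word_bracket bracket x y w \<in> filtration (Suc k))"
  using assms(3)
proof (induction w rule: induct_list012)
  case (3 a b w)
  have "word_bracket bracket x y (a # b # w) = bracket (if a then x else y) (word_bracket bracket x y (b # w))"
    by (simp add: word_bracket_def)
  moreover have "bracket (if a then x else y) (word_bracket bracket x y (b # w)) \<in> filtration (k + k)"
    using 3 assms(1,2) by (intro bracket_filtration) auto
  moreover have "filtration (k + k) \<subseteq> filtration (Suc k)" "filtration (k + k) \<subseteq> filtration k"
    using assms(4) by (intro filtration_antimono; simp)+
  ultimately show ?case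
    by auto
qed (use assms in \<open>auto simp: word_bracket_def\<close>)

lemma word_bracket_commuting:
  assumes "bracket x y = 0" "2 \<le> length w"
  shows "word_bracket bracket x y w = 0"
  using assms(2)
proof (induction w rule: induct_list012)
  case (3 a b w)
  show ?case
  proof (cases w)
    case Nil
    then show ?thesis
      using assms(1) bracket_antisym[of y x] by (auto simp: word_bracket_def alternating)
  next
    case (Cons d w')
    then have "word_bracket bracket x y (b # w) = 0"
      using 3 by simp
    then show ?thesis
      by (simp add: word_bracket_def bracket_zero_right)
  qed
qed auto

lemma bch_commuting:
  assumes "bracket x y = 0"
  shows "bch r bracket x y = x + y"
  unfolding bch_eq[OF r_pos]
  by (simp add: word_bracket_commuting[OF assms] length_bch_word)

text \<open>Every term of degree at least two contains a bracket of two elements of the \<open>k\<close>-th filtration step,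
  which lies in the step \<open>2 k\<close>.\<close>

lemma bch_mod_filtration:
  assumes "x \<in> filtration k" "y \<in> filtration k" "k \<ge> 1"
  shows "bch r bracket x y - (x + y) \<in> filtration (Suc k)"
proof -
  have "bch_coeff ps *\<^sub>R word_bracket bracket x y (bch_word ps) \<in> filtration (Suc k)"
    if "2 \<le> bch_degree ps" for ps
  proof -
    have "2 \<le> length (bch_word ps)"
      using that by (simp add: length_bch_word)
    moreover from this have "bch_word ps \<noteq> []"
      by auto
    ultimately show ?thesis
      using word_bracket_in_filtration[OF assms(1,2) _ assms(3)]
      by (intro subspace_scale[OF subspace_filtration]) auto
  qed
  then show ?thesis
    unfolding bch_eq[OF r_pos] add_diff_cancel_left'
    by (intro subspace_sum[OF subspace_filtration]) auto
qed

end

section \<open>Coordinatewise convergence\<close>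

text \<open>Convergence in the vector space topology of a finite-dimensional space, expressed without a norm
  on the space.\<close>

definition coord_tendsto :: "(nat \<Rightarrow> 'g::real_vector) \<Rightarrow> 'g \<Rightarrow> bool" where
  "coord_tendsto X x \<longleftrightarrow> (\<forall>f :: 'g \<Rightarrow> real. linear f \<longrightarrow> (\<lambda>n. f (X n)) \<longlonglongrightarrow> f x)"

lemma coord_tendstoD: "coord_tendsto X x \<Longrightarrow> linear f \<Longrightarrow> (\<lambda>n. f (X n)) \<longlonglongrightarrow> (f x :: real)"
  by (simp add: coord_tendsto_def)

lemma coord_tendsto_const: "coord_tendsto (\<lambda>_. x) x"
  by (simp add: coord_tendsto_def)

lemma coord_tendsto_add:
  "coord_tendsto X x \<Longrightarrow> coord_tendsto Y y \<Longrightarrow> coord_tendsto (\<lambda>n. X n + Y n) (x + y)"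
  by (auto simp: coord_tendsto_def linear_add intro!: tendsto_add)

lemma coord_tendsto_scale:
  "c \<longlonglongrightarrow> c' \<Longrightarrow> coord_tendsto X x \<Longrightarrow> coord_tendsto (\<lambda>n. c n *\<^sub>R X n) (c' *\<^sub>R x)"
  by (auto simp: coord_tendsto_def linear_cmul intro!: tendsto_mult)

lemma coord_tendsto_minus: "coord_tendsto X x \<Longrightarrow> coord_tendsto (\<lambda>n. - X n) (- x)"
  using coord_tendsto_scale[of "\<lambda>_. - 1" "- 1" X x] by simp

lemma coord_tendsto_sum:
  "(\<And>i. i \<in> I \<Longrightarrow> coord_tendsto (X i) (x i)) \<Longrightarrow> coord_tendsto (\<lambda>n. \<Sum>i\<in>I. X i n) (\<Sum>i\<in>I. x i)"
  by (auto simp: coord_tendsto_def linear_sum intro!: tendsto_sum)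

lemma linear_functional_vanishing_on:
  assumes "subspace S" "b \<notin> S"
  obtains f :: "'g::real_vector \<Rightarrow> real" where "linear f" "f b = 1" "\<And>x. x \<in> S \<Longrightarrow> f x = 0"
proof -
  obtain B where B: "B \<subseteq> S" "independent B" "S \<subseteq> span B"
    using real_vector.maximal_independent_subset[of S] by blast
  have "span B = S"
    using span_minimal[OF B(1) assms(1)] B(3) by (rule subset_antisym)
  then have "independent (insert b B)"
    using assms(2) B(2) by (intro real_vector.independent_insertI) auto
  then obtain f :: "'g \<Rightarrow> real" where f: "linear f" "\<forall>x\<in>insert b B. f x = (if x = b then 1 else 0)"
    using linear_independent_extend[of "insert b B" "\<lambda>x. if x = b then 1 else 0"] by blast
  have "f x = 0" if "x \<in> S" for x
  proof -
    have "x \<in> span B"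
      using that \<open>span B = S\<close> by simp
    then show ?thesis
    proof (rule linear_eq_0_on_span[OF f(1), rotated])
      show "f x = 0" if "x \<in> B" for x
        using f(2) that B(1) assms(2) by auto
    qed
  qed
  then show ?thesis
    using f by (intro that[of f]) auto
qed

context stratified_lie_algebra
begin

lemma coordinates_exist:
  obtains B :: "'g set" and crd :: "'g \<Rightarrow> 'g \<Rightarrow> real"
  where "finite B" "\<And>b. linear (crd b)" "\<And>x. x = (\<Sum>b\<in>B. crd b x *\<^sub>R b)"
proof -
  obtain B0 :: "'g set" where B0: "finite B0" "span B0 = UNIV"
    using finite_dim by blast
  obtain B where B: "B \<subseteq> B0" "independent B" "B0 \<subseteq> span B"
    using real_vector.maximal_independent_subset[of B0] by blast
  have fin: "finite B"
    using B(1) B0(1) by (rule finite_subset)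
  have span: "span B = UNIV"
    using span_minimal[OF B(3) subspace_span] B0(2) by blast
  have "\<exists>g :: 'g \<Rightarrow> real. linear g \<and> (\<forall>x\<in>B. g x = (if x = b then 1 else 0))" for b
    by (rule linear_independent_extend[OF B(2)])
  then obtain crd :: "'g \<Rightarrow> 'g \<Rightarrow> real" where crd: "\<And>b. linear (crd b)"
    "\<And>b x. x \<in> B \<Longrightarrow> crd b x = (if x = b then 1 else 0)"
    by metis
  have lin: "linear (\<lambda>x. \<Sum>b\<in>B. crd b x *\<^sub>R b)"
    by (intro linearI)
      (simp_all add: linear_add[OF crd(1)] linear_cmul[OF crd(1)] scaleR_add_left sum.distrib scaleR_sum_right)
  have "x = (\<Sum>b\<in>B. crd b x *\<^sub>R b)" for x
  proof (rule linear_eq_on_span[OF linear_ident lin])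
    show "x \<in> span B"
      by (simp add: span)
    fix y assume "y \<in> B"
    have "(\<Sum>b\<in>B. crd b y *\<^sub>R b) = (\<Sum>b\<in>B. if b = y then y else 0)"
      using \<open>y \<in> B\<close> by (intro sum.cong) (auto simp: crd(2))
    then show "y = (\<Sum>b\<in>B. crd b y *\<^sub>R b)"
      using fin \<open>y \<in> B\<close> by simp
  qed
  then show ?thesis
    using fin crd(1) by (rule that[rotated 2])
qed

lemma coord_tendsto_bracket:
  assumes "coord_tendsto X x" "coord_tendsto Y y"
  shows "coord_tendsto (\<lambda>n. bracket (X n) (Y n)) (bracket x y)"
proof -
  obtain B :: "'g set" and crd :: "'g \<Rightarrow> 'g \<Rightarrow> real" where B: "finite B" "\<And>b. linear (crd b)"
    and exp: "\<And>x. x = (\<Sum>b\<in>B. crd b x *\<^sub>R b)"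
    by (rule coordinates_exist) blast
  have eq: "bracket u v = (\<Sum>b\<in>B. \<Sum>d\<in>B. (crd d v * crd b u) *\<^sub>R bracket b d)" for u v
  proof -
    have "bracket u v = bracket (\<Sum>b\<in>B. crd b u *\<^sub>R b) (\<Sum>d\<in>B. crd d v *\<^sub>R d)"
      using exp[of u] exp[of v] by simp
    also have "\<dots> = (\<Sum>b\<in>B. bracket (crd b u *\<^sub>R b) (\<Sum>d\<in>B. crd d v *\<^sub>R d))"
      by (rule linear_sum[OF linear_bracket_left])
    also have "\<dots> = (\<Sum>b\<in>B. \<Sum>d\<in>B. (crd d v * crd b u) *\<^sub>R bracket b d)"
      by (simp only: linear_sum[OF linear_bracket_right] bracket_scale_left bracket_scale_right
          scaleR_scaleR scaleR_sum_right)
    finally show ?thesis .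
  qed
  have "coord_tendsto (\<lambda>n. \<Sum>b\<in>B. \<Sum>d\<in>B. (crd d (Y n) * crd b (X n)) *\<^sub>R bracket b d)
      (\<Sum>b\<in>B. \<Sum>d\<in>B. (crd d y * crd b x) *\<^sub>R bracket b d)"
    using assms B(2)
    by (intro coord_tendsto_sum coord_tendsto_scale coord_tendsto_const tendsto_mult coord_tendstoD)
  then show ?thesis
    by (simp only: eq[symmetric])
qed

lemma coord_tendsto_word_bracket:
  assumes "coord_tendsto X x" "coord_tendsto Y y"
  shows "coord_tendsto (\<lambda>n. word_bracket bracket (X n) (Y n) w) (word_bracket bracket x y w)"
proof (induction w rule: induct_list012)
  case (3 a b w)
  have "coord_tendsto (\<lambda>n. bracket (if a then X n else Y n) (word_bracket bracket (X n) (Y n) (b # w)))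
      (bracket (if a then x else y) (word_bracket bracket x y (b # w)))"
    using 3 assms by (intro coord_tendsto_bracket) auto
  then show ?case
    by (simp add: word_bracket_def)
qed (use assms in \<open>auto simp: word_bracket_def coord_tendsto_const\<close>)

lemma coord_tendsto_bch:
  assumes "coord_tendsto X x" "coord_tendsto Y y"
  shows "coord_tendsto (\<lambda>n. bch r bracket (X n) (Y n)) (bch r bracket x y)"
  unfolding bch_eq[OF r_pos]
  by (intro coord_tendsto_add coord_tendsto_sum coord_tendsto_scale tendsto_const
      coord_tendsto_word_bracket assms)

end

section \<open>Homogeneous norms on Carnot groups\<close>

locale homogeneous_carnot_group = carnot_group bracket V r gmul ginv
  for bracket :: "'g::real_vector \<Rightarrow> 'g \<Rightarrow> 'g" and V :: "nat \<Rightarrow> 'g set" and r :: nat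
    and gmul :: "'g \<Rightarrow> 'g \<Rightarrow> 'g" and ginv :: "'g \<Rightarrow> 'g" +
  fixes N :: "'g \<Rightarrow> real"
  assumes norm: "group_norm gmul ginv N" and homogeneous: "homogeneous V r N"
begin

sublocale G: group gmul 0 ginv
  by (rule group)

lemma gmul_commuting: "bracket x y = 0 \<Longrightarrow> gmul x y = x + y"
  by (simp add: gmul_eq_bch bch_commuting)

lemma ginv_eq: "ginv x = - x"
proof (rule G.inverse_unique)
  show "gmul x (- x) = 0"
    by (simp add: gmul_commuting bracket_minus_right alternating)
qed

lemma gmul_minus_cancel: "gmul (- x) (gmul x y) = y" "gmul x (gmul (- x) y) = y"
  using G.left_inverse[of x] G.right_inverse[of x]
  by (simp_all add: ginv_eq G.assoc[symmetric])

lemma N_nonneg: "N x \<ge> 0" and N_eq_0_iff: "N x = 0 \<longleftrightarrow> x = 0" and N_minus: "N (- x) = N x"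
  and N_gmul: "N (gmul x y) \<le> N x + N y"
  using norm by (auto simp: group_norm_def ginv_eq)

lemma N_le_add: "N x \<le> N y + N (gmul (- y) x)"
  using N_gmul[of y "gmul (- y) x"] by (simp add: gmul_minus_cancel)

text \<open>On a layer the dilation with parameter \<open>t\<close> is scaling by \<open>t ^ i\<close>.\<close>

lemma N_scale_layer:
  assumes "b \<in> V i" "i \<in> {1..r}"
  shows "N (s *\<^sub>R b) = root i \<bar>s\<bar> * N b"
proof -
  have pos: "N (t *\<^sub>R b) = root i t * N b" if "t > 0" for t
  proof -
    have "root i t > 0" "root i t ^ i = t"
      using that assms(2) by auto
    then show ?thesis
      using homogeneous[unfolded homogeneous_def, rule_format, of "root i t" b]
      by (simp add: carnot_dilation_of_layer[OF assms])
  qed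
  consider "s > 0" | "s = 0" | "s < 0"
    by linarith
  then show ?thesis
  proof cases
    case 2
    then show ?thesis
      using assms(2) by (simp add: N_eq_0_iff[of 0, simplified])
  next
    case 3
    then show ?thesis
      using pos[of "- s"] N_minus[of "s *\<^sub>R b"] by simp
  qed (simp add: pos)
qed

lemma coord_tendsto_gmul:
  "coord_tendsto X x \<Longrightarrow> coord_tendsto Y y \<Longrightarrow> coord_tendsto (\<lambda>n. gmul (X n) (Y n)) (gmul x y)"
  by (simp add: gmul_eq_bch coord_tendsto_bch)

definition N_continuous_at_0_on :: "'g set \<Rightarrow> bool" where
  "N_continuous_at_0_on S \<longleftrightarrow>
     (\<forall>X. (\<forall>n. X n \<in> S) \<longrightarrow> coord_tendsto X 0 \<longrightarrow> (\<lambda>n. N (X n)) \<longlonglongrightarrow> 0)"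

text \<open>Let \<open>s\<^sub>n\<close> be the \<open>b\<close>-coordinate of \<open>X\<^sub>n\<close>. The product \<open>Y\<^sub>n\<close> of \<open>- s\<^sub>n b\<close> and \<open>X\<^sub>n\<close> agrees with
  \<open>X\<^sub>n - s\<^sub>n b\<close> up to brackets, which lie in the next filtration step and hence in \<open>S\<close>. Both factors of
  \<open>X\<^sub>n = (s\<^sub>n b) Y\<^sub>n\<close> have small norm, the first one by homogeneity.\<close>

lemma N_continuous_at_0_on_insert:
  assumes S: "subspace S" "filtration (Suc i) \<subseteq> S" "S \<subseteq> filtration i"
    and b: "b \<in> V i" and i: "i \<in> {1..r}" and cont: "N_continuous_at_0_on S"
  shows "N_continuous_at_0_on (span (insert b S))"
proof (cases "b \<in> S")
  case True
  then have "span (insert b S) = S"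
    using S(1) by (simp add: insert_absorb span_eq_iff)
  then show ?thesis
    using cont by simp
next
  case False
  obtain f :: "'g \<Rightarrow> real" where f: "linear f" "f b = 1" "\<And>x. x \<in> S \<Longrightarrow> f x = 0"
    using linear_functional_vanishing_on[OF S(1) False] by blast
  have b_fil: "c *\<^sub>R b \<in> filtration i" for c
    using ext_layer_subset_filtration[of i i] b i subspace_scale[OF subspace_filtration]
    by (auto simp: ext_layer_def)
  show ?thesis
    unfolding N_continuous_at_0_on_def
  proof (intro allI impI)
    fix X assume X: "\<forall>n. X n \<in> span (insert b S)" and X0: "coord_tendsto X 0"
    define s where "s n = f (X n)" for n
    define Y where "Y n = gmul (- s n *\<^sub>R b) (X n)" for n
    have rest: "X n - s n *\<^sub>R b \<in> S" for n
    proof -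
      obtain k where "X n - k *\<^sub>R b \<in> span S"
        using X real_vector.span_breakdown_eq[of "X n" b S] by blast
      then have k: "X n - k *\<^sub>R b \<in> S"
        using S(1) by (simp add: span_eq_iff[THEN iffD2])
      then have "f (X n - k *\<^sub>R b) = 0"
        by (rule f(3))
      then have "k = s n"
        by (simp add: s_def linear_diff[OF f(1)] linear_cmul[OF f(1)] f(2))
      then show ?thesis
        using k by simp
    qed
    have "Y n \<in> S" for n
    proof -
      have "X n = (X n - s n *\<^sub>R b) + s n *\<^sub>R b"
        by simp
      moreover have "(X n - s n *\<^sub>R b) + s n *\<^sub>R b \<in> filtration i"
        using rest[of n] S(3) by (intro subspace_add[OF subspace_filtration] b_fil) auto
      ultimately have "X n \<in> filtration i"
        by simp
      then have "Y n - (- s n *\<^sub>R b + X n) \<in> filtration (Suc i)"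
        unfolding Y_def gmul_eq_bch using i by (intro bch_mod_filtration b_fil) auto
      then have "(Y n - (- s n *\<^sub>R b + X n)) + (X n - s n *\<^sub>R b) \<in> S"
        using S(2) by (intro subspace_add[OF S(1)] rest) auto
      then show ?thesis
        by simp
    qed
    moreover have "s \<longlonglongrightarrow> 0"
      using coord_tendstoD[OF X0 f(1)] by (simp add: s_def[abs_def] linear_0[OF f(1)])
    then have "coord_tendsto (\<lambda>n. - s n *\<^sub>R b) (- 0 *\<^sub>R b)"
      by (intro coord_tendsto_scale tendsto_minus coord_tendsto_const)
    then have "coord_tendsto Y (gmul (- 0 *\<^sub>R b) 0)"
      unfolding Y_def by (intro coord_tendsto_gmul X0)
    ultimately have "(\<lambda>n. N (Y n)) \<longlonglongrightarrow> 0"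
      using cont unfolding N_continuous_at_0_on_def by simp
    moreover have "(\<lambda>n. N (s n *\<^sub>R b)) \<longlonglongrightarrow> 0"
    proof -
      have "(\<lambda>n. root i \<bar>s n\<bar> * N b) \<longlonglongrightarrow> root i \<bar>0\<bar> * N b"
        by (intro tendsto_intros \<open>s \<longlonglongrightarrow> 0\<close>)
      then show ?thesis
        by (simp add: N_scale_layer[OF b i])
    qed
    ultimately have "(\<lambda>n. N (s n *\<^sub>R b) + N (Y n)) \<longlonglongrightarrow> 0 + 0"
      by (rule tendsto_add[rotated])
    moreover have "N (X n) \<le> N (s n *\<^sub>R b) + N (Y n)" for n
      using N_le_add[of "X n" "s n *\<^sub>R b"] by (simp add: Y_def)
    ultimately show "(\<lambda>n. N (X n)) \<longlonglongrightarrow> 0"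
      using tendsto_sandwich[of "\<lambda>_. 0" "\<lambda>n. N (X n)" sequentially "\<lambda>n. N (s n *\<^sub>R b) + N (Y n)" 0] N_nonneg
      by simp
  qed
qed

text \<open>The \<open>i\<close>-th filtration step arises from the next one by adding finitely many vectors that span the
  layer \<open>V i\<close>.\<close>

lemma N_continuous_at_0_on_filtration_step:
  assumes i: "i \<in> {1..r}" and cont: "N_continuous_at_0_on (filtration (Suc i))"
  shows "N_continuous_at_0_on (filtration i)"
proof -
  obtain B :: "'g set" and crd :: "'g \<Rightarrow> 'g \<Rightarrow> real" where B: "finite B"
    and exp: "\<And>x. x = (\<Sum>b\<in>B. crd b x *\<^sub>R b)"
    by (rule coordinates_exist) blast
  define F where "F = (\<lambda>b. layer V r b i) ` B"
  have F: "finite F" "F \<subseteq> V i"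
    using B layer_in[OF i] by (auto simp: F_def)
  have V_fil: "V i \<subseteq> filtration i"
    using ext_layer_subset_filtration[of i i] i by (auto simp: ext_layer_def)
  have "N_continuous_at_0_on (span (F \<union> filtration (Suc i)))"
    using F
  proof (induction F)
    case empty
    then show ?case
      using cont by (simp add: span_eq_iff[THEN iffD2] subspace_filtration)
  next
    case (insert b F)
    let ?S = "span (F \<union> filtration (Suc i))"
    have "F \<union> filtration (Suc i) \<subseteq> filtration i"
      using insert.prems V_fil filtration_antimono[of i "Suc i"] by auto
    then have "?S \<subseteq> filtration i"
      by (rule span_minimal[OF _ subspace_filtration])
    moreover have "filtration (Suc i) \<subseteq> ?S"
      by (auto intro: span_base)
    ultimately have cont_insert: "N_continuous_at_0_on (span (insert b ?S))"
      using insert i by (intro N_continuous_at_0_on_insert[of ?S i]) auto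
    have "span (insert b F \<union> filtration (Suc i)) \<subseteq> span (insert b ?S)"
      by (intro span_mono) (auto intro: span_base)
    then show ?case
      using cont_insert unfolding N_continuous_at_0_on_def by (meson subsetD)
  qed
  moreover have "filtration i \<subseteq> span (F \<union> filtration (Suc i))"
  proof
    fix x assume x: "x \<in> filtration i"
    have "layer V r x i = layer V r (\<Sum>b\<in>B. crd b x *\<^sub>R b) i"
      using exp[of x] by simp
    also have "\<dots> = (\<Sum>b\<in>B. crd b x *\<^sub>R layer V r b i)"
      by (simp only: linear_sum[OF linear_layer] layer_scale)
    also have "\<dots> \<in> span (F \<union> filtration (Suc i))"
      by (intro span_sum span_scale span_base) (auto simp: F_def)
    finally have "layer V r x i \<in> span (F \<union> filtration (Suc i))" .
    moreover have "x - layer V r x i \<in> filtration (Suc i)"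
      using x layer_of_layer[OF layer_in[OF i] i]
      by (auto simp: filtration_def less_Suc_eq linear_diff[OF linear_layer])
    ultimately have "layer V r x i + (x - layer V r x i) \<in> span (F \<union> filtration (Suc i))"
      by (intro span_add) (auto intro: span_base)
    then show "x \<in> span (F \<union> filtration (Suc i))"
      by simp
  qed
  ultimately show ?thesis
    unfolding N_continuous_at_0_on_def by (meson subsetD)
qed

lemma N_tendsto_0:
  assumes "coord_tendsto X 0"
  shows "(\<lambda>n. N (X n)) \<longlonglongrightarrow> 0"
proof -
  have "N_continuous_at_0_on (filtration (Suc r - k))" if "k \<le> r" for k
    using that
  proof (induction k)
    case 0
    show ?case
      unfolding N_continuous_at_0_on_def
    proof (intro allI impI)
      fix X :: "nat \<Rightarrow> 'g" assume "\<forall>n. X n \<in> filtration (Suc r - 0)"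
      then have "X n = 0" for n
        using filtration_above by simp
      then show "(\<lambda>n. N (X n)) \<longlonglongrightarrow> 0"
        using N_eq_0_iff[of 0] by simp
    qed
  next
    case (Suc k)
    then have eq: "Suc (Suc r - Suc k) = Suc r - k"
      by simp
    have "N_continuous_at_0_on (filtration (Suc r - k))"
      using Suc by simp
    then show ?case
      using Suc.prems by (intro N_continuous_at_0_on_filtration_step[of "Suc r - Suc k", unfolded eq]) auto
  qed
  from this[of r] have "N_continuous_at_0_on UNIV"
    using filtration_1 by simp
  then show ?thesis
    using assms by (simp add: N_continuous_at_0_on_def)
qed

lemma N_diff_tendsto_0:
  assumes "coord_tendsto X x"
  shows "(\<lambda>n. N (gmul (- X n) x)) \<longlonglongrightarrow> 0"
proof (rule N_tendsto_0)
  have "coord_tendsto (\<lambda>n. gmul (- X n) x) (gmul (- x) x)"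
    by (intro coord_tendsto_gmul coord_tendsto_minus assms coord_tendsto_const)
  then show "coord_tendsto (\<lambda>n. gmul (- X n) x) 0"
    using G.left_inverse[of x] by (simp add: ginv_eq)
qed

end

section \<open>Boundedness in a homogeneous norm and coordinatewise compactness\<close>

lemma simultaneously_convergent_subsequence:
  fixes f :: "'i \<Rightarrow> nat \<Rightarrow> real"
  assumes "finite I" "\<And>i. i \<in> I \<Longrightarrow> bounded (range (f i))"
  shows "\<exists>\<sigma> :: nat \<Rightarrow> nat. strict_mono \<sigma> \<and> (\<forall>i\<in>I. convergent (f i \<circ> \<sigma>))"
  using assms
proof (induction I)
  case empty
  show ?case
    by (rule exI[of _ id]) (simp add: strict_mono_def)
next
  case (insert i I)
  have "\<exists>\<sigma> :: nat \<Rightarrow> nat. strict_mono \<sigma> \<and> (\<forall>j\<in>I. convergent (f j \<circ> \<sigma>))"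
    using insert.prems by (intro insert.IH) simp
  then obtain \<sigma> :: "nat \<Rightarrow> nat" where \<sigma>: "strict_mono \<sigma>" "\<forall>j\<in>I. convergent (f j \<circ> \<sigma>)"
    by blast
  have "bounded (range (f i \<circ> \<sigma>))"
    using insert.prems[of i] by (auto intro: bounded_subset)
  then obtain l \<tau> where \<tau>: "strict_mono \<tau>" "((f i \<circ> \<sigma>) \<circ> \<tau>) \<longlonglongrightarrow> l"
    using bounded_imp_convergent_subsequence by blast
  have "convergent (f j \<circ> (\<sigma> \<circ> \<tau>))" if "j \<in> insert i I" for j
  proof (cases "j = i")
    case True
    then show ?thesis
      using \<tau>(2) by (auto simp: convergent_def o_assoc)
  next
    case False
    then have "convergent (f j \<circ> \<sigma>)"
      using \<sigma>(2) that by blast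
    then show ?thesis
      using LIMSEQ_subseq_LIMSEQ[OF _ \<tau>(1)] by (fastforce simp: convergent_def o_assoc)
  qed
  then show ?case
    using strict_mono_o[OF \<sigma>(1) \<tau>(1)] by blast
qed

context stratified_lie_algebra
begin

text \<open>The sum of the absolute values of the coordinates of all layers. Along the dilations of \<open>g\<close> it is the
  polynomial \<open>p t = (\<Sum>\<^sub>i t ^ i * s\<^sub>i)\<close> with \<open>s\<^sub>i \<ge> 0\<close> and \<open>i \<ge> 1\<close>, so the intermediate value theorem yields
  the parameter \<open>t\<close> at which the dilated element has size one.\<close>

lemma graded_coordinate_norm:
  obtains S :: "'g \<Rightarrow> real" where
    "S 0 = 0"
    "\<And>X x. coord_tendsto X x \<Longrightarrow> (\<lambda>n. S (X n)) \<longlonglongrightarrow> S x"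
    "\<And>(X :: nat \<Rightarrow> 'g) C. (\<And>n. S (X n) \<le> C) \<Longrightarrow>
      \<exists>(\<sigma> :: nat \<Rightarrow> nat) x. strict_mono \<sigma> \<and> coord_tendsto (X \<circ> \<sigma>) x"
    "\<And>g. S g > 1 \<Longrightarrow> \<exists>t. 0 < t \<and> t \<le> 1 \<and> S (carnot_dilation V r t g) = 1 \<and> t ^ r * S g \<le> 1"
proof -
  obtain B :: "'g set" and crd :: "'g \<Rightarrow> 'g \<Rightarrow> real" where B: "finite B" "\<And>b. linear (crd b)"
    and exp: "\<And>x. x = (\<Sum>b\<in>B. crd b x *\<^sub>R b)"
    by (rule coordinates_exist) blast
  define \<phi> where "\<phi> = (\<lambda>(i, b) x. crd b (layer V r x i))"
  define I where "I = {1..r} \<times> B"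
  define S where "S x = (\<Sum>j\<in>I. \<bar>\<phi> j x\<bar>)" for x
  have I: "finite I"
    using B(1) by (simp add: I_def)
  have lin: "linear (\<phi> j)" for j
    using linear_compose[OF linear_layer B(2)] by (cases j) (simp add: \<phi>_def o_def)
  have exp_\<phi>: "x = (\<Sum>j\<in>I. \<phi> j x *\<^sub>R snd j)" for x
  proof -
    have "x = (\<Sum>i=1..r. \<Sum>b\<in>B. crd b (layer V r x i) *\<^sub>R b)"
      using sum_layers[of x] exp by simp
    also have "\<dots> = (\<Sum>j\<in>I. \<phi> j x *\<^sub>R snd j)"
      unfolding I_def sum.cartesian_product by (simp add: \<phi>_def case_prod_unfold)
    finally show ?thesis .
  qed
  have \<phi>_le: "\<bar>\<phi> j x\<bar> \<le> S x" if "j \<in> I" for j x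
    unfolding S_def using that I by (intro member_le_sum) auto
  show ?thesis
  proof
    show "S 0 = 0"
      by (simp add: S_def linear_0[OF lin])
    show "(\<lambda>n. S (X n)) \<longlonglongrightarrow> S x" if "coord_tendsto X x" for X x
      unfolding S_def by (intro tendsto_sum tendsto_rabs coord_tendstoD[OF that lin])
    show "\<exists>(\<sigma> :: nat \<Rightarrow> nat) x. strict_mono \<sigma> \<and> coord_tendsto (X \<circ> \<sigma>) x" if C: "\<And>n. S (X n) \<le> C" for X :: "nat \<Rightarrow> 'g" and C
    proof -
      have "bounded (range (\<lambda>n. \<phi> j (X n)))" if "j \<in> I" for j
        using \<phi>_le[OF that] C by (auto simp: bounded_iff intro: order_trans)
      then obtain \<sigma> :: "nat \<Rightarrow> nat" where \<sigma>: "strict_mono \<sigma>"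
        "\<forall>j\<in>I. convergent ((\<lambda>n. \<phi> j (X n)) \<circ> \<sigma>)"
        using simultaneously_convergent_subsequence[OF I, of "\<lambda>j n. \<phi> j (X n)"] by blast
      define L where "L j = lim ((\<lambda>n. \<phi> j (X n)) \<circ> \<sigma>)" for j
      have L: "(\<lambda>n. \<phi> j (X (\<sigma> n))) \<longlonglongrightarrow> L j" if "j \<in> I" for j
        using \<sigma>(2) that unfolding L_def convergent_LIMSEQ_iff by (simp add: o_def)
      have "coord_tendsto (\<lambda>n. \<Sum>j\<in>I. \<phi> j (X (\<sigma> n)) *\<^sub>R snd j) (\<Sum>j\<in>I. L j *\<^sub>R snd j)"
        by (intro coord_tendsto_sum coord_tendsto_scale coord_tendsto_const L)
      then have "coord_tendsto (X \<circ> \<sigma>) (\<Sum>j\<in>I. L j *\<^sub>R snd j)"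
        by (simp add: o_def exp_\<phi>[symmetric])
      then show ?thesis
        using \<sigma>(1) by blast
    qed
    fix g assume g: "S g > 1"
    have S_dil: "S (carnot_dilation V r t g) = (\<Sum>j\<in>I. t ^ fst j * \<bar>\<phi> j g\<bar>)" if "t \<ge> 0" for t
      unfolding S_def using that
      by (intro sum.cong)
        (auto simp: \<phi>_def layer_carnot_dilation linear_cmul[OF B(2)] abs_mult I_def)
    define p where "p t = (\<Sum>j\<in>I. t ^ fst j * \<bar>\<phi> j g\<bar>)" for t :: real
    have "p 0 = 0"
      unfolding p_def by (intro sum.neutral) (auto simp: I_def)
    moreover have "p 1 = S g"
      by (simp add: p_def S_def)
    moreover have "continuous_on {0..1} p"
      unfolding p_def by (intro continuous_intros)
    ultimately obtain t where t: "0 \<le> t" "t \<le> 1" "p t = 1"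
      using IVT'[of p 0 1 1] g by auto
    have "t \<noteq> 0"
      using t(3) \<open>p 0 = 0\<close> by auto
    have "t ^ r * S g = (\<Sum>j\<in>I. t ^ r * \<bar>\<phi> j g\<bar>)"
      by (simp add: S_def sum_distrib_left)
    also have "\<dots> \<le> p t"
      unfolding p_def using t by (intro sum_mono mult_right_mono power_decreasing) (auto simp: I_def)
    finally have "t ^ r * S g \<le> 1"
      by (simp add: t)
    then show "\<exists>t. 0 < t \<and> t \<le> 1 \<and> S (carnot_dilation V r t g) = 1 \<and> t ^ r * S g \<le> 1"
      using t \<open>t \<noteq> 0\<close> S_dil[of t] by (intro exI[of _ t]) (auto simp: p_def)
  qed
qed

end

context homogeneous_carnot_group
begin

text \<open>On the elements of coordinate size one \<open>N\<close> has a positive lower bound \<open>c\<close>: otherwise, by compactness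
  in coordinates and continuity of \<open>N\<close> at \<open>0\<close>, an element of size one would have norm \<open>0\<close>. Dilations
  carry this over to all elements, so a bound on \<open>N\<close> bounds the coordinates.\<close>

lemma N_bounded_imp_coord_subsequence:
  fixes X :: "nat \<Rightarrow> 'g"
  assumes bdd: "\<And>n. N (X n) \<le> R"
  shows "\<exists>(\<sigma> :: nat \<Rightarrow> nat) x. strict_mono \<sigma> \<and> coord_tendsto (X \<circ> \<sigma>) x"
proof -
  obtain S :: "'g \<Rightarrow> real" where S0: "S 0 = 0"
    and S_cont: "\<And>X x. coord_tendsto X x \<Longrightarrow> (\<lambda>n. S (X n)) \<longlonglongrightarrow> S x"
    and S_sub: "\<And>(X :: nat \<Rightarrow> 'g) C. (\<And>n. S (X n) \<le> C) \<Longrightarrow>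
      \<exists>(\<sigma> :: nat \<Rightarrow> nat) x. strict_mono \<sigma> \<and> coord_tendsto (X \<circ> \<sigma>) x"
    and S_dil: "\<And>g. S g > 1 \<Longrightarrow> \<exists>t. 0 < t \<and> t \<le> 1 \<and> S (carnot_dilation V r t g) = 1 \<and> t ^ r * S g \<le> 1"
    by (rule graded_coordinate_norm) blast
  have "\<exists>c>0. \<forall>g. S g = 1 \<longrightarrow> c \<le> N g"
  proof (rule ccontr)
    assume "\<not> ?thesis"
    then have "\<exists>g. S g = 1 \<and> N g < 1 / real (Suc n)" for n
      by (force simp: not_le)
    then obtain Y where Y: "\<And>n. S (Y n) = 1" "\<And>n. N (Y n) < 1 / real (Suc n)"
      by metis
    obtain \<sigma> y where \<sigma>: "strict_mono \<sigma>" "coord_tendsto (Y \<circ> \<sigma>) y"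
      using S_sub[of Y 1] Y(1) by auto
    have "S y = 1"
      using S_cont[OF \<sigma>(2)] by (simp add: Y(1) LIMSEQ_const_iff)
    have "(\<lambda>n. N (Y (\<sigma> n))) \<longlonglongrightarrow> 0"
    proof (rule tendsto_sandwich[of "\<lambda>_. 0" _ _ "\<lambda>n. 1 / real (Suc n)"])
      have "1 / real (Suc (\<sigma> n)) \<le> 1 / real (Suc n)" for n
        using seq_suble[OF \<sigma>(1), of n] by (intro divide_left_mono) auto
      then show "eventually (\<lambda>n. N (Y (\<sigma> n)) \<le> 1 / real (Suc n)) sequentially"
        using Y(2) by (intro always_eventually allI) (meson less_imp_le order_trans)
      show "(\<lambda>n. 1 / real (Suc n)) \<longlonglongrightarrow> 0"
        using LIMSEQ_inverse_real_of_nat by (simp add: inverse_eq_divide)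
    qed (simp_all add: N_nonneg)
    moreover have "(\<lambda>n. N (gmul (- Y (\<sigma> n)) y)) \<longlonglongrightarrow> 0"
      using N_diff_tendsto_0[OF \<sigma>(2)] by simp
    ultimately have "(\<lambda>n. N (Y (\<sigma> n)) + N (gmul (- Y (\<sigma> n)) y)) \<longlonglongrightarrow> 0 + 0"
      by (rule tendsto_add)
    then have "N y \<le> 0 + 0"
      by (rule LIMSEQ_le_const) (auto intro: N_le_add)
    then have "y = 0"
      using N_nonneg[of y] N_eq_0_iff[of y] by simp
    then show False
      using S0 \<open>S y = 1\<close> by simp
  qed
  then obtain c where c: "c > 0" "\<And>g. S g = 1 \<Longrightarrow> c \<le> N g"
    by blast
  have "S (X n) \<le> max 1 ((R / c) ^ r)" for n
  proof (cases "S (X n) > 1")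
    case True
    then obtain t where t: "0 < t" "t \<le> 1" "S (carnot_dilation V r t (X n)) = 1" "t ^ r * S (X n) \<le> 1"
      using S_dil by blast
    have "c \<le> N (carnot_dilation V r t (X n))"
      by (rule c(2)[OF t(3)])
    also have "\<dots> = t * N (X n)"
      using homogeneous t(1) by (simp add: homogeneous_def)
    also have "\<dots> \<le> t * R"
      using bdd t(1) by (intro mult_left_mono) auto
    finally have "1 / t \<le> R / c"
      using t(1) c(1) by (simp add: field_simps)
    then have "(1 / t) ^ r \<le> (R / c) ^ r"
      using t(1) by (intro power_mono) auto
    moreover have "S (X n) \<le> (1 / t) ^ r"
      using t(1,4) by (simp add: field_simps power_divide)
    ultimately show ?thesis
      by simp
  qed simp
  then show ?thesis
    by (rule S_sub)
qed

end

section \<open>The metric of a horizontally strictly convex norm\<close>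

text \<open>A sequence of points that violates the gap for parameters tending to \<open>0\<close> is bounded, and a limit of a
  subsequence lies between \<open>x\<close> and \<open>y\<close> at distance at least \<open>\<eta>\<close> from both.\<close>

lemma gap_if_no_between:
  fixes x y :: "'a::metric_space"
  assumes proper: "\<And>(p::'a) R. compact (cball p R)"
    and nb: "\<And>z. dist x z + dist z y = dist x y \<Longrightarrow> z = x \<or> z = y" and \<eta>: "\<eta> > 0"
  shows "\<exists>\<kappa>>0. \<kappa> < 1 \<and>
    (\<forall>z. (1 - \<kappa>) * (dist x z + dist z y) < dist x y \<longrightarrow> dist z x < \<eta> \<or> dist z y < \<eta>)"
proof (rule ccontr)
  assume no: "\<not> ?thesis"
  define \<kappa> where "\<kappa> n = inverse (real (Suc (Suc n)))" for n
  have \<kappa>: "\<kappa> n > 0" "\<kappa> n \<le> 1 / 2" for n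
    by (auto simp: \<kappa>_def field_simps)
  have "\<exists>z. (1 - \<kappa> n) * (dist x z + dist z y) < dist x y \<and> dist z x \<ge> \<eta> \<and> dist z y \<ge> \<eta>" for n
    using no \<kappa>[of n] by (force simp: not_less)
  then obtain z where z: "\<And>n. (1 - \<kappa> n) * (dist x (z n) + dist (z n) y) < dist x y"
    "\<And>n. dist (z n) x \<ge> \<eta>" "\<And>n. dist (z n) y \<ge> \<eta>"
    by metis
  have "z n \<in> cball x (2 * dist x y)" for n
  proof -
    have "1 / 2 * (dist x (z n) + dist (z n) y) \<le> (1 - \<kappa> n) * (dist x (z n) + dist (z n) y)"
      using \<kappa>(2)[of n] by (intro mult_right_mono) auto
    then have "1 / 2 * (dist x (z n) + dist (z n) y) < dist x y"
      using z(1)[of n] by (rule le_less_trans)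
    then have "dist x (z n) + dist (z n) y \<le> 2 * dist x y"
      by simp
    moreover have "dist x (z n) \<le> dist x (z n) + dist (z n) y"
      by simp
    ultimately show ?thesis
      unfolding mem_cball by (rule order_trans[rotated])
  qed
  then obtain l \<sigma> where \<sigma>: "strict_mono \<sigma>" "(z \<circ> \<sigma>) \<longlonglongrightarrow> l"
    using proper[of x "2 * dist x y"] unfolding compact_eq_seq_compact_metric seq_compact_def by metis
  have lim: "(\<lambda>n. z (\<sigma> n)) \<longlonglongrightarrow> l"
    using \<sigma>(2) by (simp add: o_def)
  have "\<kappa> \<longlonglongrightarrow> 0"
    unfolding \<kappa>_def by (rule LIMSEQ_Suc[OF LIMSEQ_inverse_real_of_nat])
  then have "(\<lambda>n. \<kappa> (\<sigma> n)) \<longlonglongrightarrow> 0"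
    using LIMSEQ_subseq_LIMSEQ[OF _ \<sigma>(1)] by (simp add: o_def)
  then have "(\<lambda>n. (1 - \<kappa> (\<sigma> n)) * (dist x (z (\<sigma> n)) + dist (z (\<sigma> n)) y)) \<longlonglongrightarrow> (1 - 0) * (dist x l + dist l y)"
    by (intro tendsto_intros lim)
  then have "(1 - 0) * (dist x l + dist l y) \<le> dist x y"
    using z(1) by (intro LIMSEQ_le_const2) (auto intro: less_imp_le)
  then have "dist x l + dist l y = dist x y"
    using dist_triangle[of x y l] by simp
  moreover have "(\<lambda>n. dist (z (\<sigma> n)) x) \<longlonglongrightarrow> dist l x" "(\<lambda>n. dist (z (\<sigma> n)) y) \<longlonglongrightarrow> dist l y"
    by (intro tendsto_intros lim)+
  then have "\<eta> \<le> dist l x" "\<eta> \<le> dist l y"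
    using z(2,3) by (auto intro: LIMSEQ_le_const)
  ultimately show False
    using nb[of l] \<eta> by auto
qed

theorem theorem7p1:
  fixes bracket gmul :: "'g::{real_vector, metric_space} \<Rightarrow> 'g \<Rightarrow> 'g"
    and V :: "nat \<Rightarrow> 'g set" and r :: nat
    and ginv :: "'g \<Rightarrow> 'g" and N :: "'g \<Rightarrow> real"
  assumes "carnot_group bracket V r gmul ginv"
    and "\<exists>g h. gmul g h \<noteq> gmul h g"
    and "group_norm gmul ginv N"
    and "homogeneous V r N"
    and "horizontally_strictly_convex V gmul N"
    and "\<forall>g h. dist g h = N (gmul (ginv g) h)"
  shows "prague_space TYPE('g) \<and> lipschitz_free_rigid TYPE('g)"
proof -
  interpret homogeneous_carnot_group bracket V r gmul ginv N
    using assms(1,3,4) by (simp add: homogeneous_carnot_group_def homogeneous_carnot_group_axioms_def)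
  have dist_eq: "dist g h = N (gmul (- g) h)" for g h
    using assms(6) by (simp add: ginv_eq)
  have left_inv: "gmul (- gmul p g) (gmul p h) = gmul (- g) h" for p g h
    using G.inverse_distrib_swap[of p g] G.left_inverse[of p] by (simp add: ginv_eq G.assoc gmul_minus_cancel)
  have proper: "compact (cball p R)" for p :: 'g and R
    unfolding compact_eq_seq_compact_metric seq_compact_def
  proof (intro allI impI)
    fix X :: "nat \<Rightarrow> 'g" assume X: "\<forall>n. X n \<in> cball p R"
    define Y where "Y n = gmul (- p) (X n)" for n
    have "N (Y n) \<le> R" for n
      using X by (simp add: Y_def dist_eq)
    then obtain \<sigma> y where \<sigma>: "strict_mono \<sigma>" "coord_tendsto (Y \<circ> \<sigma>) y"
      using N_bounded_imp_coord_subsequence[of Y R] by blast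
    have X_eq: "X n = gmul p (Y n)" for n
      by (simp add: Y_def gmul_minus_cancel)
    have "(\<lambda>n. dist ((X \<circ> \<sigma>) n) (gmul p y)) \<longlonglongrightarrow> 0"
      using N_diff_tendsto_0[OF \<sigma>(2)] by (simp add: X_eq dist_eq left_inv)
    then have lim: "(X \<circ> \<sigma>) \<longlonglongrightarrow> gmul p y"
      by (rule tendsto_dist_iff[THEN iffD2])
    moreover have "gmul p y \<in> cball p R"
      using X by (intro closed_sequentially[OF closed_cball _ lim]) auto
    ultimately show "\<exists>l\<in>cball p R. \<exists>\<sigma>. strict_mono \<sigma> \<and> (X \<circ> \<sigma>) \<longlonglongrightarrow> l"
      using \<sigma>(1) by blast
  qed
  have V1: "1 \<in> {1..r}"
    using r_pos by simp
  have edge: "(x, y) \<in> E_ext" if nh: "gmul (- x) y \<notin> V 1" for x y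
  proof (rule E_extI_gap)
    show "x \<noteq> y"
    proof
      assume "x = y"
      then have "gmul (- x) y = 0"
        using G.left_inverse[of x] by (simp add: ginv_eq)
      then show False
        using nh subspace_0[OF subspace[OF V1]] by simp
    qed
    fix \<eta> :: real assume "\<eta> > 0"
    show "\<exists>\<kappa>>0. \<kappa> < 1 \<and>
      (\<forall>z. (1 - \<kappa>) * (dist x z + dist z y) < dist x y \<longrightarrow> dist z x < \<eta> \<or> dist z y < \<eta>)"
    proof (rule gap_if_no_between[OF proper _ \<open>\<eta> > 0\<close>], rule ccontr)
      fix z assume between: "dist x z + dist z y = dist x y" and "\<not> (z = x \<or> z = y)"
      let ?g = "gmul (- x) z" and ?h = "gmul (- z) y"
      have gh: "gmul ?g ?h = gmul (- x) y"
        by (simp add: G.assoc gmul_minus_cancel)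
      have "?g \<noteq> 0" "?h \<noteq> 0"
        using \<open>\<not> (z = x \<or> z = y)\<close> dist_eq[of x z] dist_eq[of z y] N_eq_0_iff by (metis dist_eq_0_iff)+
      moreover have "N (gmul ?g ?h) = N ?g + N ?h"
        using between by (simp add: gh dist_eq)
      ultimately obtain w where w: "w \<in> V 1" "?g \<in> horizontal_line w" "?h \<in> horizontal_line w"
        using assms(5) unfolding horizontally_strictly_convex_def by blast
      then obtain s t where st: "?g = s *\<^sub>R w" "?h = t *\<^sub>R w"
        by (auto simp: horizontal_line_def)
      have "gmul ?g ?h = s *\<^sub>R w + t *\<^sub>R w"
        unfolding st by (rule gmul_commuting) (simp add: bracket_scale_left bracket_scale_right alternating)
      also have "\<dots> \<in> V 1"
        by (intro subspace_add[OF subspace[OF V1]] subspace_scale[OF subspace[OF V1]] w(1))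
      finally show False
        using nh by (simp add: gh)
    qed
  qed
  have "\<exists>g h. bracket g h \<noteq> 0"
  proof (rule ccontr)
    assume "\<not> ?thesis"
    then have "gmul g h = g + h" for g h
      by (intro gmul_commuting) blast
    then show False
      using assms(2) by (simp add: add.commute)
  qed
  then obtain s c where s: "2 \<le> s" "s \<le> r" and c: "c \<in> V s" "c \<noteq> 0" "\<And>x. bracket x c = 0"
    using central_element_exists by metis
  have s_in: "s \<in> {1..r}"
    using s by simp
  have c_not: "\<tau> = 0" if "\<tau> *\<^sub>R c \<in> V 1" for \<tau>
  proof -
    have "\<tau> *\<^sub>R c \<in> V s"
      by (intro subspace_scale[OF subspace[OF s_in]] c(1))
    then have "layer V r (\<tau> *\<^sub>R c) s = \<tau> *\<^sub>R c"
      using layer_of_layer[OF _ s_in] by simp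
    moreover have "layer V r (\<tau> *\<^sub>R c) s = 0"
      using layer_of_layer[OF that V1, of s] s(1) by simp
    ultimately show ?thesis
      using c(2) by simp
  qed
  \<comment> \<open>The line \<open>y + \<tau> c\<close> meets each left translate \<open>p V\<^sub>1\<close> for at
    most one parameter \<open>\<tau>\<close>.\<close>
  have dense: "\<exists>w. dist y w < e \<and> (\<forall>p\<in>P. (p, w) \<in> E_ext)" if P: "finite P" and e: "e > 0" for P and y :: 'g and e :: real
  proof -
    define Bad where "Bad p = {\<tau>. gmul (- p) y + \<tau> *\<^sub>R c \<in> V 1}" for p
    have "finite (Bad p)" for p
    proof (rule finite_subset)
      define \<tau>0 where "\<tau>0 = (SOME \<tau>. \<tau> \<in> Bad p)"
      show "Bad p \<subseteq> {\<tau>0}"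
      proof
        fix \<tau> assume \<tau>: "\<tau> \<in> Bad p"
        then have "\<tau>0 \<in> Bad p"
          unfolding \<tau>0_def by (rule someI)
        then have "(gmul (- p) y + \<tau> *\<^sub>R c) - (gmul (- p) y + \<tau>0 *\<^sub>R c) \<in> V 1"
          using \<tau> by (intro subspace_diff[OF subspace[OF V1]]) (auto simp: Bad_def)
        then show "\<tau> \<in> {\<tau>0}"
          using c_not[of "\<tau> - \<tau>0"] by (simp add: scaleR_diff_left)
      qed
    qed simp
    then have fin: "finite (\<Union>p\<in>P. Bad p)"
      using P by blast
    \<comment> \<open>Homogeneity gives \<open>d(y, w) = root s \<bar>\<tau>\<bar> * N c\<close>, which is less than
      \<open>e\<close> when \<open>0 < \<tau> < \<epsilon>\<close>.\<close>
    define \<epsilon> where "\<epsilon> = (e / (N c + 1)) ^ s"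
    have "e / (N c + 1) > 0"
      using e N_nonneg[of c] by (intro divide_pos_pos) auto
    then have "\<epsilon> > 0"
      by (simp add: \<epsilon>_def)
    then have "infinite {0<..<\<epsilon>}"
      by (simp add: infinite_Ioo)
    then obtain \<tau> where \<tau>: "\<tau> \<in> {0<..<\<epsilon>}" "\<tau> \<notin> (\<Union>p\<in>P. Bad p)"
      using fin by (meson finite_subset subsetI)
    define w where "w = gmul y (\<tau> *\<^sub>R c)"
    have "dist y w = root s \<bar>\<tau>\<bar> * N c"
      by (simp add: dist_eq w_def gmul_minus_cancel N_scale_layer[OF c(1) s_in])
    also have "root s \<bar>\<tau>\<bar> < e / (N c + 1)"
    proof -
      have "root s \<tau> < root s \<epsilon>"
        using \<tau>(1) s by (intro real_root_less_mono) auto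
      also have "root s \<epsilon> = e / (N c + 1)"
        unfolding \<epsilon>_def using \<open>e / (N c + 1) > 0\<close> s by (intro real_root_power_cancel) auto
      finally show ?thesis
        using \<tau>(1) by simp
    qed
    then have "root s \<bar>\<tau>\<bar> * N c \<le> e / (N c + 1) * N c"
      using N_nonneg by (intro mult_right_mono) auto
    also have "\<dots> < e"
      using e N_nonneg[of c] by (simp add: pos_divide_less_eq add_nonneg_pos)
    finally have "dist y w < e" .
    moreover have "(p, w) \<in> E_ext" if "p \<in> P" for p
    proof (rule edge)
      have "gmul (- p) w = gmul (gmul (- p) y) (\<tau> *\<^sub>R c)"
        by (simp add: w_def G.assoc)
      also have "\<dots> = gmul (- p) y + \<tau> *\<^sub>R c"
        by (rule gmul_commuting) (simp add: bracket_scale_right c(3))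
      finally show "gmul (- p) w \<notin> V 1"
        using \<tau>(2) that by (auto simp: Bad_def)
    qed
    ultimately show ?thesis
      by blast
  qed
  have "\<exists>w. \<forall>p\<in>P. (p, w) \<in> E_ext" if "finite P" for P :: "'g set"
    using dense[OF that zero_less_one] by blast
  then show ?thesis
    using prague_spaceI[OF dense] lipschitz_free_rigidI[OF proper] by blast
qed

end
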